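(* Let $(E,\mathcal{P})$ be a random locally convex module over $\mathbb{R}$ with base $(\Omega,\mathcal{F},P)$ such that $E$ has the countable concatenation property and $f:E\to\bar L^0(\mathcal{F})$ a local function. Then $f^{\ast\ast}_c=Cl_c(f)$.
   Context: $(\Omega,\mathcal{F},P)$ is a probability space. $L^0(\mathcal{F})$ (resp. $\bar L^0(\mathcal{F})$) is the set of equivalence classes (a.s. equality) of real (resp. extended real)-valued $\mathcal{F}$-measurable random variables, with the a.s. order; $\bar L^0(\mathcal{F})$ is a complete lattice, with suprema $\bigvee$ and infima $\bigwedge$. $L^0_+(\mathcal{F})=\{\xi\in L^0(\mathcal{F}):\xi\ge0\}$, $L^0_{++}(\mathcal{F})=\{\xi\in L^0(\mathcal{F}):\xi>0\text{ a.s.}\}$; $\tilde I_A$ is the class of the indicator of $A\in\mathcal{F}$. "$\xi<\eta$ on $A$" means $\xi(\omega)<\eta(\omega)$ for $P$-almost all $\omega\in A$. Conventions: $0\cdot(\pm\infty)=0$, $+\infty\pm(\pm\infty)=+\infty$. A countable partition $\{A_n,n\in\mathbb{N}\}$ of $\Omega$ to $\mathcal{F}$ is a sequence of pairwise disjoint members of $\mathcal{F}$ with union $\Omega$. Random locally convex module (RLC module) over $\mathbb{R}$ with base $(\Omega,\mathcal{F},P)$: a pair $(E,\mathcal{P})$ with $E$ an $L^0(\mathcal{F})$-module and $\mathcal{P}$ a family of $L^0$-seminorms on $E$ (maps $\|\cdot\|:E\to L^0_+(\mathcal{F})$ with $\|\xi x\|=|\xi|\|x\|$ for $\xi\in L^0(\mathcal{F})$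 and $\|x+y\|\le\|x\|+\|y\|$) such that $\bigvee\{\|x\|:\|\cdot\|\in\mathcal{P}\}=0$ iff $x=\theta$ (null element). $\mathcal{P}_f$ is the family of (nonempty) finite subsets of $\mathcal{P}$, and $\|x\|_{\mathcal{Q}}=\bigvee\{\|x\|:\|\cdot\|\in\mathcal{Q}\}$. The locally $L^0$-convex topology $\mathcal{T}_c$ on $E$ has local base at $\theta$: $\{x:\|x\|_{\mathcal{Q}}\le\varepsilon\}$, $\mathcal{Q}\in\mathcal{P}_f$, $\varepsilon\in L^0_{++}(\mathcal{F})$; $L^0(\mathcal{F})$ carries its own $\mathcal{T}_c$ determined by $|\cdot|$. $E^\ast_c$ is the set of continuous module homomorphisms from $(E,\mathcal{T}_c)$ to $(L^0(\mathcal{F}),\mathcal{T}_c)$. $E$ has the countable concatenation property if for each sequence $\{x_n\}$ in $E$ and each countable partition $\{A_n\}$ of $\Omega$ to $\mathcal{F}$ there is $x\in E$ with $\tilde I_{A_n}x=\tilde I_{A_n}x_n$ for all $n$. For $f:E\to\bar L^0(\mathcal{F})$: $f$ is local if $\tilde I_Af(x)=\tilde I_Af(\tilde I_Ax)$ for all $x\in E$, $A\in\mathcal{F}$; proper if $f(x)>-\infty$ on $\Omega$ for all $x\in E$ and there is $x\in E$ with $f(x)<+\infty$ on $\Omega$; $L^0$-convex if $f(\xi x+(1-\xi)y)\le\xi f(x)+(1-\xi)f(y)$ for all $x,y\in E$, $\xi\in L^0_+(\mathcal{F})$, $0\le\xi\le1$. A proper $f$ is $\mathcal{T}_c$-lower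 semicontinuous if $epi(f)=\{(x,r)\in E\times L^0(\mathcal{F}):f(x)\le r\}$ is closed in $(E,\mathcal{T}_c)\times(L^0(\mathcal{F}),\mathcal{T}_c)$. For a local $f$: $MI(f)$ is the essential supremum of $\{A\in\mathcal{F}:\text{there is }x\in E\text{ with }\tilde I_Af(x)=\tilde I_A(-\infty)\}$, $PI(f)$ the essential supremum of $\{A\in\mathcal{F}:\tilde I_Af(x)=\tilde I_A(+\infty)\text{ for all }x\in E\}$ (they may be chosen disjoint), and $BP(f)=\Omega\setminus(MI(f)\cup PI(f))$. For $D\in\mathcal{F}$ with $P(D)>0$, $E^D=\tilde I_DE$ with the restricted seminorms $\mathcal{P}^D=\{\|\cdot\||_{E^D}:\|\cdot\|\in\mathcal{P}\}$ is an RLC module over $\mathbb{R}$ with base $(D,D\cap\mathcal{F},P(\cdot|D))$, and $f_D:E^D\to\tilde I_D\bar L^0(\mathcal{F})$ (identified with $\bar L^0(D\cap\mathcal{F})$) is $f_D(\tilde I_Dx)=\tilde I_Df(\tilde I_Dx)$. A local $f$ is $\mathcal{T}_c$-closed if $\tilde I_{MI(f)}f=\tilde I_{MI(f)}(-\infty)$ and if $f_A$ is $L^0(A\cap\mathcal{F})$-convex and $\mathcal{T}_c$-lower semicontinuous for each $A\in\mathcal{F}$ with $A\subset BP(f)$, $P(A)>0$ such that $f_A$ is proper. $Cl_c(f)$ is the greatest $\mathcal{T}_c$-closed function majorized by $f$ (pointwise suprema of $\mathcal{T}_c$-closed functions are $\mathcal{T}_c$-closed, so it exists). $f^\ast_c(g)=\bigvee\{g(x)-f(x):x\in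 E\}$ for $g\in E^\ast_c$, and $f^{\ast\ast}_c(x)=\bigvee\{g(x)-f^\ast_c(g):g\in E^\ast_c\}$ for $x\in E$. *)

theory Defs
  imports "HOL-Probability.Probability" "HOL-Algebra.Module"
begin

section \<open>The spaces of equivalence classes of random variables\<close>

text \<open>
  An element of \<open>L0 M\<close> is the set of all measurable functions that agree almost surely with a
  given one. The value type is \<^typ>\<open>real\<close> for $L^0$ and \<^typ>\<open>ereal\<close> for
  $\bar L^0$. The arithmetic of \<^typ>\<open>ereal\<close> obeys the required conventions
  $0 \cdot (\pm\infty) = 0$ and $+\infty \pm (\pm\infty) = +\infty$. Operations on classes are
  defined through \<open>L0_rep\<close>, a chosen representative; they do not depend on the choice.
\<close>

definition L0_class :: "'a measure \<Rightarrow> ('a \<Rightarrow> 'b::topological_space) \<Rightarrow> ('a \<Rightarrow> 'b) set" where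
  "L0_class M u = {v \<in> borel_measurable M. AE \<omega> in M. v \<omega> = u \<omega>}"

definition L0 :: "'a measure \<Rightarrow> ('a \<Rightarrow> 'b::topological_space) set set" where
  "L0 M = L0_class M ` borel_measurable M"

definition L0_rep :: "('a \<Rightarrow> 'b) set \<Rightarrow> 'a \<Rightarrow> 'b" where
  "L0_rep X = (SOME u. u \<in> X)"

lemma L0_class_eq_iff:
  assumes "u \<in> borel_measurable M" "v \<in> borel_measurable M"
  shows "L0_class M u = L0_class M v \<longleftrightarrow> (AE \<omega> in M. u \<omega> = v \<omega>)"
proof
  assume "L0_class M u = L0_class M v"
  moreover have "u \<in> L0_class M u" using assms by (simp add: L0_class_def)
  ultimately show "AE \<omega> in M. u \<omega> = v \<omega>" by (simp add: L0_class_def)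
next
  assume "AE \<omega> in M. u \<omega> = v \<omega>"
  then show "L0_class M u = L0_class M v" by (auto simp: L0_class_def)
qed

lemma L0_rep_class:
  assumes "u \<in> borel_measurable M"
  shows "L0_rep (L0_class M u) \<in> borel_measurable M"
    and "AE \<omega> in M. L0_rep (L0_class M u) \<omega> = u \<omega>"
proof -
  have "u \<in> L0_class M u" using assms by (simp add: L0_class_def)
  then have "L0_rep (L0_class M u) \<in> L0_class M u"
    unfolding L0_rep_def by (rule someI[where P = "\<lambda>v. v \<in> L0_class M u"])
  then show "L0_rep (L0_class M u) \<in> borel_measurable M"
    and "AE \<omega> in M. L0_rep (L0_class M u) \<omega> = u \<omega>"
    by (simp_all add: L0_class_def)
qed

lemma L0_class_rep:
  assumes "X \<in> L0 M"
  shows "L0_rep X \<in> borel_measurable M" and "L0_class M (L0_rep X) = X"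
proof -
  from assms obtain u where u: "u \<in> borel_measurable M" "X = L0_class M u"
    by (auto simp: L0_def)
  then show "L0_rep X \<in> borel_measurable M" and "L0_class M (L0_rep X) = X"
    using L0_rep_class[of u M] by (simp_all add: L0_class_eq_iff)
qed

definition L0_const :: "'a measure \<Rightarrow> 'b::topological_space \<Rightarrow> ('a \<Rightarrow> 'b) set" where
  "L0_const M c = L0_class M (\<lambda>_. c)"

definition L0_ind :: "'a measure \<Rightarrow> 'a set \<Rightarrow> ('a \<Rightarrow> 'b::{topological_space,zero_neq_one}) set" where
  "L0_ind M A = L0_class M (indicator A)"

definition L0_add ::
    "'a measure \<Rightarrow> ('a \<Rightarrow> 'b::{topological_space,plus}) set \<Rightarrow> ('a \<Rightarrow> 'b) set \<Rightarrow> ('a \<Rightarrow> 'b) set" where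
  "L0_add M X Y = L0_class M (\<lambda>\<omega>. L0_rep X \<omega> + L0_rep Y \<omega>)"

definition L0_diff ::
    "'a measure \<Rightarrow> ('a \<Rightarrow> 'b::{topological_space,minus}) set \<Rightarrow> ('a \<Rightarrow> 'b) set \<Rightarrow> ('a \<Rightarrow> 'b) set" where
  "L0_diff M X Y = L0_class M (\<lambda>\<omega>. L0_rep X \<omega> - L0_rep Y \<omega>)"

definition L0_mult ::
    "'a measure \<Rightarrow> ('a \<Rightarrow> 'b::{topological_space,times}) set \<Rightarrow> ('a \<Rightarrow> 'b) set \<Rightarrow> ('a \<Rightarrow> 'b) set" where
  "L0_mult M X Y = L0_class M (\<lambda>\<omega>. L0_rep X \<omega> * L0_rep Y \<omega>)"

definition L0_abs :: "'a measure \<Rightarrow> ('a \<Rightarrow> real) set \<Rightarrow> ('a \<Rightarrow> real) set" where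
  "L0_abs M X = L0_class M (\<lambda>\<omega>. \<bar>L0_rep X \<omega>\<bar>)"

definition L0_ereal :: "'a measure \<Rightarrow> ('a \<Rightarrow> real) set \<Rightarrow> ('a \<Rightarrow> ereal) set" where
  "L0_ereal M X = L0_class M (\<lambda>\<omega>. ereal (L0_rep X \<omega>))"

definition L0_order :: "'a measure \<Rightarrow> ('a \<Rightarrow> 'b::{topological_space,ord}) set gorder" where
  "L0_order M =
     \<lparr>carrier = L0 M, eq = (=), le = (\<lambda>X Y. AE \<omega> in M. L0_rep X \<omega> \<le> L0_rep Y \<omega>)\<rparr>"

definition L0_ring :: "'a measure \<Rightarrow> ('a \<Rightarrow> real) set ring" where
  "L0_ring M = \<lparr>carrier = L0 M, mult = L0_mult M, one = L0_const M 1,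
     zero = L0_const M 0, add = L0_add M\<rparr>"

definition L0_module :: "'a measure \<Rightarrow> (('a \<Rightarrow> real) set, ('a \<Rightarrow> real) set) module" where
  "L0_module M = \<lparr>carrier = L0 M, mult = L0_mult M, one = L0_const M 1,
     zero = L0_const M 0, add = L0_add M, smult = L0_mult M\<rparr>"

definition L0_nonneg :: "'a measure \<Rightarrow> ('a \<Rightarrow> real) set set" where
  "L0_nonneg M = {X \<in> L0 M. L0_const M 0 \<sqsubseteq>\<^bsub>L0_order M\<^esub> X}"

definition L0_pos :: "'a measure \<Rightarrow> ('a \<Rightarrow> real) set set" where
  "L0_pos M = {X \<in> L0 M. AE \<omega> in M. 0 < L0_rep X \<omega>}"


section \<open>Random locally convex modules\<close>

definition L0_seminorm ::
    "'a measure \<Rightarrow> (('a \<Rightarrow> real) set, 'e) module \<Rightarrow> ('e \<Rightarrow> ('a \<Rightarrow> real) set) \<Rightarrow> bool" where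
  "L0_seminorm M E N \<longleftrightarrow>
     N \<in> carrier E \<rightarrow> L0_nonneg M \<and>
     (\<forall>\<xi>\<in>L0 M. \<forall>x\<in>carrier E. N (\<xi> \<odot>\<^bsub>E\<^esub> x) = L0_mult M (L0_abs M \<xi>) (N x)) \<and>
     (\<forall>x\<in>carrier E. \<forall>y\<in>carrier E. N (x \<oplus>\<^bsub>E\<^esub> y) \<sqsubseteq>\<^bsub>L0_order M\<^esub> L0_add M (N x) (N y))"

text \<open>
  The supremum over the possibly infinite family \<open>P\<close> is taken in the extended-real valued space.
  The supremum of the empty family is the constant $-\infty$, so that \<open>P\<close> is nonempty.
\<close>

locale rlc_module = prob_space M + Module.module "L0_ring M" E
  for M :: "'a measure"
    and E :: "(('a \<Rightarrow> real) set, 'e) module"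
    and P :: "('e \<Rightarrow> ('a \<Rightarrow> real) set) set" +
  assumes seminorm: "N \<in> P \<Longrightarrow> L0_seminorm M E N"
    and separating: "x \<in> carrier E \<Longrightarrow>
      \<Squnion>\<^bsub>L0_order M\<^esub> {L0_ereal M (N x) | N. N \<in> P} = L0_const M 0 \<longleftrightarrow> x = \<zero>\<^bsub>E\<^esub>"

definition fam_seminorm ::
    "'a measure \<Rightarrow> ('e \<Rightarrow> ('a \<Rightarrow> real) set) set \<Rightarrow> 'e \<Rightarrow> ('a \<Rightarrow> real) set" where
  "fam_seminorm M Q x = \<Squnion>\<^bsub>L0_order M\<^esub> {N x | N. N \<in> Q}"

definition Tc ::
    "'a measure \<Rightarrow> (('a \<Rightarrow> real) set, 'e) module \<Rightarrow> ('e \<Rightarrow> ('a \<Rightarrow> real) set) set \<Rightarrow> 'e topology" where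
  "Tc M E P = topology (\<lambda>U. U \<subseteq> carrier E \<and>
     (\<forall>x\<in>U. \<exists>Q \<epsilon>. finite Q \<and> Q \<noteq> {} \<and> Q \<subseteq> P \<and> \<epsilon> \<in> L0_pos M \<and>
        {y \<in> carrier E. fam_seminorm M Q (y \<ominus>\<^bsub>E\<^esub> x) \<sqsubseteq>\<^bsub>L0_order M\<^esub> \<epsilon>} \<subseteq> U))"

definition Tc_L0 :: "'a measure \<Rightarrow> ('a \<Rightarrow> real) set topology" where
  "Tc_L0 M = Tc M (L0_module M) {L0_abs M}"

definition Tc_dual ::
    "'a measure \<Rightarrow> (('a \<Rightarrow> real) set, 'e) module \<Rightarrow> ('e \<Rightarrow> ('a \<Rightarrow> real) set) set
      \<Rightarrow> ('e \<Rightarrow> ('a \<Rightarrow> real) set) set" where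
  "Tc_dual M E P = {g \<in> carrier E \<rightarrow>\<^sub>E L0 M.
     (\<forall>x\<in>carrier E. \<forall>y\<in>carrier E. g (x \<oplus>\<^bsub>E\<^esub> y) = L0_add M (g x) (g y)) \<and>
     (\<forall>\<xi>\<in>L0 M. \<forall>x\<in>carrier E. g (\<xi> \<odot>\<^bsub>E\<^esub> x) = L0_mult M \<xi> (g x)) \<and>
     continuous_map (Tc M E P) (Tc_L0 M) g}"

definition countable_concatenation ::
    "'a measure \<Rightarrow> (('a \<Rightarrow> real) set, 'e) module \<Rightarrow> bool" where
  "countable_concatenation M E \<longleftrightarrow>
     (\<forall>(x :: nat \<Rightarrow> 'e) (A :: nat \<Rightarrow> 'a set).
        range x \<subseteq> carrier E \<longrightarrow> range A \<subseteq> sets M \<longrightarrow> disjoint_family A \<longrightarrow> (\<Union>n. A n) = space M \<longrightarrow>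
        (\<exists>y\<in>carrier E. \<forall>n. L0_ind M (A n) \<odot>\<^bsub>E\<^esub> y = L0_ind M (A n) \<odot>\<^bsub>E\<^esub> x n))"


section \<open>Functions with values in the extended-real valued classes\<close>

definition L0_local ::
    "'a measure \<Rightarrow> (('a \<Rightarrow> real) set, 'e) module \<Rightarrow> ('e \<Rightarrow> ('a \<Rightarrow> ereal) set) \<Rightarrow> bool" where
  "L0_local M E f \<longleftrightarrow>
     (\<forall>x\<in>carrier E. \<forall>A\<in>sets M.
        L0_mult M (L0_ind M A) (f x) = L0_mult M (L0_ind M A) (f (L0_ind M A \<odot>\<^bsub>E\<^esub> x)))"

definition L0_proper ::
    "'a measure \<Rightarrow> (('a \<Rightarrow> real) set, 'e) module \<Rightarrow> ('e \<Rightarrow> ('a \<Rightarrow> ereal) set) \<Rightarrow> bool" where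
  "L0_proper M E f \<longleftrightarrow>
     (\<forall>x\<in>carrier E. AE \<omega> in M. L0_rep (f x) \<omega> > -\<infinity>) \<and>
     (\<exists>x\<in>carrier E. AE \<omega> in M. L0_rep (f x) \<omega> < \<infinity>)"

definition L0_convex ::
    "'a measure \<Rightarrow> (('a \<Rightarrow> real) set, 'e) module \<Rightarrow> ('e \<Rightarrow> ('a \<Rightarrow> ereal) set) \<Rightarrow> bool" where
  "L0_convex M E f \<longleftrightarrow>
     (\<forall>x\<in>carrier E. \<forall>y\<in>carrier E. \<forall>\<xi>\<in>L0_nonneg M. \<xi> \<sqsubseteq>\<^bsub>L0_order M\<^esub> L0_const M 1 \<longrightarrow>
        f (\<xi> \<odot>\<^bsub>E\<^esub> x \<oplus>\<^bsub>E\<^esub> L0_diff M (L0_const M 1) \<xi> \<odot>\<^bsub>E\<^esub> y) \<sqsubseteq>\<^bsub>L0_order M\<^esub>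
          L0_add M (L0_mult M (L0_ereal M \<xi>) (f x))
            (L0_mult M (L0_ereal M (L0_diff M (L0_const M 1) \<xi>)) (f y)))"

definition epi ::
    "'a measure \<Rightarrow> (('a \<Rightarrow> real) set, 'e) module \<Rightarrow> ('e \<Rightarrow> ('a \<Rightarrow> ereal) set)
      \<Rightarrow> ('e \<times> ('a \<Rightarrow> real) set) set" where
  "epi M E f = {(x, r). x \<in> carrier E \<and> r \<in> L0 M \<and> f x \<sqsubseteq>\<^bsub>L0_order M\<^esub> L0_ereal M r}"

definition Tc_lsc ::
    "'a measure \<Rightarrow> (('a \<Rightarrow> real) set, 'e) module \<Rightarrow> ('e \<Rightarrow> ('a \<Rightarrow> real) set) set
      \<Rightarrow> ('e \<Rightarrow> ('a \<Rightarrow> ereal) set) \<Rightarrow> bool" where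
  "Tc_lsc M E P f \<longleftrightarrow> closedin (prod_topology (Tc M E P) (Tc_L0 M)) (epi M E f)"


section \<open>Restriction to an event\<close>

text \<open>The base $(D, D \cap \mathcal F, P(\cdot \mid D))$.\<close>

definition cond_base :: "'a measure \<Rightarrow> 'a set \<Rightarrow> 'a measure" where
  "cond_base M D = restrict_space (uniform_measure M D) D"

text \<open>
  \<open>L0_restrict\<close> and \<open>L0_extend\<close> realise the identification of the classes over \<open>cond_base M D\<close>
  with the classes over \<open>M\<close> that vanish outside \<open>D\<close>.
\<close>

definition L0_restrict ::
    "'a measure \<Rightarrow> 'a set \<Rightarrow> ('a \<Rightarrow> 'b::topological_space) set \<Rightarrow> ('a \<Rightarrow> 'b) set" where
  "L0_restrict M D X = L0_class (cond_base M D) (L0_rep X)"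

definition L0_extend ::
    "'a measure \<Rightarrow> 'a set \<Rightarrow> ('a \<Rightarrow> 'b::{topological_space,zero}) set \<Rightarrow> ('a \<Rightarrow> 'b) set" where
  "L0_extend M D Y = L0_class M (\<lambda>\<omega>. if \<omega> \<in> D then L0_rep Y \<omega> else 0)"

text \<open>$E^D = \tilde I_D E$ as a module over the classes on \<open>cond_base M D\<close>.\<close>

definition restr_module ::
    "'a measure \<Rightarrow> 'a set \<Rightarrow> (('a \<Rightarrow> real) set, 'e) module \<Rightarrow> (('a \<Rightarrow> real) set, 'e) module" where
  "restr_module M D E =
     E\<lparr>carrier := (\<lambda>x. L0_ind M D \<odot>\<^bsub>E\<^esub> x) ` carrier E,
       smult := (\<lambda>\<xi> x. L0_extend M D \<xi> \<odot>\<^bsub>E\<^esub> x)\<rparr>"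

definition restr_seminorms ::
    "'a measure \<Rightarrow> 'a set \<Rightarrow> (('a \<Rightarrow> real) set, 'e) module \<Rightarrow> ('e \<Rightarrow> ('a \<Rightarrow> real) set) set
      \<Rightarrow> ('e \<Rightarrow> ('a \<Rightarrow> real) set) set" where
  "restr_seminorms M D E P =
     (\<lambda>N. \<lambda>x\<in>carrier (restr_module M D E). L0_restrict M D (N x)) ` P"

definition restr_fun ::
    "'a measure \<Rightarrow> 'a set \<Rightarrow> (('a \<Rightarrow> real) set, 'e) module \<Rightarrow> ('e \<Rightarrow> ('a \<Rightarrow> ereal) set)
      \<Rightarrow> 'e \<Rightarrow> ('a \<Rightarrow> ereal) set" where
  "restr_fun M D E f =
     (\<lambda>x\<in>carrier (restr_module M D E). L0_restrict M D (L0_mult M (L0_ind M D) (f x)))"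


section \<open>Closed functions and the closure\<close>

text \<open>
  The essential supremum of a family of events is determined up to a null set; \<open>ess_Sup_sets\<close>
  is an arbitrary version. The notions below do not depend on the version.
\<close>

definition is_ess_Sup :: "'a measure \<Rightarrow> 'a set set \<Rightarrow> 'a set \<Rightarrow> bool" where
  "is_ess_Sup M \<A> S \<longleftrightarrow> S \<in> sets M \<and>
     (\<forall>A\<in>\<A>. AE \<omega> in M. \<omega> \<in> A \<longrightarrow> \<omega> \<in> S) \<and>
     (\<forall>T\<in>sets M. (\<forall>A\<in>\<A>. AE \<omega> in M. \<omega> \<in> A \<longrightarrow> \<omega> \<in> T) \<longrightarrow> (AE \<omega> in M. \<omega> \<in> S \<longrightarrow> \<omega> \<in> T))"

definition ess_Sup_sets :: "'a measure \<Rightarrow> 'a set set \<Rightarrow> 'a set" where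
  "ess_Sup_sets M \<A> = (SOME S. is_ess_Sup M \<A> S)"

definition MI ::
    "'a measure \<Rightarrow> (('a \<Rightarrow> real) set, 'e) module \<Rightarrow> ('e \<Rightarrow> ('a \<Rightarrow> ereal) set) \<Rightarrow> 'a set" where
  "MI M E f = ess_Sup_sets M {A \<in> sets M. \<exists>x\<in>carrier E.
     L0_mult M (L0_ind M A) (f x) = L0_mult M (L0_ind M A) (L0_const M (-\<infinity>))}"

definition PI ::
    "'a measure \<Rightarrow> (('a \<Rightarrow> real) set, 'e) module \<Rightarrow> ('e \<Rightarrow> ('a \<Rightarrow> ereal) set) \<Rightarrow> 'a set" where
  "PI M E f = ess_Sup_sets M {A \<in> sets M. \<forall>x\<in>carrier E.
     L0_mult M (L0_ind M A) (f x) = L0_mult M (L0_ind M A) (L0_const M \<infinity>)}"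

definition BP ::
    "'a measure \<Rightarrow> (('a \<Rightarrow> real) set, 'e) module \<Rightarrow> ('e \<Rightarrow> ('a \<Rightarrow> ereal) set) \<Rightarrow> 'a set" where
  "BP M E f = space M - (MI M E f \<union> PI M E f)"

definition Tc_closed ::
    "'a measure \<Rightarrow> (('a \<Rightarrow> real) set, 'e) module \<Rightarrow> ('e \<Rightarrow> ('a \<Rightarrow> real) set) set
      \<Rightarrow> ('e \<Rightarrow> ('a \<Rightarrow> ereal) set) \<Rightarrow> bool" where
  "Tc_closed M E P f \<longleftrightarrow>
     L0_local M E f \<and>
     (\<forall>x\<in>carrier E. L0_mult M (L0_ind M (MI M E f)) (f x) =
        L0_mult M (L0_ind M (MI M E f)) (L0_const M (-\<infinity>))) \<and>
     (\<forall>A\<in>sets M. A \<subseteq> BP M E f \<longrightarrow> measure M A > 0 \<longrightarrow>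
        L0_proper (cond_base M A) (restr_module M A E) (restr_fun M A E f) \<longrightarrow>
        L0_convex (cond_base M A) (restr_module M A E) (restr_fun M A E f) \<and>
        Tc_lsc (cond_base M A) (restr_module M A E) (restr_seminorms M A E P) (restr_fun M A E f))"

text \<open>
  Functions on \<open>E\<close> are taken extensional (undefined outside the carrier), so that a greatest
  closed minorant is unique as a HOL function. Outside the carrier the values of \<open>f\<close> play no role.
\<close>

definition fun_order ::
    "'a measure \<Rightarrow> (('a \<Rightarrow> real) set, 'e) module \<Rightarrow> ('e \<Rightarrow> ('a \<Rightarrow> ereal) set) gorder" where
  "fun_order M E = \<lparr>carrier = carrier E \<rightarrow>\<^sub>E L0 M, eq = (=),
     le = (\<lambda>h f. \<forall>x\<in>carrier E. h x \<sqsubseteq>\<^bsub>L0_order M\<^esub> f x)\<rparr>"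

definition Cl_c ::
    "'a measure \<Rightarrow> (('a \<Rightarrow> real) set, 'e) module \<Rightarrow> ('e \<Rightarrow> ('a \<Rightarrow> real) set) set
      \<Rightarrow> ('e \<Rightarrow> ('a \<Rightarrow> ereal) set) \<Rightarrow> 'e \<Rightarrow> ('a \<Rightarrow> ereal) set" where
  "Cl_c M E P f = (THE h. greatest (fun_order M E) h
     {h \<in> carrier E \<rightarrow>\<^sub>E L0 M. Tc_closed M E P h \<and> h \<sqsubseteq>\<^bsub>fun_order M E\<^esub> f})"


section \<open>Conjugates\<close>

definition conj_c ::
    "'a measure \<Rightarrow> (('a \<Rightarrow> real) set, 'e) module \<Rightarrow> ('e \<Rightarrow> ('a \<Rightarrow> real) set) set
      \<Rightarrow> ('e \<Rightarrow> ('a \<Rightarrow> ereal) set) \<Rightarrow> ('e \<Rightarrow> ('a \<Rightarrow> real) set) \<Rightarrow> ('a \<Rightarrow> ereal) set" where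
  "conj_c M E P f = (\<lambda>g\<in>Tc_dual M E P.
     \<Squnion>\<^bsub>L0_order M\<^esub> {L0_diff M (L0_ereal M (g x)) (f x) | x. x \<in> carrier E})"

definition biconj_c ::
    "'a measure \<Rightarrow> (('a \<Rightarrow> real) set, 'e) module \<Rightarrow> ('e \<Rightarrow> ('a \<Rightarrow> real) set) set
      \<Rightarrow> ('e \<Rightarrow> ('a \<Rightarrow> ereal) set) \<Rightarrow> 'e \<Rightarrow> ('a \<Rightarrow> ereal) set" where
  "biconj_c M E P f = (\<lambda>x\<in>carrier E.
     \<Squnion>\<^bsub>L0_order M\<^esub> {L0_diff M (L0_ereal M (g x)) (conj_c M E P f g) | g. g \<in> Tc_dual M E P})"

end

theory Submission
  imports Defs
begin

text \<open>
  The biconjugate \<open>f\<^sup>*\<^sup>*\<close> is a supremum of continuous affine functions, hence a closed minorant of \<open>f\<close>.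
  Conversely let \<open>h \<le> f\<close> be closed and suppose \<open>f\<^sup>*\<^sup>*(x) < h(x)\<close> on an event of positive probability.
  That event may be shrunk freely as long as it keeps positive probability, so that random bounds become
  constants. First it lies in \<open>BP(h)\<close>, and \<open>f\<^sup>*\<^sup>*(x) < r < h(x)\<close> for a constant \<open>r\<close>. By lower semicontinuity
  and countable concatenation, \<open>h > r\<close> on a ball around \<open>x\<close> and \<open>h\<close> is bounded below on a ball around a
  point \<open>y\<^sub>0\<close> with \<open>h(y\<^sub>0) < \<infinity>\<close>. Convexity then gives \<open>h(y) \<ge> r - K \<parallel>y - x\<parallel>\<^sub>Q\<close> for all \<open>y\<close>, with a
  finite family \<open>Q\<close> of seminorms. A Hahn--Banach argument yields a continuous homomorphism \<open>g\<close> with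
  \<open>h(y) \<ge> r + g(y) - g(x)\<close> for all \<open>y\<close>, whence \<open>f\<^sup>*(g) \<le> g(x) - r\<close> and \<open>f\<^sup>*\<^sup>*(x) \<ge> r\<close>, a contradiction.
\<close>

section \<open>Classes of random variables\<close>

text \<open>The a.s. order is partial: the failure of an inequality means only that it fails on some
  event of positive probability, and the complement of a closed epigraph yields no more than that.
  Passing to smaller events costs nothing, because conjugates are suprema in the same order: a bound
  for the conjugate at \<open>g\<close> on one event gives a bound for the biconjugate on that
  event, whatever \<open>g\<close> does elsewhere. It also keeps the Lipschitz constant
  \<open>K\<close> a real number. Scalars form the second obstacle. The ring of classes has zero
  divisors, so a nonzero multiple of a vector outside a submodule may lie inside it, and the usual
  extension by one dimension does not carry over directly. The Hahn-Banach theorem is therefore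
  proved for additive maps on the abelian group alone, and homogeneity is recovered afterwards from
  domination by a seminorm. The object that bounds \<open>g\<close> from above is the conical hull
  of \<open>h - r\<close> at \<open>x\<close>, infimally convolved with \<open>K\<close> times a
  seminorm; as \<open>h\<close> may be infinite, it is kept as a set of constraints and never formed
  as a function.\<close>

lemma L0_class_in_L0: "u \<in> borel_measurable M \<Longrightarrow> L0_class M u \<in> L0 M"
  by (auto simp: L0_def)

lemma L0_rep_measurable: "X \<in> L0 M \<Longrightarrow> L0_rep X \<in> borel_measurable M"
  by (rule L0_class_rep)

lemma L0_eq_iff:
  assumes "X \<in> L0 M" "Y \<in> L0 M"
  shows "X = Y \<longleftrightarrow> (AE \<omega> in M. L0_rep X \<omega> = L0_rep Y \<omega>)"
  using L0_class_eq_iff[of "L0_rep X" M "L0_rep Y"] L0_class_rep[OF assms(1)] L0_class_rep[OF assms(2)]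
  by simp

lemma L0_class_eqI:
  assumes "u \<in> borel_measurable M" "v \<in> borel_measurable M" "AE \<omega> in M. u \<omega> = v \<omega>"
  shows "L0_class M u = L0_class M v"
  using assms by (simp add: L0_class_eq_iff)

lemma L0_const_in_L0: "L0_const M c \<in> L0 M"
  unfolding L0_const_def by (rule L0_class_in_L0) simp

lemma L0_rep_const: "AE \<omega> in M. L0_rep (L0_const M c) \<omega> = c"
  unfolding L0_const_def by (rule L0_rep_class) simp

text \<open>The value type stays general since \<open>L0_ind\<close> serves both as a real scalar
  acting on \<open>E\<close> and as an extended real factor of function values.\<close>

lemma indicator_borel_measurable:
  "A \<in> sets M \<Longrightarrow> (indicator A :: 'a \<Rightarrow> 'b::{topological_space,zero_neq_one}) \<in> borel_measurable M"
proof -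
  assume A: "A \<in> sets M"
  have "(\<lambda>\<omega>. if \<omega> \<in> A then 1 else 0 :: 'b) \<in> borel_measurable M"
    using A by (intro measurable_If_set) (auto intro: sets.Int)
  then show ?thesis
    by (subst measurable_cong[of _ _ "\<lambda>\<omega>. if \<omega> \<in> A then 1 else 0"]) (auto simp: indicator_def)
qed

lemma L0_ind_in_L0: "A \<in> sets M \<Longrightarrow> L0_ind M A \<in> L0 M"
  unfolding L0_ind_def by (intro L0_class_in_L0 indicator_borel_measurable)

lemma L0_rep_ind: "A \<in> sets M \<Longrightarrow> AE \<omega> in M. L0_rep (L0_ind M A) \<omega> = indicator A \<omega>"
  unfolding L0_ind_def by (intro L0_rep_class indicator_borel_measurable)

lemma
  fixes X Y :: "('a \<Rightarrow> real) set"
  assumes "X \<in> L0 M" "Y \<in> L0 M"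
  shows L0_add_in_L0: "L0_add M X Y \<in> L0 M"
    and L0_rep_add: "AE \<omega> in M. L0_rep (L0_add M X Y) \<omega> = L0_rep X \<omega> + L0_rep Y \<omega>"
    and L0_diff_in_L0: "L0_diff M X Y \<in> L0 M"
    and L0_rep_diff: "AE \<omega> in M. L0_rep (L0_diff M X Y) \<omega> = L0_rep X \<omega> - L0_rep Y \<omega>"
    and L0_rep_mult: "AE \<omega> in M. L0_rep (L0_mult M X Y) \<omega> = L0_rep X \<omega> * L0_rep Y \<omega>"
proof -
  note [measurable] = assms[THEN L0_rep_measurable]
  show "L0_add M X Y \<in> L0 M" "AE \<omega> in M. L0_rep (L0_add M X Y) \<omega> = L0_rep X \<omega> + L0_rep Y \<omega>"
    unfolding L0_add_def by (intro L0_class_in_L0 L0_rep_class; measurable)+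
  show "L0_diff M X Y \<in> L0 M" "AE \<omega> in M. L0_rep (L0_diff M X Y) \<omega> = L0_rep X \<omega> - L0_rep Y \<omega>"
    unfolding L0_diff_def by (intro L0_class_in_L0 L0_rep_class; measurable)+
  show "AE \<omega> in M. L0_rep (L0_mult M X Y) \<omega> = L0_rep X \<omega> * L0_rep Y \<omega>"
    unfolding L0_mult_def by (intro L0_rep_class; measurable)
qed

lemma
  fixes X :: "('a \<Rightarrow> real) set"
  assumes "X \<in> L0 M"
  shows L0_abs_in_L0: "L0_abs M X \<in> L0 M"
    and L0_rep_abs: "AE \<omega> in M. L0_rep (L0_abs M X) \<omega> = \<bar>L0_rep X \<omega>\<bar>"
    and L0_ereal_in_L0: "L0_ereal M X \<in> L0 M"
    and L0_rep_ereal: "AE \<omega> in M. L0_rep (L0_ereal M X) \<omega> = ereal (L0_rep X \<omega>)"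
proof -
  note [measurable] = L0_rep_measurable[OF assms]
  show "L0_abs M X \<in> L0 M" "AE \<omega> in M. L0_rep (L0_abs M X) \<omega> = \<bar>L0_rep X \<omega>\<bar>"
    unfolding L0_abs_def by (intro L0_class_in_L0 L0_rep_class; measurable)+
  show "L0_ereal M X \<in> L0 M" "AE \<omega> in M. L0_rep (L0_ereal M X) \<omega> = ereal (L0_rep X \<omega>)"
    unfolding L0_ereal_def by (intro L0_class_in_L0 L0_rep_class; measurable)+
qed

lemma
  fixes X Y :: "('a \<Rightarrow> ereal) set"
  assumes "X \<in> L0 M" "Y \<in> L0 M"
  shows L0_rep_add_ereal: "AE \<omega> in M. L0_rep (L0_add M X Y) \<omega> = L0_rep X \<omega> + L0_rep Y \<omega>"
    and L0_diff_ereal_in_L0: "L0_diff M X Y \<in> L0 M"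
    and L0_rep_diff_ereal: "AE \<omega> in M. L0_rep (L0_diff M X Y) \<omega> = L0_rep X \<omega> - L0_rep Y \<omega>"
    and L0_mult_ereal_in_L0: "L0_mult M X Y \<in> L0 M"
    and L0_rep_mult_ereal: "AE \<omega> in M. L0_rep (L0_mult M X Y) \<omega> = L0_rep X \<omega> * L0_rep Y \<omega>"
proof -
  note [measurable] = assms[THEN L0_rep_measurable]
  show "AE \<omega> in M. L0_rep (L0_add M X Y) \<omega> = L0_rep X \<omega> + L0_rep Y \<omega>"
    unfolding L0_add_def by (intro L0_rep_class; measurable)
  show "L0_diff M X Y \<in> L0 M" "AE \<omega> in M. L0_rep (L0_diff M X Y) \<omega> = L0_rep X \<omega> - L0_rep Y \<omega>"
    unfolding L0_diff_def by (intro L0_class_in_L0 L0_rep_class; measurable)+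
  show "L0_mult M X Y \<in> L0 M" "AE \<omega> in M. L0_rep (L0_mult M X Y) \<omega> = L0_rep X \<omega> * L0_rep Y \<omega>"
    unfolding L0_mult_def by (intro L0_class_in_L0 L0_rep_class; measurable)+
qed

text \<open>Since 0 times an infinite value is 0, the factor erases everything off \<open>A\<close>.
  Locality, \<open>MI\<close> and \<open>PI\<close> are stated with such products, and this turns
  them into almost sure statements on an event.\<close>

lemma L0_ind_mult_eq_iff:
  fixes X Y :: "('a \<Rightarrow> ereal) set"
  assumes "X \<in> L0 M" "Y \<in> L0 M" "A \<in> sets M"
  shows "L0_mult M (L0_ind M A) X = L0_mult M (L0_ind M A) Y \<longleftrightarrow>
    (AE \<omega>\<in>A in M. L0_rep X \<omega> = L0_rep Y \<omega>)"
proof -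
  have I: "L0_ind M A \<in> L0 M" using assms(3) by (rule L0_ind_in_L0)
  note r = L0_rep_mult_ereal[OF I assms(1)] L0_rep_mult_ereal[OF I assms(2)] L0_rep_ind[OF assms(3), where ?'b = ereal]
  have "L0_mult M (L0_ind M A) X = L0_mult M (L0_ind M A) Y \<longleftrightarrow>
    (AE \<omega> in M. L0_rep (L0_mult M (L0_ind M A) X) \<omega> = L0_rep (L0_mult M (L0_ind M A) Y) \<omega>)"
    by (intro L0_eq_iff L0_mult_ereal_in_L0 I assms)
  also have "\<dots> \<longleftrightarrow> (AE \<omega>\<in>A in M. L0_rep X \<omega> = L0_rep Y \<omega>)"
  proof
    assume "AE \<omega> in M. L0_rep (L0_mult M (L0_ind M A) X) \<omega> = L0_rep (L0_mult M (L0_ind M A) Y) \<omega>"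
    with r show "AE \<omega>\<in>A in M. L0_rep X \<omega> = L0_rep Y \<omega>" by eventually_elim auto
  next
    assume "AE \<omega>\<in>A in M. L0_rep X \<omega> = L0_rep Y \<omega>"
    with r show "AE \<omega> in M. L0_rep (L0_mult M (L0_ind M A) X) \<omega> = L0_rep (L0_mult M (L0_ind M A) Y) \<omega>"
      by eventually_elim (auto simp: indicator_def)
  qed
  finally show ?thesis .
qed

subsection \<open>Essential suprema\<close>

text \<open>The supremum of an order record is an arbitrarily chosen least upper bound. Two of them
  agree a.s. and are then the same class, so exhibiting one identifies the choice.\<close>

lemma L0_sup_eqI:
  fixes \<X> :: "('a \<Rightarrow> 'b::{topological_space,order}) set set"
  assumes "s \<in> L0 M" "\<X> \<subseteq> L0 M"
    and "\<And>X. X \<in> \<X> \<Longrightarrow> AE \<omega> in M. L0_rep X \<omega> \<le> L0_rep s \<omega>"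
    and "\<And>Y. Y \<in> L0 M \<Longrightarrow> (\<And>X. X \<in> \<X> \<Longrightarrow> AE \<omega> in M. L0_rep X \<omega> \<le> L0_rep Y \<omega>) \<Longrightarrow>
      AE \<omega> in M. L0_rep s \<omega> \<le> L0_rep Y \<omega>"
  shows "\<Squnion>\<^bsub>L0_order M\<^esub> \<X> = s"
proof -
  have s: "least (L0_order M) s (Upper (L0_order M) \<X>)"
    unfolding least_def Upper_def L0_order_def using assms(1-3) by (auto intro!: assms(4))
  have "t = s" if "least (L0_order M) t (Upper (L0_order M) \<X>)" for t
  proof -
    have "t \<in> L0 M" "AE \<omega> in M. L0_rep t \<omega> \<le> L0_rep s \<omega>" "AE \<omega> in M. L0_rep s \<omega> \<le> L0_rep t \<omega>"
      using s that by (auto simp: least_def Upper_def L0_order_def)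
    then show ?thesis using L0_eq_iff[of t M s] assms(1) by (auto intro: order.antisym)
  qed
  then show ?thesis unfolding sup_def using s by (intro some_equality)
qed

text \<open>Exhaustion: joining countably many near-maximisers gives a countable family again, so
  the largest measure of a countable union is attained. Adding one more member cannot enlarge it,
  hence that member is covered up to a null set.\<close>

lemma (in finite_measure) ex_countable_ess_Union:
  assumes "\<A> \<subseteq> sets M"
  shows "\<exists>\<C>. countable \<C> \<and> \<C> \<subseteq> \<A> \<and> (\<forall>A\<in>\<A>. AE \<omega>\<in>A in M. \<omega> \<in> \<Union>\<C>)"
proof -
  let ?K = "{\<C>. countable \<C> \<and> \<C> \<subseteq> \<A>}"
  let ?s = "SUP \<C>\<in>?K. measure M (\<Union>\<C>)"
  have bdd: "bdd_above ((\<lambda>\<C>. measure M (\<Union>\<C>)) ` ?K)"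
    by (intro bdd_aboveI2[of _ _ "measure M (space M)"]) (rule bounded_measure)
  have ne: "?K \<noteq> {}" by auto
  have "\<exists>\<C>\<in>?K. ?s - 1 / Suc n < measure M (\<Union>\<C>)" for n :: nat
    using less_cSUP_iff[OF ne bdd, of "?s - 1 / Suc n"] by auto
  then have "\<forall>n :: nat. \<exists>\<C>. \<C> \<in> ?K \<and> ?s - 1 / Suc n < measure M (\<Union>\<C>)" by (simp only: Bex_def) blast
  from choice[OF this] obtain D :: "nat \<Rightarrow> 'a set set" where
    D: "\<And>n. D n \<in> ?K" "\<And>n. ?s - 1 / Suc n < measure M (\<Union>(D n))" by auto
  define \<C> where "\<C> = (\<Union>n. D n)"
  have \<C>: "\<C> \<in> ?K" unfolding \<C>_def using D(1) by auto
  have meas: "\<Union>\<D> \<in> sets M" if "\<D> \<in> ?K" for \<D>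
    using that assms by (intro sets.countable_Union) auto
  have le: "?s \<le> measure M (\<Union>\<C>)"
  proof (rule ccontr)
    assume "\<not> ?thesis"
    then obtain n where "1 / Suc n < ?s - measure M (\<Union>\<C>)"
      using reals_Archimedean[of "?s - measure M (\<Union>\<C>)"] by (auto simp: inverse_eq_divide)
    moreover have "measure M (\<Union>(D n)) \<le> measure M (\<Union>\<C>)"
      by (intro finite_measure_mono meas[OF \<C>]) (auto simp: \<C>_def)
    ultimately show False using D(2)[of n] by linarith
  qed
  show ?thesis
  proof (intro exI[of _ \<C>] conjI ballI)
    fix A assume A: "A \<in> \<A>"
    have K': "insert A \<C> \<in> ?K" using \<C> A by auto
    have "measure M (A - \<Union>\<C>) + measure M (\<Union>\<C>) = measure M (\<Union>(insert A \<C>))"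
      using meas[OF \<C>] A assms by (subst finite_measure_Union[symmetric]) (auto intro!: arg_cong[where f="measure M"])
    also have "\<dots> \<le> ?s" by (rule cSUP_upper[OF K' bdd])
    finally have "measure M (A - \<Union>\<C>) \<le> 0" using le by linarith
    then have "A - \<Union>\<C> \<in> null_sets M"
      using meas[OF \<C>] A assms measure_nonneg[of M "A - \<Union>\<C>"]
      by (intro null_setsI) (auto simp: emeasure_eq_measure)
    from AE_not_in[OF this] show "AE \<omega>\<in>A in M. \<omega> \<in> \<Union>\<C>" by eventually_elim auto
  qed (use \<C> in auto)
qed

text \<open>The version picked by \<open>ess_Sup_sets\<close> has the defining property, and this is
  all that is ever used about \<open>MI\<close> and \<open>PI\<close>.\<close>

lemma (in finite_measure) is_ess_Sup_ess_Sup_sets: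
  assumes "\<A> \<subseteq> sets M"
  shows "is_ess_Sup M \<A> (ess_Sup_sets M \<A>)"
proof -
  obtain \<C> where \<C>: "countable \<C>" "\<C> \<subseteq> \<A>" "\<forall>A\<in>\<A>. AE \<omega>\<in>A in M. \<omega> \<in> \<Union>\<C>"
    using ex_countable_ess_Union[OF assms] by blast
  have "is_ess_Sup M \<A> (\<Union>\<C>)" unfolding is_ess_Sup_def
  proof (intro conjI ballI impI)
    show "\<Union>\<C> \<in> sets M" using \<C> assms by (intro sets.countable_Union) auto
    fix T assume "\<forall>A\<in>\<A>. AE \<omega>\<in>A in M. \<omega> \<in> T"
    then have "AE \<omega> in M. \<forall>A\<in>\<C>. \<omega> \<in> A \<longrightarrow> \<omega> \<in> T"
      using \<C> by (subst AE_ball_countable) auto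
    then show "AE \<omega> in M. \<omega> \<in> \<Union>\<C> \<longrightarrow> \<omega> \<in> T" by eventually_elim auto
  qed (use \<C> in auto)
  then show ?thesis unfolding ess_Sup_sets_def by (rule someI)
qed

text \<open>The superlevel sets are exhausted at each rational level; countably many levels cost
  only countably many functions and null sets. Where some \<open>u\<close> exceeded the supremum, a
  rational in between would be a level missed by the exhaustion.\<close>

lemma (in finite_measure) ex_countable_ess_SUP:
  fixes \<U> :: "('a \<Rightarrow> ereal) set"
  assumes "\<U> \<subseteq> borel_measurable M"
  shows "\<exists>\<C>. countable \<C> \<and> \<C> \<subseteq> \<U> \<and> (\<forall>u\<in>\<U>. AE \<omega> in M. u \<omega> \<le> (SUP v\<in>\<C>. v \<omega>))"
proof -
  have "\<exists>\<C>. countable \<C> \<and> \<C> \<subseteq> \<U> \<and>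
      (\<forall>u\<in>\<U>. AE \<omega> in M. ereal (of_rat q) < u \<omega> \<longrightarrow> (\<exists>v\<in>\<C>. ereal (of_rat q) < v \<omega>))" for q :: rat
  proof -
    let ?S = "\<lambda>u. {\<omega> \<in> space M. ereal (of_rat q) < u \<omega>}"
    have "?S ` \<U> \<subseteq> sets M" using assms by (auto intro!: borel_measurable_less)
    from ex_countable_ess_Union[OF this] obtain \<D> where
      \<D>: "countable \<D>" "\<D> \<subseteq> ?S ` \<U>" "\<forall>u\<in>\<U>. AE \<omega> in M. \<omega> \<in> ?S u \<longrightarrow> \<omega> \<in> \<Union>\<D>" by auto
    from countable_subset_image[of \<D> ?S \<U>] \<D>(1,2) obtain \<C> where
      \<C>: "countable \<C>" "\<C> \<subseteq> \<U>" "\<D> = ?S ` \<C>" by auto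
    have "AE \<omega> in M. ereal (of_rat q) < u \<omega> \<longrightarrow> (\<exists>v\<in>\<C>. ereal (of_rat q) < v \<omega>)" if "u \<in> \<U>" for u
      using \<D>(3)[rule_format, OF that] AE_space by eventually_elim (auto simp: \<C>(3))
    with \<C> show ?thesis by blast
  qed
  from choice[OF allI[OF this]] obtain C where "\<forall>q. countable (C q) \<and> C q \<subseteq> \<U> \<and>
      (\<forall>u\<in>\<U>. AE \<omega> in M. ereal (of_rat q) < u \<omega> \<longrightarrow> (\<exists>v\<in>C q. ereal (of_rat q) < v \<omega>))" ..
  then have C: "\<And>q. countable (C q)" "\<And>q. C q \<subseteq> \<U>"
    "\<And>q u. u \<in> \<U> \<Longrightarrow> AE \<omega> in M. ereal (of_rat q) < u \<omega> \<longrightarrow> (\<exists>v\<in>C q. ereal (of_rat q) < v \<omega>)"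
    by simp_all
  show ?thesis
  proof (intro exI[of _ "\<Union>q. C q"] conjI ballI)
    fix u assume "u \<in> \<U>"
    then have "AE \<omega> in M. \<forall>q. ereal (of_rat q) < u \<omega> \<longrightarrow> (\<exists>v\<in>C q. ereal (of_rat q) < v \<omega>)"
      using C(3) by (subst AE_all_countable) auto
    then show "AE \<omega> in M. u \<omega> \<le> (SUP v\<in>\<Union>q. C q. v \<omega>)"
    proof eventually_elim
      case (elim \<omega>)
      show ?case
      proof (rule ccontr)
        assume "\<not> ?case"
        then obtain r where r: "(SUP v\<in>\<Union>q. C q. v \<omega>) < ereal r" "ereal r < u \<omega>"
          using ereal_dense2 by (metis not_le)
        from ereal_dense2[OF r(2)] obtain r' where r': "ereal r < ereal r'" "ereal r' < u \<omega>" by auto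
        obtain q where q: "r < of_rat q" "of_rat q < r'" using of_rat_dense r'(1) by auto
        then have "ereal (of_rat q) < u \<omega>" using r'(2) by (meson ereal_less(2) less_ereal.simps(1) order.strict_trans)
        then obtain v where v: "v \<in> C q" "ereal (of_rat q) < v \<omega>" using elim by auto
        have "v \<omega> \<le> (SUP v\<in>\<Union>q. C q. v \<omega>)" using v by (intro SUP_upper) auto
        with v r(1) q have "ereal (of_rat q) < ereal r" by (meson le_less_trans less_le_trans order.strict_trans)
        with q show False by simp
      qed
    qed
  qed (use C in auto)
qed

text \<open>The least upper bound property is tested against a function \<open>v\<close>, so that
  bounds equal to \<open>\<infinity>\<close> off an event can be supplied without naming their
  class.\<close>

lemma (in finite_measure)
  fixes \<X> :: "('a \<Rightarrow> ereal) set set"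
  assumes "\<X> \<subseteq> L0 M"
  shows L0_sup_in_L0: "\<Squnion>\<^bsub>L0_order M\<^esub> \<X> \<in> L0 M"
    and L0_sup_upper: "X \<in> \<X> \<Longrightarrow> AE \<omega> in M. L0_rep X \<omega> \<le> L0_rep (\<Squnion>\<^bsub>L0_order M\<^esub> \<X>) \<omega>"
    and L0_sup_least: "v \<in> borel_measurable M \<Longrightarrow>
      (\<And>X. X \<in> \<X> \<Longrightarrow> AE \<omega> in M. L0_rep X \<omega> \<le> v \<omega>) \<Longrightarrow>
      AE \<omega> in M. L0_rep (\<Squnion>\<^bsub>L0_order M\<^esub> \<X>) \<omega> \<le> v \<omega>"
proof -
  have meas: "L0_rep ` \<X> \<subseteq> borel_measurable M" using assms L0_rep_measurable by blast
  from ex_countable_ess_SUP[OF meas] obtain \<D> where \<D>: "countable \<D>" "\<D> \<subseteq> L0_rep ` \<X>"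
    "\<forall>u\<in>L0_rep ` \<X>. AE \<omega> in M. u \<omega> \<le> (SUP v\<in>\<D>. v \<omega>)" by auto
  define s where "s = (\<lambda>\<omega>. SUP v\<in>\<D>. v \<omega>)"
  have s: "s \<in> borel_measurable M" unfolding s_def
    using \<D>(1,2) meas by (intro borel_measurable_SUP) blast+
  have up: "AE \<omega> in M. L0_rep X \<omega> \<le> L0_rep (L0_class M s) \<omega>" if "X \<in> \<X>" for X
    using \<D>(3)[rule_format, of "L0_rep X"] that L0_rep_class(2)[OF s] unfolding s_def
    by (auto elim!: eventually_elim2)
  have le: "AE \<omega> in M. L0_rep (L0_class M s) \<omega> \<le> v \<omega>"
    if "\<And>X. X \<in> \<X> \<Longrightarrow> AE \<omega> in M. L0_rep X \<omega> \<le> v \<omega>" for v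
  proof -
    have "AE \<omega> in M. \<forall>u\<in>\<D>. u \<omega> \<le> v \<omega>" using \<D> that by (subst AE_ball_countable) auto
    then show ?thesis using L0_rep_class(2)[OF s]
      by eventually_elim (auto simp: s_def intro: SUP_least)
  qed
  have sup: "\<Squnion>\<^bsub>L0_order M\<^esub> \<X> = L0_class M s"
    by (rule L0_sup_eqI) (use L0_class_in_L0[OF s] assms up le in auto)
  show "\<Squnion>\<^bsub>L0_order M\<^esub> \<X> \<in> L0 M" by (simp add: sup L0_class_in_L0[OF s])
  show "AE \<omega> in M. L0_rep X \<omega> \<le> L0_rep (\<Squnion>\<^bsub>L0_order M\<^esub> \<X>) \<omega>" if "X \<in> \<X>"
    unfolding sup by (rule up[OF that])
  show "AE \<omega> in M. L0_rep (\<Squnion>\<^bsub>L0_order M\<^esub> \<X>) \<omega> \<le> v \<omega>"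
    if "v \<in> borel_measurable M" "\<And>X. X \<in> \<X> \<Longrightarrow> AE \<omega> in M. L0_rep X \<omega> \<le> v \<omega>"
    unfolding sup by (rule le[OF that(2)])
qed

text \<open>Real-valued classes lack suprema of unbounded families, so the finite case, needed for
  \<open>fam_seminorm\<close>, is treated apart with a pointwise \<open>Max\<close>.\<close>

lemma L0_finite_sup_le_iff:
  fixes \<X> :: "('a \<Rightarrow> real) set set"
  assumes "finite \<X>" "\<X> \<noteq> {}" "\<X> \<subseteq> L0 M"
  shows "(AE \<omega> in M. L0_rep (\<Squnion>\<^bsub>L0_order M\<^esub> \<X>) \<omega> \<le> v \<omega>) \<longleftrightarrow>
    (\<forall>X\<in>\<X>. AE \<omega> in M. L0_rep X \<omega> \<le> v \<omega>)"
proof -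
  define s where "s = (\<lambda>\<omega>. Max ((\<lambda>X. L0_rep X \<omega>) ` \<X>))"
  have s: "s \<in> borel_measurable M" unfolding s_def
    using assms L0_rep_measurable by (intro borel_measurable_Max) blast+
  have iff: "(AE \<omega> in M. L0_rep (L0_class M s) \<omega> \<le> v \<omega>) \<longleftrightarrow>
    (\<forall>X\<in>\<X>. AE \<omega> in M. L0_rep X \<omega> \<le> v \<omega>)" for v
  proof -
    have "(AE \<omega> in M. L0_rep (L0_class M s) \<omega> \<le> v \<omega>) \<longleftrightarrow> (AE \<omega> in M. s \<omega> \<le> v \<omega>)"
    proof
      assume "AE \<omega> in M. L0_rep (L0_class M s) \<omega> \<le> v \<omega>"
      with L0_rep_class(2)[OF s] show "AE \<omega> in M. s \<omega> \<le> v \<omega>" by eventually_elim auto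
    next
      assume "AE \<omega> in M. s \<omega> \<le> v \<omega>"
      with L0_rep_class(2)[OF s] show "AE \<omega> in M. L0_rep (L0_class M s) \<omega> \<le> v \<omega>" by eventually_elim auto
    qed
    also have "\<dots> \<longleftrightarrow> (AE \<omega> in M. \<forall>X\<in>\<X>. L0_rep X \<omega> \<le> v \<omega>)"
      unfolding s_def using assms by (simp add: Max_le_iff)
    also have "\<dots> \<longleftrightarrow> (\<forall>X\<in>\<X>. AE \<omega> in M. L0_rep X \<omega> \<le> v \<omega>)"
      using assms by (intro AE_ball_countable countable_finite)
    finally show ?thesis .
  qed
  have up: "\<forall>X\<in>\<X>. AE \<omega> in M. L0_rep X \<omega> \<le> L0_rep (L0_class M s) \<omega>"
    using iff[of "L0_rep (L0_class M s)"] by simp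
  have "\<Squnion>\<^bsub>L0_order M\<^esub> \<X> = L0_class M s"
    by (rule L0_sup_eqI) (use L0_class_in_L0[OF s] assms up iff in auto)
  then show ?thesis using iff by simp
qed

text \<open>Nonemptiness keeps the infimum below \<open>\<infinity>\<close> and the lower bound
  \<open>l\<close> keeps it above \<open>-\<infinity>\<close>, so it has a real version. It will be
  the value of \<open>g\<close> at a vector in the Hahn-Banach proof.\<close>

lemma (in finite_measure) ex_real_ess_INF:
  fixes \<U> :: "('a \<Rightarrow> real) set"
  assumes "\<U> \<subseteq> borel_measurable M" "\<U> \<noteq> {}"
    and l: "\<And>u. u \<in> \<U> \<Longrightarrow> AE \<omega> in M. l \<omega> \<le> u \<omega>"
  shows "\<exists>b\<in>borel_measurable M. (\<forall>u\<in>\<U>. AE \<omega> in M. b \<omega> \<le> u \<omega>) \<and>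
    (\<forall>v. (\<forall>u\<in>\<U>. AE \<omega> in M. v \<omega> \<le> u \<omega>) \<longrightarrow> (AE \<omega> in M. v \<omega> \<le> b \<omega>))"
proof -
  let ?m = "\<lambda>u \<omega>. - ereal (u \<omega>)"
  have meas: "?m ` \<U> \<subseteq> borel_measurable M" using assms(1) by auto
  from ex_countable_ess_SUP[OF meas] obtain \<D> where \<D>: "countable \<D>" "\<D> \<subseteq> ?m ` \<U>"
    "\<forall>u\<in>\<U>. AE \<omega> in M. - ereal (u \<omega>) \<le> (SUP v\<in>\<D>. v \<omega>)" by auto
  define s where "s = (\<lambda>\<omega>. SUP v\<in>\<D>. v \<omega>)"
  have s: "s \<in> borel_measurable M" unfolding s_def
    using \<D>(1,2) meas by (intro borel_measurable_SUP) blast+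
  have le: "AE \<omega> in M. s \<omega> \<le> - ereal (v \<omega>)" if "\<And>u. u \<in> \<U> \<Longrightarrow> AE \<omega> in M. v \<omega> \<le> u \<omega>" for v
  proof -
    have "AE \<omega> in M. \<forall>d\<in>\<D>. d \<omega> \<le> - ereal (v \<omega>)" using \<D>(1,2) that by (subst AE_ball_countable) auto
    then show ?thesis by eventually_elim (auto simp: s_def intro: SUP_least)
  qed
  obtain u0 where u0: "u0 \<in> \<U>" using assms(2) by auto
  have fin: "AE \<omega> in M. \<bar>s \<omega>\<bar> \<noteq> \<infinity>"
  proof -
    have "AE \<omega> in M. s \<omega> \<le> - ereal (l \<omega>)" by (intro le l)
    moreover have "AE \<omega> in M. - ereal (u0 \<omega>) \<le> s \<omega>" using \<D>(3) u0 unfolding s_def by blast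
    ultimately show ?thesis by eventually_elim auto
  qed
  show ?thesis
  proof (intro bexI[of _ "\<lambda>\<omega>. - real_of_ereal (s \<omega>)"] conjI ballI allI impI)
    fix u assume "u \<in> \<U>"
    with \<D>(3) have "AE \<omega> in M. - ereal (u \<omega>) \<le> s \<omega>" unfolding s_def by auto
    then show "AE \<omega> in M. - real_of_ereal (s \<omega>) \<le> u \<omega>" using fin
      by eventually_elim (auto simp: ereal_uminus_le_reorder real_of_ereal_ord_simps)
  next
    fix v assume "\<forall>u\<in>\<U>. AE \<omega> in M. v \<omega> \<le> u \<omega>"
    then have "AE \<omega> in M. s \<omega> \<le> - ereal (v \<omega>)" by (intro le) auto
    then show "AE \<omega> in M. v \<omega> \<le> - real_of_ereal (s \<omega>)" using fin
    proof eventually_elim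
      case (elim \<omega>) then show ?case by (cases "s \<omega>") auto
    qed
  qed (use s in measurable)
qed

section \<open>A Hahn--Banach theorem with values in classes of random variables\<close>

text \<open>
  A submonoid \<open>K\<close> of pairs \<open>(w, b)\<close> stands for the constraints \<open>g w \<le> b\<close> on an additive \<open>g\<close>. They
  are consistent iff they do not force \<open>g 0 < 0\<close>. A maximal consistent family determines \<open>g\<close>.
\<close>

definition consistent :: "'a measure \<Rightarrow> ('e, 'm) ring_scheme \<Rightarrow> ('e \<times> ('a \<Rightarrow> real)) set \<Rightarrow> bool" where
  "consistent M E K \<longleftrightarrow> K \<subseteq> carrier E \<times> borel_measurable M \<and> (\<zero>\<^bsub>E\<^esub>, \<lambda>_. 0) \<in> K \<and>
     (\<forall>v b w c. (v, b) \<in> K \<longrightarrow> (w, c) \<in> K \<longrightarrow> (v \<oplus>\<^bsub>E\<^esub> w, \<lambda>\<omega>. b \<omega> + c \<omega>) \<in> K) \<and>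
     (\<forall>b. (\<zero>\<^bsub>E\<^esub>, b) \<in> K \<longrightarrow> (AE \<omega> in M. 0 \<le> b \<omega>))"

lemma consistentD:
  assumes "consistent M E K"
  shows "(v, b) \<in> K \<Longrightarrow> v \<in> carrier E" "(v, b) \<in> K \<Longrightarrow> b \<in> borel_measurable M"
    "(\<zero>\<^bsub>E\<^esub>, \<lambda>_. 0) \<in> K"
    "(v, b) \<in> K \<Longrightarrow> (w, c) \<in> K \<Longrightarrow> (v \<oplus>\<^bsub>E\<^esub> w, \<lambda>\<omega>. b \<omega> + c \<omega>) \<in> K"
    "(\<zero>\<^bsub>E\<^esub>, b) \<in> K \<Longrightarrow> AE \<omega> in M. 0 \<le> b \<omega>"
  using assms unfolding consistent_def by auto

lemma (in abelian_group) consistent_multiple: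
  assumes K: "consistent M G K" and "(v, b) \<in> K"
  shows "([n] \<cdot> v, \<lambda>\<omega>. real n * b \<omega>) \<in> K"
proof (induction n)
  case 0
  then show ?case using consistentD(3)[OF K] by simp
next
  case (Suc n)
  from consistentD(4)[OF K Suc assms(2)] show ?case by (simp add: algebra_simps)
qed

text \<open>In the submonoid generated by \<open>K\<close> and \<open>(v, b)\<close>, a constraint
  at zero comes from some \<open>w\<close> with \<open>w + n v\<close> equal to zero. For
  \<open>n = 0\<close> it already lies in \<open>K\<close>; for \<open>n > 0\<close> it is covered
  by the hypothesis \<open>pos\<close>.\<close>

lemma (in abelian_group) consistent_adjoin:
  assumes K: "consistent M G K" and v: "v \<in> carrier G" and b: "b \<in> borel_measurable M"
    and pos: "\<And>n w c. n > 0 \<Longrightarrow> (w, c) \<in> K \<Longrightarrow> w \<oplus> [n] \<cdot> v = \<zero> \<Longrightarrow> AE \<omega> in M. 0 \<le> c \<omega> + real n * b \<omega>"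
  shows "\<exists>K'. consistent M G K' \<and> insert (v, b) K \<subseteq> K'"
proof -
  define K' where "K' = {(w \<oplus> [n] \<cdot> v, \<lambda>\<omega>. c \<omega> + real n * b \<omega>) | w c n. (w, c) \<in> K}"
  have K'I: "(w \<oplus> [n] \<cdot> v, \<lambda>\<omega>. c \<omega> + real n * b \<omega>) \<in> K'" if "(w, c) \<in> K" for w c n
    using that unfolding K'_def by auto
  have sub: "K \<subseteq> K'"
  proof
    fix p assume p: "p \<in> K"
    obtain w c where [simp]: "p = (w, c)" by (cases p)
    show "p \<in> K'" using K'I[of w c 0] consistentD(1)[OF K, of w c] p by simp
  qed
  have "(v, b) \<in> K'" using K'I[OF consistentD(3)[OF K], of 1] v by simp
  moreover have "consistent M G K'" unfolding consistent_def
  proof (intro conjI allI impI)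
    show "K' \<subseteq> carrier G \<times> borel_measurable M"
      unfolding K'_def using consistentD(1,2)[OF K] v b by auto
    show "(\<zero>, \<lambda>_. 0) \<in> K'" using sub consistentD(3)[OF K] by auto
  next
    fix x d y e assume "(x, d) \<in> K'" "(y, e) \<in> K'"
    then obtain w c n w' c' n' where
      1: "(w, c) \<in> K" "x = w \<oplus> [n] \<cdot> v" "d = (\<lambda>\<omega>. c \<omega> + real n * b \<omega>)" and
      2: "(w', c') \<in> K" "y = w' \<oplus> [n'] \<cdot> v" "e = (\<lambda>\<omega>. c' \<omega> + real n' * b \<omega>)"
      unfolding K'_def by auto
    have "x \<oplus> y = (w \<oplus> w') \<oplus> ([(n + n')] \<cdot> v)"
      using 1(1) 2(1) v consistentD(1)[OF K]
      by (simp add: 1(2) 2(2) add.nat_pow_mult[symmetric] a_ac)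
    moreover have "(\<lambda>\<omega>. d \<omega> + e \<omega>) = (\<lambda>\<omega>. (c \<omega> + c' \<omega>) + real (n + n') * b \<omega>)"
      by (simp add: 1(3) 2(3) algebra_simps)
    ultimately show "(x \<oplus> y, \<lambda>\<omega>. d \<omega> + e \<omega>) \<in> K'"
      using K'I[OF consistentD(4)[OF K 1(1) 2(1)], of "n + n'"] by simp
  next
    fix d assume "(\<zero>, d) \<in> K'"
    then obtain w c n where 1: "(w, c) \<in> K" "\<zero> = w \<oplus> [n] \<cdot> v" "d = (\<lambda>\<omega>. c \<omega> + real n * b \<omega>)"
      unfolding K'_def by auto
    show "AE \<omega> in M. 0 \<le> d \<omega>"
    proof (cases "n = 0")
      case True
      with 1 have "(\<zero>, d) \<in> K" using consistentD(1)[OF K 1(1)] by simp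
      then show ?thesis by (rule consistentD(5)[OF K])
    next
      case False
      then show ?thesis using pos[of n w c] 1 by simp
    qed
  qed
  ultimately show ?thesis using sub by blast
qed

text \<open>By \<open>total\<close> there is an upper bound for \<open>g v\<close> and, through
  \<open>- v\<close>, a lower one; this makes the essential infimum that defines \<open>g v\<close>
  real valued. A maximal family then contains \<open>(v, b)\<close> together with
  \<open>(- v, - b)\<close> for that infimum \<open>b\<close>, which leaves no freedom for
  \<open>g v\<close>.\<close>

theorem (in abelian_group) ex_additive_below_constraints:
  assumes M: "prob_space M" and K0: "consistent M G K0"
    and total: "\<And>v. v \<in> carrier G \<Longrightarrow> \<exists>b. (v, b) \<in> K0"
  shows "\<exists>g. (\<forall>v\<in>carrier G. g v \<in> borel_measurable M) \<and>
    (\<forall>v\<in>carrier G. \<forall>w\<in>carrier G. AE \<omega> in M. g (v \<oplus> w) \<omega> = g v \<omega> + g w \<omega>) \<and>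
    (\<forall>(v, b)\<in>K0. AE \<omega> in M. g v \<omega> \<le> b \<omega>)"
proof -
  interpret prob_space M by (rule M)
  let ?A = "{K. consistent M G K \<and> K0 \<subseteq> K}"
  have "\<exists>K\<in>?A. \<forall>X\<in>?A. K \<subseteq> X \<longrightarrow> X = K"
  proof (rule subset_Zorn_nonempty)
    show "?A \<noteq> {}" using K0 by auto
    fix \<C> assume \<C>: "\<C> \<noteq> {}" "subset.chain ?A \<C>"
    have ok: "\<And>K. K \<in> \<C> \<Longrightarrow> consistent M G K" "\<And>K. K \<in> \<C> \<Longrightarrow> K0 \<subseteq> K"
      using \<C>(2) by (auto simp: subset.chain_def)
    have "consistent M G (\<Union>\<C>)" unfolding consistent_def
    proof (intro conjI allI impI)
      show "\<Union>\<C> \<subseteq> carrier G \<times> borel_measurable M" using ok(1) by (auto dest: consistentD)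
      show "(\<zero>, \<lambda>_. 0) \<in> \<Union>\<C>" using \<C>(1) ok(1) by (auto dest: consistentD)
    next
      fix v b w c assume "(v, b) \<in> \<Union>\<C>" "(w, c) \<in> \<Union>\<C>"
      then obtain X Y where XY: "X \<in> \<C>" "Y \<in> \<C>" "(v, b) \<in> X" "(w, c) \<in> Y" by auto
      with \<C>(2) have "X \<subseteq> Y \<or> Y \<subseteq> X" by (meson subset_chain_def)
      with XY obtain Z where "Z \<in> \<C>" "(v, b) \<in> Z" "(w, c) \<in> Z" by blast
      then show "(v \<oplus> w, \<lambda>\<omega>. b \<omega> + c \<omega>) \<in> \<Union>\<C>" using consistentD(4)[OF ok(1)] by blast
    next
      fix b assume "(\<zero>, b) \<in> \<Union>\<C>"
      then show "AE \<omega> in M. 0 \<le> b \<omega>" using consistentD(5)[OF ok(1)] by blast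
    qed
    with \<C>(1) ok(2) show "\<Union>\<C> \<in> ?A" by auto
  qed
  then obtain K where K: "consistent M G K" "K0 \<subseteq> K"
    and max: "\<And>X. consistent M G X \<Longrightarrow> K \<subseteq> X \<Longrightarrow> X = K" by auto
  \<comment> \<open>Maximality turns the consistency of an enlarged family into membership.\<close>
  have adj: "(v, b) \<in> K" if "v \<in> carrier G" "b \<in> borel_measurable M"
    "\<And>n w c. n > 0 \<Longrightarrow> (w, c) \<in> K \<Longrightarrow> w \<oplus> [n] \<cdot> v = \<zero> \<Longrightarrow> AE \<omega> in M. 0 \<le> c \<omega> + real n * b \<omega>" for v b
  proof -
    have "\<exists>K'. consistent M G K' \<and> insert (v, b) K \<subseteq> K'"
      by (rule consistent_adjoin[OF K(1) that(1,2)]) (rule that(3))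
    then show ?thesis using max by blast
  qed
  have mult: "([n] \<cdot> v, \<lambda>\<omega>. real n * b \<omega>) \<in> K" if "(v, b) \<in> K" for n v b
    by (rule consistent_multiple[OF K(1) that])
  have ex: "\<exists>b. (v, b) \<in> K \<and> (\<ominus> v, \<lambda>\<omega>. - b \<omega>) \<in> K" if v: "v \<in> carrier G" for v
  proof -
    define \<U> where "\<U> = {\<lambda>\<omega>. c \<omega> / real n | n c. n > 0 \<and> ([n] \<cdot> v, c) \<in> K}"
    have meas: "\<U> \<subseteq> borel_measurable M" unfolding \<U>_def
      using consistentD(2)[OF K(1)] by (auto intro!: borel_measurable_divide)
    obtain d where "(v, d) \<in> K" using total[OF v] K(2) by auto
    then have ne: "\<U> \<noteq> {}" unfolding \<U>_def using v by (auto intro!: exI[of _ 1] exI[of _ d])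
    \<comment> \<open>Here \<open>w\<close> is \<open>- m v\<close>. Taking \<open>n\<close> copies
      of its constraint and \<open>m\<close> copies of the one on \<open>n v\<close> gives a
      constraint at zero, and consistency compares the two bounds after division by
      \<open>n m\<close>.\<close>
    have low: "AE \<omega> in M. - d \<omega> / real m \<le> u \<omega>"
      if wd: "(w, d) \<in> K" and m: "m > 0" and z: "w \<oplus> [m] \<cdot> v = \<zero>" and u: "u \<in> \<U>" for u w d m
    proof -
      obtain n c where n: "u = (\<lambda>\<omega>. c \<omega> / real n)" "n > 0" "([n] \<cdot> v, c) \<in> K"
        using u unfolding \<U>_def by auto
      have w: "w \<in> carrier G" using wd by (rule consistentD(1)[OF K(1)])
      have "([n] \<cdot> w) \<oplus> ([m] \<cdot> ([n] \<cdot> v)) = [n] \<cdot> (w \<oplus> [m] \<cdot> v)"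
        using v w by (simp add: add.nat_pow_pow mult.commute add.nat_pow_distrib)
      also have "\<dots> = \<zero>" by (simp add: z)
      finally have "(\<zero>, \<lambda>\<omega>. real n * d \<omega> + real m * c \<omega>) \<in> K"
        using consistentD(4)[OF K(1) mult[OF wd, of n] mult[OF n(3), of m]] by simp
      from consistentD(5)[OF K(1) this] show ?thesis
        by eventually_elim (use n(2) m in \<open>simp add: n(1) field_simps\<close>)
    qed
    \<comment> \<open>The case \<open>m = 1\<close> of \<open>low\<close>, with \<open>w\<close>
      equal to \<open>- v\<close>, is the lower bound that the infimum requires.\<close>
    obtain d' where d': "(\<ominus> v, d') \<in> K" using total[of "\<ominus> v"] v K(2) by auto
    have "\<And>u. u \<in> \<U> \<Longrightarrow> AE \<omega> in M. - d' \<omega> / real 1 \<le> u \<omega>"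
      by (rule low[OF d']) (use v in \<open>simp_all add: l_neg\<close>)
    from ex_real_ess_INF[OF meas ne this] obtain b where b: "b \<in> borel_measurable M"
      "\<And>u. u \<in> \<U> \<Longrightarrow> AE \<omega> in M. b \<omega> \<le> u \<omega>"
      "\<And>l. (\<And>u. u \<in> \<U> \<Longrightarrow> AE \<omega> in M. l \<omega> \<le> u \<omega>) \<Longrightarrow> AE \<omega> in M. l \<omega> \<le> b \<omega>" by blast
    \<comment> \<open>\<open>b\<close> is the largest value of \<open>g v\<close> compatible with \<open>K\<close>; dividing by \<open>n\<close> replaces the
      homogeneity of a sublinear majorant, so that no scalars are needed here.\<close>
    have 1: "(v, b) \<in> K"
    proof (rule adj[OF v b(1)])
      fix n :: nat and w c assume n: "n > 0" "(w, c) \<in> K" "w \<oplus> [n] \<cdot> v = \<zero>"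
      have "AE \<omega> in M. - c \<omega> / real n \<le> b \<omega>" by (rule b(3)) (rule low[OF n(2,1,3)])
      then show "AE \<omega> in M. 0 \<le> c \<omega> + real n * b \<omega>"
        by eventually_elim (use n(1) in \<open>simp add: field_simps\<close>)
    qed
    have 2: "(\<ominus> v, \<lambda>\<omega>. - b \<omega>) \<in> K"
    proof (rule adj)
      fix n :: nat and w c assume n: "n > 0" "(w, c) \<in> K" "w \<oplus> [n] \<cdot> (\<ominus> v) = \<zero>"
      have w: "w \<in> carrier G" using n(2) by (rule consistentD(1)[OF K(1)])
      have "w = [n] \<cdot> v" using n(3) v w by (metis a_inv_closed add.inv_equality add.nat_pow_closed add.nat_pow_inv minus_minus)
      then have "(\<lambda>\<omega>. c \<omega> / real n) \<in> \<U>" unfolding \<U>_def using n by auto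
      from b(2)[OF this] show "AE \<omega> in M. 0 \<le> c \<omega> + real n * - b \<omega>"
        by eventually_elim (use n(1) in \<open>simp add: field_simps\<close>)
    qed (use v b in auto)
    from 1 2 show ?thesis by blast
  qed
  define g where "g = (\<lambda>v. SOME b. (v, b) \<in> K \<and> (\<ominus> v, \<lambda>\<omega>. - b \<omega>) \<in> K)"
  have g: "(v, g v) \<in> K" "(\<ominus> v, \<lambda>\<omega>. - g v \<omega>) \<in> K" if "v \<in> carrier G" for v
    using someI_ex[OF ex[OF that]] unfolding g_def by auto
  \<comment> \<open>Adding the constraint at \<open>- v\<close> moves any bound at \<open>v\<close>
    to zero, where consistency applies.\<close>
  have le: "AE \<omega> in M. g v \<omega> \<le> c \<omega>" if "(v, c) \<in> K" for v c
  proof -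
    have v: "v \<in> carrier G" using that by (rule consistentD(1)[OF K(1)])
    have "(\<zero>, \<lambda>\<omega>. - g v \<omega> + c \<omega>) \<in> K" using consistentD(4)[OF K(1) g(2)[OF v] that] v by (simp add: l_neg)
    from consistentD(5)[OF K(1) this] show ?thesis by eventually_elim simp
  qed
  have add: "AE \<omega> in M. g (v \<oplus> w) \<omega> = g v \<omega> + g w \<omega>" if v: "v \<in> carrier G" and w: "w \<in> carrier G" for v w
  proof -
    have 1: "AE \<omega> in M. g (v \<oplus> w) \<omega> \<le> g v \<omega> + g w \<omega>"
      using le[OF consistentD(4)[OF K(1) g(1)[OF v] g(1)[OF w]]] .
    \<comment> \<open>The reverse inequality: the constraints at \<open>- v\<close>,
      \<open>- w\<close> and \<open>v + w\<close> add up to one at zero.\<close>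
    have "(\<ominus> v \<oplus> \<ominus> w \<oplus> (v \<oplus> w), \<lambda>\<omega>. - g v \<omega> + - g w \<omega> + g (v \<oplus> w) \<omega>) \<in> K"
      using consistentD(4)[OF K(1) consistentD(4)[OF K(1) g(2)[OF v] g(2)[OF w]] g(1)[of "v \<oplus> w"]] v w by simp
    moreover have "\<ominus> v \<oplus> \<ominus> w \<oplus> (v \<oplus> w) = \<zero>" using v w by (simp add: minus_add[symmetric] l_neg)
    ultimately have "AE \<omega> in M. 0 \<le> - g v \<omega> + - g w \<omega> + g (v \<oplus> w) \<omega>"
      using consistentD(5)[OF K(1)] by metis
    with 1 show ?thesis by eventually_elim simp
  qed
  show ?thesis
    using g(1) consistentD(2)[OF K(1)] add le K(2) by (intro exI[of _ g]) blast
qed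

section \<open>Modules over classes of random variables\<close>

locale L0_mod = prob_space M + Module.module "L0_ring M" E
  for M :: "'a measure"
    and E :: "(('a \<Rightarrow> real) set, 'e) module"
begin

text \<open>Scalars are functions here and not classes, so identities between them are checked
  pointwise or almost everywhere, and \<open>sc_cong\<close> absorbs the null sets.\<close>

definition sc :: "('a \<Rightarrow> real) \<Rightarrow> 'e \<Rightarrow> 'e" where
  "sc u x = L0_class M u \<odot>\<^bsub>E\<^esub> x"

lemma L0_ring_simps:
  "carrier (L0_ring M) = L0 M" "mult (L0_ring M) = L0_mult M" "one (L0_ring M) = L0_const M 1"
  "zero (L0_ring M) = L0_const M 0" "add (L0_ring M) = L0_add M"
  by (simp_all add: L0_ring_def)

lemma L0_class_mult:
  assumes [measurable]: "u \<in> borel_measurable M" "v \<in> borel_measurable M"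
  shows "L0_mult M (L0_class M u) (L0_class M v) = L0_class M (\<lambda>\<omega>. u \<omega> * v \<omega> :: real)"
  unfolding L0_mult_def
proof (rule L0_class_eqI)
  show "AE \<omega> in M. L0_rep (L0_class M u) \<omega> * L0_rep (L0_class M v) \<omega> = u \<omega> * v \<omega>"
    using L0_rep_class(2)[OF assms(1)] L0_rep_class(2)[OF assms(2)] by eventually_elim simp
qed (use L0_rep_class(1)[OF assms(1)] L0_rep_class(1)[OF assms(2)] in measurable)

lemma L0_class_add:
  assumes [measurable]: "u \<in> borel_measurable M" "v \<in> borel_measurable M"
  shows "L0_add M (L0_class M u) (L0_class M v) = L0_class M (\<lambda>\<omega>. u \<omega> + v \<omega> :: real)"
  unfolding L0_add_def
proof (rule L0_class_eqI)
  show "AE \<omega> in M. L0_rep (L0_class M u) \<omega> + L0_rep (L0_class M v) \<omega> = u \<omega> + v \<omega>"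
    using L0_rep_class(2)[OF assms(1)] L0_rep_class(2)[OF assms(2)] by eventually_elim simp
qed (use L0_rep_class(1)[OF assms(1)] L0_rep_class(1)[OF assms(2)] in measurable)

lemma sc_closed [simp]: "u \<in> borel_measurable M \<Longrightarrow> x \<in> carrier E \<Longrightarrow> sc u x \<in> carrier E"
  unfolding sc_def using smult_closed[of "L0_class M u" x] by (simp add: L0_ring_simps L0_class_in_L0)

lemma sc_sc:
  "u \<in> borel_measurable M \<Longrightarrow> v \<in> borel_measurable M \<Longrightarrow> x \<in> carrier E \<Longrightarrow>
    sc u (sc v x) = sc (\<lambda>\<omega>. u \<omega> * v \<omega>) x"
  unfolding sc_def using smult_assoc1[of "L0_class M u" "L0_class M v" x]
  by (simp add: L0_ring_simps L0_class_in_L0 L0_class_mult)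

lemma sc_add_left:
  "u \<in> borel_measurable M \<Longrightarrow> v \<in> borel_measurable M \<Longrightarrow> x \<in> carrier E \<Longrightarrow>
    sc (\<lambda>\<omega>. u \<omega> + v \<omega>) x = sc u x \<oplus>\<^bsub>E\<^esub> sc v x"
  unfolding sc_def using smult_l_distr[of "L0_class M u" "L0_class M v" x]
  by (simp add: L0_ring_simps L0_class_in_L0 L0_class_add)

lemma sc_add_right:
  "u \<in> borel_measurable M \<Longrightarrow> x \<in> carrier E \<Longrightarrow> y \<in> carrier E \<Longrightarrow>
    sc u (x \<oplus>\<^bsub>E\<^esub> y) = sc u x \<oplus>\<^bsub>E\<^esub> sc u y"
  unfolding sc_def using smult_r_distr[of "L0_class M u" x y]
  by (simp add: L0_ring_simps L0_class_in_L0)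

lemma sc_one: "x \<in> carrier E \<Longrightarrow> sc (\<lambda>_. 1) x = x"
  unfolding sc_def using smult_one[of x] by (simp add: L0_ring_simps L0_const_def)

lemma sc_zero: "x \<in> carrier E \<Longrightarrow> sc (\<lambda>_. 0) x = \<zero>\<^bsub>E\<^esub>"
  unfolding sc_def using smult_l_null[of x] by (simp add: L0_ring_simps L0_const_def)

lemma sc_null: "u \<in> borel_measurable M \<Longrightarrow> sc u \<zero>\<^bsub>E\<^esub> = \<zero>\<^bsub>E\<^esub>"
  unfolding sc_def using smult_r_null[of "L0_class M u"] by (simp add: L0_ring_simps L0_class_in_L0)

lemma sc_cong:
  "u \<in> borel_measurable M \<Longrightarrow> v \<in> borel_measurable M \<Longrightarrow> AE \<omega> in M. u \<omega> = v \<omega> \<Longrightarrow> sc u x = sc v x"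
  unfolding sc_def by (metis L0_class_eqI)

lemma smult_eq_sc: "\<xi> \<in> L0 M \<Longrightarrow> \<xi> \<odot>\<^bsub>E\<^esub> x = sc (L0_rep \<xi>) x"
  unfolding sc_def by (simp add: L0_class_rep(2))

lemma ind_smult_eq_sc: "L0_ind M A \<odot>\<^bsub>E\<^esub> x = sc (indicator A) x"
  unfolding sc_def L0_ind_def ..

lemma sc_uminus: "u \<in> borel_measurable M \<Longrightarrow> x \<in> carrier E \<Longrightarrow> sc (\<lambda>\<omega>. - u \<omega>) x = \<ominus>\<^bsub>E\<^esub> sc u x"
  using sc_add_left[of "\<lambda>\<omega>. - u \<omega>" u x] sc_zero[of x] by (intro M.minus_equality[symmetric]) auto

lemma sc_a_inv: "u \<in> borel_measurable M \<Longrightarrow> x \<in> carrier E \<Longrightarrow> sc u (\<ominus>\<^bsub>E\<^esub> x) = \<ominus>\<^bsub>E\<^esub> sc u x"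
  using sc_add_right[of u "\<ominus>\<^bsub>E\<^esub> x" x] by (intro M.minus_equality[symmetric]) (auto simp: M.l_neg sc_null)

lemma sc_minus_right:
  "u \<in> borel_measurable M \<Longrightarrow> x \<in> carrier E \<Longrightarrow> y \<in> carrier E \<Longrightarrow>
    sc u (x \<ominus>\<^bsub>E\<^esub> y) = sc u x \<ominus>\<^bsub>E\<^esub> sc u y"
  by (simp add: a_minus_def sc_add_right sc_a_inv)

lemma sc_minus_left:
  "u \<in> borel_measurable M \<Longrightarrow> v \<in> borel_measurable M \<Longrightarrow> x \<in> carrier E \<Longrightarrow>
    sc (\<lambda>\<omega>. u \<omega> - v \<omega>) x = sc u x \<ominus>\<^bsub>E\<^esub> sc v x"
  using sc_add_left[of u "\<lambda>\<omega>. - v \<omega>" x] by (simp add: a_minus_def sc_uminus)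

lemma sc_split:
  assumes "A \<in> sets M" "x \<in> carrier E"
  shows "x = sc (indicator A) x \<oplus>\<^bsub>E\<^esub> sc (indicator (space M - A)) x"
proof -
  have [measurable]: "A \<in> sets M" by fact
  have "sc (indicator A) x \<oplus>\<^bsub>E\<^esub> sc (indicator (space M - A)) x =
      sc (\<lambda>\<omega>. indicator A \<omega> + indicator (space M - A) \<omega>) x"
    using assms by (intro sc_add_left[symmetric]) auto
  also have "\<dots> = sc (\<lambda>_. 1) x"
    using AE_space by (intro sc_cong) (auto elim!: eventually_mono simp: indicator_def)
  finally show ?thesis using sc_one assms by simp
qed

text \<open>
  Domination makes \<open>g\<close> local, so additivity yields homogeneity for integer valued multipliers. For
  general \<open>u\<close>, split \<open>n * u\<close> into integer and fractional part; the error is at most \<open>q x\<close>, and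
  dividing by \<open>n\<close> removes it.
\<close>

lemma additive_dominated_homogeneous:
  fixes g q :: "'e \<Rightarrow> 'a \<Rightarrow> real"
  assumes g: "\<And>x. x \<in> carrier E \<Longrightarrow> g x \<in> borel_measurable M"
    and add: "\<And>x y. x \<in> carrier E \<Longrightarrow> y \<in> carrier E \<Longrightarrow> AE \<omega> in M. g (x \<oplus>\<^bsub>E\<^esub> y) \<omega> = g x \<omega> + g y \<omega>"
    and q: "\<And>u x. u \<in> borel_measurable M \<Longrightarrow> x \<in> carrier E \<Longrightarrow> AE \<omega> in M. q (sc u x) \<omega> = \<bar>u \<omega>\<bar> * q x \<omega>"
    and dom: "\<And>x. x \<in> carrier E \<Longrightarrow> AE \<omega> in M. \<bar>g x \<omega>\<bar> \<le> q x \<omega>"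
    and u [measurable]: "u \<in> borel_measurable M" and x: "x \<in> carrier E"
  shows "AE \<omega> in M. g (sc u x) \<omega> = u \<omega> * g x \<omega>"
proof -
  have loc: "AE \<omega> in M. g (sc (indicator A) x) \<omega> = indicator A \<omega> * g x \<omega>"
    if A [measurable]: "A \<in> sets M" and x: "x \<in> carrier E" for A x
  proof -
    have "AE \<omega> in M. g x \<omega> = g (sc (indicator A) x) \<omega> + g (sc (indicator (space M - A)) x) \<omega>"
      using add[of "sc (indicator A) x" "sc (indicator (space M - A)) x"] sc_split[OF A x] x A by simp
    \<comment> \<open>Used for \<open>A\<close> and for its complement: off the respective set the
      bound is zero, so at almost every point one of the two summands of \<open>g x\<close>
      vanishes.\<close>
    moreover have "AE \<omega> in M. \<bar>g (sc (indicator B) x) \<omega>\<bar> \<le> \<bar>indicator B \<omega>\<bar> * q x \<omega>"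
      if [measurable]: "B \<in> sets M" for B
      using dom[of "sc (indicator B) x"] q[of "indicator B" x] x that
      by (auto elim!: eventually_elim2)
    from this[of A] this[of "space M - A"]
    have "AE \<omega> in M. \<bar>g (sc (indicator A) x) \<omega>\<bar> \<le> \<bar>indicator A \<omega>\<bar> * q x \<omega>"
      "AE \<omega> in M. \<bar>g (sc (indicator (space M - A)) x) \<omega>\<bar> \<le> \<bar>indicator (space M - A) \<omega>\<bar> * q x \<omega>" by auto
    ultimately show ?thesis
      by eventually_elim (auto simp: indicator_def split: if_splits)
  qed
  have zero: "AE \<omega> in M. g \<zero>\<^bsub>E\<^esub> \<omega> = 0"
    using add[of "\<zero>\<^bsub>E\<^esub>" "\<zero>\<^bsub>E\<^esub>"] by simp
  have nat: "AE \<omega> in M. g (sc (\<lambda>_. real n) x) \<omega> = real n * g x \<omega>" if x: "x \<in> carrier E" for n x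
  proof (induction n)
    case 0
    show ?case using zero by (simp add: sc_zero x)
  next
    case (Suc n)
    have "sc (\<lambda>_. real (Suc n)) x = sc (\<lambda>_. real n) x \<oplus>\<^bsub>E\<^esub> x"
      using sc_add_left[of "\<lambda>_. real n" "\<lambda>_. 1" x] x by (simp add: sc_one add.commute)
    with add[of "sc (\<lambda>_. real n) x" x] x
    have "AE \<omega> in M. g (sc (\<lambda>_. real (Suc n)) x) \<omega> = g (sc (\<lambda>_. real n) x) \<omega> + g x \<omega>" by simp
    with Suc show ?case by eventually_elim (simp add: algebra_simps)
  qed
  have int: "AE \<omega> in M. g (sc (\<lambda>_. of_int k) x) \<omega> = of_int k * g x \<omega>" for k
  proof (cases "k \<ge> 0")
    case True
    then show ?thesis using nat[OF x, of "nat k"] by simp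
  next
    case False
    then have k: "real (nat (- k)) = - of_int k" by simp
    have "sc (\<lambda>_. of_int k) x \<oplus>\<^bsub>E\<^esub> sc (\<lambda>_. real (nat (- k))) x = \<zero>\<^bsub>E\<^esub>"
      using sc_add_left[of "\<lambda>_. of_int k" "\<lambda>_. real (nat (- k))" x] x by (simp add: k sc_zero)
    with add[of "sc (\<lambda>_. of_int k) x" "sc (\<lambda>_. real (nat (- k))) x"] x
    have "AE \<omega> in M. g \<zero>\<^bsub>E\<^esub> \<omega> = g (sc (\<lambda>_. of_int k) x) \<omega> + g (sc (\<lambda>_. real (nat (- k))) x) \<omega>" by simp
    with nat[OF x, of "nat (- k)"] zero show ?thesis by eventually_elim (simp add: k)
  qed
  have intv: "AE \<omega> in M. g (sc (\<lambda>\<omega>. of_int \<lfloor>v \<omega>\<rfloor>) x) \<omega> = of_int \<lfloor>v \<omega>\<rfloor> * g x \<omega>"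
    if v [measurable]: "v \<in> borel_measurable M" for v :: "'a \<Rightarrow> real"
  proof -
    \<comment> \<open>A multiplier with integer values is constant on each of countably many events;
      locality reduces each of them to the constant multiplier \<open>k\<close>.\<close>
    have "AE \<omega> in M. \<forall>k::int. \<lfloor>v \<omega>\<rfloor> = k \<longrightarrow>
      g (sc (\<lambda>\<omega>. of_int \<lfloor>v \<omega>\<rfloor>) x) \<omega> = of_int \<lfloor>v \<omega>\<rfloor> * g x \<omega>"
    proof (subst AE_all_countable, intro allI)
      fix k :: int
      let ?A = "{\<omega> \<in> space M. \<lfloor>v \<omega>\<rfloor> = k}"
      have A: "?A \<in> sets M" by measurable
      have "sc (indicator ?A) (sc (\<lambda>\<omega>. of_int \<lfloor>v \<omega>\<rfloor>) x) = sc (indicator ?A) (sc (\<lambda>_. of_int k) x)"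
        using x A by (subst (1 2) sc_sc) (auto intro!: sc_cong AE_I2 simp: indicator_def)
      with loc[OF A, of "sc (\<lambda>\<omega>. of_int \<lfloor>v \<omega>\<rfloor>) x"] loc[OF A, of "sc (\<lambda>_. of_int k) x"] x
      have "AE \<omega> in M. indicator ?A \<omega> * g (sc (\<lambda>\<omega>. of_int \<lfloor>v \<omega>\<rfloor>) x) \<omega> =
        indicator ?A \<omega> * g (sc (\<lambda>_. of_int k) x) \<omega>" by (auto elim!: eventually_elim2)
      with int[of k] AE_space show "AE \<omega> in M. \<lfloor>v \<omega>\<rfloor> = k \<longrightarrow>
          g (sc (\<lambda>\<omega>. of_int \<lfloor>v \<omega>\<rfloor>) x) \<omega> = of_int \<lfloor>v \<omega>\<rfloor> * g x \<omega>"
        by eventually_elim auto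
    qed
    then show ?thesis by eventually_elim auto
  qed
  have "AE \<omega> in M. \<forall>n::nat. real n * \<bar>g (sc u x) \<omega> - u \<omega> * g x \<omega>\<bar> \<le> \<bar>g x \<omega>\<bar> + q x \<omega>"
  proof (subst AE_all_countable, intro allI)
    fix n :: nat
    let ?k = "\<lambda>\<omega>. of_int \<lfloor>real n * u \<omega>\<rfloor> :: real" and ?r = "\<lambda>\<omega>. frac (real n * u \<omega>)"
    have r [measurable]: "?r \<in> borel_measurable M" unfolding frac_def by measurable
    have "sc (\<lambda>_. real n) (sc u x) = sc (\<lambda>\<omega>. ?k \<omega> + ?r \<omega>) x"
      using x by (subst sc_sc) (auto simp: frac_def)
    also have "\<dots> = sc ?k x \<oplus>\<^bsub>E\<^esub> sc ?r x" using x by (intro sc_add_left) auto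
    finally have "AE \<omega> in M. g (sc (\<lambda>_. real n) (sc u x)) \<omega> = g (sc ?k x) \<omega> + g (sc ?r x) \<omega>"
      using add[of "sc ?k x" "sc ?r x"] x by simp
    moreover have "AE \<omega> in M. g (sc (\<lambda>_. real n) (sc u x)) \<omega> = real n * g (sc u x) \<omega>"
      using x by (intro nat) auto
    moreover have "AE \<omega> in M. g (sc ?k x) \<omega> = ?k \<omega> * g x \<omega>" by (rule intv) measurable
    moreover have "AE \<omega> in M. \<bar>g (sc ?r x) \<omega>\<bar> \<le> q (sc ?r x) \<omega>" using x by (intro dom) auto
    moreover have "AE \<omega> in M. q (sc ?r x) \<omega> = \<bar>?r \<omega>\<bar> * q x \<omega>" using x by (intro q) auto
    moreover note dom[OF x]
    ultimately show "AE \<omega> in M. real n * \<bar>g (sc u x) \<omega> - u \<omega> * g x \<omega>\<bar> \<le> \<bar>g x \<omega>\<bar> + q x \<omega>"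
    proof eventually_elim
      case (elim \<omega>)
      have f: "0 \<le> ?r \<omega>" "?r \<omega> \<le> 1" using frac_lt_1[of "real n * u \<omega>"] by auto
      have "?k \<omega> + ?r \<omega> = real n * u \<omega>" by (simp add: frac_def)
      then have nu: "real n * u \<omega> * g x \<omega> = ?k \<omega> * g x \<omega> + ?r \<omega> * g x \<omega>"
        by (simp only: distrib_right[symmetric])
      have "real n * \<bar>g (sc u x) \<omega> - u \<omega> * g x \<omega>\<bar> = \<bar>real n * g (sc u x) \<omega> - real n * u \<omega> * g x \<omega>\<bar>"
        by (simp add: abs_mult right_diff_distrib[symmetric] mult.assoc)
      also have "\<dots> = \<bar>g (sc ?r x) \<omega> - ?r \<omega> * g x \<omega>\<bar>"
        using nu elim(1-3) by (intro arg_cong[where f = abs]) linarith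
      also have "\<dots> \<le> \<bar>g (sc ?r x) \<omega>\<bar> + ?r \<omega> * \<bar>g x \<omega>\<bar>"
        using abs_triangle_ineq4[of "g (sc ?r x) \<omega>" "?r \<omega> * g x \<omega>"] f by (simp add: abs_mult)
      also have "\<dots> \<le> q x \<omega> + \<bar>g x \<omega>\<bar>"
      proof (rule add_mono)
        have "\<bar>?r \<omega>\<bar> * q x \<omega> \<le> q x \<omega>" using elim f by (intro mult_left_le_one_le) auto
        then show "\<bar>g (sc ?r x) \<omega>\<bar> \<le> q x \<omega>" using elim by linarith
        show "?r \<omega> * \<bar>g x \<omega>\<bar> \<le> \<bar>g x \<omega>\<bar>" using f by (intro mult_left_le_one_le) auto
      qed
      finally show ?case by simp
    qed
  qed
  then show ?thesis
  proof eventually_elim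
    case (elim \<omega>)
    show ?case
    proof (rule ccontr)
      assume "\<not> ?case"
      then have p: "0 < \<bar>g (sc u x) \<omega> - u \<omega> * g x \<omega>\<bar>" by simp
      from reals_Archimedean3[OF p] obtain n :: nat where
        "\<bar>g x \<omega>\<bar> + q x \<omega> < real n * \<bar>g (sc u x) \<omega> - u \<omega> * g x \<omega>\<bar>" by blast
      with elim show False by (simp add: not_less[symmetric])
    qed
  qed
qed

end

section \<open>The conditional base\<close>

context prob_space
begin

context
  fixes D :: "'a set"
  assumes D [measurable]: "D \<in> sets M" and pos: "measure M D > 0"
begin

text \<open>The notions over the conditional base compare representatives almost everywhere, so this
  equivalence is the bridge by which they are read as statements over \<open>M\<close> restricted to
  \<open>D\<close>.\<close>

lemma AE_cond_base: "(AE \<omega> in cond_base M D. R \<omega>) \<longleftrightarrow> (AE \<omega>\<in>D in M. R \<omega>)"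
proof -
  have "(AE \<omega> in cond_base M D. R \<omega>) \<longleftrightarrow> (AE \<omega> in uniform_measure M D. \<omega> \<in> D \<longrightarrow> R \<omega>)"
    unfolding cond_base_def by (rule AE_restrict_space_iff) simp
  also have "\<dots> \<longleftrightarrow> (AE \<omega>\<in>D in M. (\<omega> \<in> D \<longrightarrow> R \<omega>))"
    using pos by (intro AE_uniform_measure) (auto simp: emeasure_eq_measure)
  finally show ?thesis by simp
qed

lemma measurable_cond_base: "u \<in> borel_measurable M \<Longrightarrow> u \<in> borel_measurable (cond_base M D)"
  unfolding cond_base_def by (rule measurable_restrict_space1) simp

lemma measurable_extend:
  fixes u :: "'a \<Rightarrow> 'b::topological_space"
  assumes "u \<in> borel_measurable (cond_base M D)"
  shows "(\<lambda>\<omega>. if \<omega> \<in> D then u \<omega> else c) \<in> borel_measurable M"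
  using assms measurable_restrict_space_iff[of D "uniform_measure M D" c borel u]
  by (simp add: cond_base_def)

lemma
  fixes X :: "('a \<Rightarrow> 'b::topological_space) set"
  assumes "X \<in> L0 M"
  shows L0_restrict_in_L0: "L0_restrict M D X \<in> L0 (cond_base M D)"
    and L0_rep_restrict: "AE \<omega>\<in>D in M. L0_rep (L0_restrict M D X) \<omega> = L0_rep X \<omega>"
proof -
  have m: "L0_rep X \<in> borel_measurable (cond_base M D)"
    by (intro measurable_cond_base L0_rep_measurable assms)
  show "L0_restrict M D X \<in> L0 (cond_base M D)"
    unfolding L0_restrict_def by (rule L0_class_in_L0[OF m])
  show "AE \<omega>\<in>D in M. L0_rep (L0_restrict M D X) \<omega> = L0_rep X \<omega>"
    using L0_rep_class(2)[OF m] unfolding L0_restrict_def AE_cond_base .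
qed

lemma
  fixes Y :: "('a \<Rightarrow> 'b::{topological_space,zero}) set"
  assumes "Y \<in> L0 (cond_base M D)"
  shows L0_extend_in_L0: "L0_extend M D Y \<in> L0 M"
    and L0_rep_extend: "AE \<omega> in M. L0_rep (L0_extend M D Y) \<omega> = (if \<omega> \<in> D then L0_rep Y \<omega> else 0)"
proof -
  have m: "(\<lambda>\<omega>. if \<omega> \<in> D then L0_rep Y \<omega> else 0) \<in> borel_measurable M"
    by (intro measurable_extend L0_rep_measurable assms)
  show "L0_extend M D Y \<in> L0 M"
    "AE \<omega> in M. L0_rep (L0_extend M D Y) \<omega> = (if \<omega> \<in> D then L0_rep Y \<omega> else 0)"
    unfolding L0_extend_def by (rule L0_class_in_L0[OF m], rule L0_rep_class(2)[OF m])
qed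

end

end

section \<open>Locally \<open>L0\<close>-convex topologies\<close>

lemma L0_le_iff: "X \<sqsubseteq>\<^bsub>L0_order M\<^esub> Y \<longleftrightarrow> (AE \<omega> in M. L0_rep X \<omega> \<le> L0_rep Y \<omega>)"
  by (simp add: L0_order_def)

lemma fam_seminorm_le_iff:
  fixes N :: "'e \<Rightarrow> ('a \<Rightarrow> real) set"
  assumes "finite Q" "Q \<noteq> {}" "\<And>N. N \<in> Q \<Longrightarrow> N x \<in> L0 M"
  shows "fam_seminorm M Q x \<sqsubseteq>\<^bsub>L0_order M\<^esub> \<epsilon> \<longleftrightarrow> (\<forall>N\<in>Q. AE \<omega> in M. L0_rep (N x) \<omega> \<le> L0_rep \<epsilon> \<omega>)"
proof -
  have eq: "{N x | N. N \<in> Q} = (\<lambda>N. N x) ` Q" by auto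
  have "(\<lambda>N. N x) ` Q \<subseteq> L0 M" using assms(3) by auto
  then show ?thesis
    unfolding fam_seminorm_def L0_le_iff eq
    using L0_finite_sup_le_iff[of "(\<lambda>N. N x) ` Q" M "L0_rep \<epsilon>"] assms(1,2) by simp
qed

text \<open>\<open>Tc\<close> is built by \<open>topology\<close> from a predicate, so its open sets
  are known only once that predicate is shown to be a topology. The sole assumption is that the
  seminorms take values in \<open>L0 M\<close>; the same lemma thus serves for \<open>E\<close>, for
  \<open>L0_module M\<close> and for the restricted modules. Radii become functions that are
  positive everywhere.\<close>

lemma openin_Tc:
  fixes P :: "('e \<Rightarrow> ('a \<Rightarrow> real) set) set"
  assumes L0: "\<And>N x y. N \<in> P \<Longrightarrow> x \<in> carrier E \<Longrightarrow> y \<in> carrier E \<Longrightarrow> N (y \<ominus>\<^bsub>E\<^esub> x) \<in> L0 M"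
  shows "openin (Tc M E P) U \<longleftrightarrow> U \<subseteq> carrier E \<and>
    (\<forall>x\<in>U. \<exists>Q \<epsilon>. finite Q \<and> Q \<noteq> {} \<and> Q \<subseteq> P \<and> \<epsilon> \<in> borel_measurable M \<and> (\<forall>\<omega>. 0 < \<epsilon> \<omega>) \<and>
      (\<forall>y\<in>carrier E. (\<forall>N\<in>Q. AE \<omega> in M. L0_rep (N (y \<ominus>\<^bsub>E\<^esub> x)) \<omega> \<le> \<epsilon> \<omega>) \<longrightarrow> y \<in> U))"
    (is "_ \<longleftrightarrow> ?open U")
proof -
  let ?ball = "\<lambda>x U Q \<epsilon>. finite Q \<and> Q \<noteq> {} \<and> Q \<subseteq> P \<and> \<epsilon> \<in> borel_measurable M \<and> (\<forall>\<omega>. 0 < \<epsilon> \<omega>) \<and>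
      (\<forall>y\<in>carrier E. (\<forall>N\<in>Q. AE \<omega> in M. L0_rep (N (y \<ominus>\<^bsub>E\<^esub> x)) \<omega> \<le> \<epsilon> \<omega>) \<longrightarrow> y \<in> U)"
  have eq: "(\<exists>Q \<epsilon>. finite Q \<and> Q \<noteq> {} \<and> Q \<subseteq> P \<and> \<epsilon> \<in> L0_pos M \<and>
        {y \<in> carrier E. fam_seminorm M Q (y \<ominus>\<^bsub>E\<^esub> x) \<sqsubseteq>\<^bsub>L0_order M\<^esub> \<epsilon>} \<subseteq> U) \<longleftrightarrow>
      (\<exists>Q \<epsilon>. ?ball x U Q \<epsilon>)" if x: "x \<in> carrier E" for x U
  proof
    assume "\<exists>Q \<epsilon>. finite Q \<and> Q \<noteq> {} \<and> Q \<subseteq> P \<and> \<epsilon> \<in> L0_pos M \<and>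
        {y \<in> carrier E. fam_seminorm M Q (y \<ominus>\<^bsub>E\<^esub> x) \<sqsubseteq>\<^bsub>L0_order M\<^esub> \<epsilon>} \<subseteq> U"
    then obtain Q \<epsilon> where Q: "finite Q" "Q \<noteq> {}" "Q \<subseteq> P" and e: "\<epsilon> \<in> L0 M" "AE \<omega> in M. 0 < L0_rep \<epsilon> \<omega>"
      and sub: "\<And>y. y \<in> carrier E \<Longrightarrow> fam_seminorm M Q (y \<ominus>\<^bsub>E\<^esub> x) \<sqsubseteq>\<^bsub>L0_order M\<^esub> \<epsilon> \<Longrightarrow> y \<in> U"
      by (auto simp: L0_pos_def)
    have [measurable]: "L0_rep \<epsilon> \<in> borel_measurable M" by (rule L0_rep_measurable[OF e(1)])
    \<comment> \<open>The given radius is positive only a.s.; the value 1 repairs it on a null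
      set.\<close>
    let ?e = "\<lambda>\<omega>. if 0 < L0_rep \<epsilon> \<omega> then L0_rep \<epsilon> \<omega> else 1"
    have "?ball x U Q ?e"
    proof (intro conjI ballI impI Q)
      show "?e \<in> borel_measurable M" by measurable
      fix y assume y: "y \<in> carrier E" and le: "\<forall>N\<in>Q. AE \<omega> in M. L0_rep (N (y \<ominus>\<^bsub>E\<^esub> x)) \<omega> \<le> ?e \<omega>"
      have "AE \<omega> in M. L0_rep (N (y \<ominus>\<^bsub>E\<^esub> x)) \<omega> \<le> L0_rep \<epsilon> \<omega>" if "N \<in> Q" for N
        using le[rule_format, OF that] e(2) by eventually_elim simp
      with fam_seminorm_le_iff[of Q "y \<ominus>\<^bsub>E\<^esub> x" M \<epsilon>] Q L0 x y sub show "y \<in> U" by blast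
    qed auto
    then show "\<exists>Q \<epsilon>. ?ball x U Q \<epsilon>" by blast
  next
    assume "\<exists>Q \<epsilon>. ?ball x U Q \<epsilon>"
    then obtain Q \<epsilon> where Q: "?ball x U Q \<epsilon>" by blast
    then have m: "\<epsilon> \<in> borel_measurable M" by simp
    have p: "L0_class M \<epsilon> \<in> L0_pos M"
      using L0_rep_class(2)[OF m] Q L0_class_in_L0[OF m] by (auto simp: L0_pos_def elim!: eventually_mono)
    have "y \<in> U" if y: "y \<in> carrier E" and f: "fam_seminorm M Q (y \<ominus>\<^bsub>E\<^esub> x) \<sqsubseteq>\<^bsub>L0_order M\<^esub> L0_class M \<epsilon>" for y
    proof -
      have "N (y \<ominus>\<^bsub>E\<^esub> x) \<in> L0 M" if "N \<in> Q" for N using L0 x y Q that by blast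
      then have *: "\<forall>N\<in>Q. AE \<omega> in M. L0_rep (N (y \<ominus>\<^bsub>E\<^esub> x)) \<omega> \<le> L0_rep (L0_class M \<epsilon>) \<omega>"
        using fam_seminorm_le_iff[of Q "y \<ominus>\<^bsub>E\<^esub> x" M "L0_class M \<epsilon>"] Q f by blast
      have "AE \<omega> in M. L0_rep (N (y \<ominus>\<^bsub>E\<^esub> x)) \<omega> \<le> \<epsilon> \<omega>" if "N \<in> Q" for N
        using *[rule_format, OF that] L0_rep_class(2)[OF m] by eventually_elim simp
      with Q y show ?thesis by blast
    qed
    with p Q show "\<exists>Q \<epsilon>. finite Q \<and> Q \<noteq> {} \<and> Q \<subseteq> P \<and> \<epsilon> \<in> L0_pos M \<and>
        {y \<in> carrier E. fam_seminorm M Q (y \<ominus>\<^bsub>E\<^esub> x) \<sqsubseteq>\<^bsub>L0_order M\<^esub> \<epsilon>} \<subseteq> U" by blast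
  qed
  have open_eq: "(\<lambda>U. U \<subseteq> carrier E \<and> (\<forall>x\<in>U. \<exists>Q \<epsilon>. finite Q \<and> Q \<noteq> {} \<and> Q \<subseteq> P \<and> \<epsilon> \<in> L0_pos M \<and>
        {y \<in> carrier E. fam_seminorm M Q (y \<ominus>\<^bsub>E\<^esub> x) \<sqsubseteq>\<^bsub>L0_order M\<^esub> \<epsilon>} \<subseteq> U)) = ?open" (is "?o = _")
    by (intro ext conj_cong refl ball_cong eq) (erule subsetD)
  have "istopology ?open" unfolding istopology_def
  proof (intro conjI allI impI)
    fix S T assume S: "?open S" and T: "?open T"
    then show "S \<inter> T \<subseteq> carrier E" by auto
    show "\<forall>x\<in>S \<inter> T. \<exists>Q \<epsilon>. ?ball x (S \<inter> T) Q \<epsilon>"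
    proof
      fix x assume "x \<in> S \<inter> T"
      then have xS: "x \<in> S" and xT: "x \<in> T" by auto
      from bspec[OF conjunct2[OF S] xS] obtain Q \<epsilon> where 1: "?ball x S Q \<epsilon>" by (elim exE)
      from bspec[OF conjunct2[OF T] xT] obtain Q' \<epsilon>' where 2: "?ball x T Q' \<epsilon>'" by (elim exE)
      have [measurable]: "\<epsilon> \<in> borel_measurable M" "\<epsilon>' \<in> borel_measurable M" using 1 2 by auto
      let ?e = "\<lambda>\<omega>. min (\<epsilon> \<omega>) (\<epsilon>' \<omega>)"
      have "y \<in> S \<and> y \<in> T"
        if y: "y \<in> carrier E" and le: "\<forall>N\<in>Q \<union> Q'. AE \<omega> in M. L0_rep (N (y \<ominus>\<^bsub>E\<^esub> x)) \<omega> \<le> ?e \<omega>" for y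
      proof -
        have "\<forall>N\<in>Q. AE \<omega> in M. L0_rep (N (y \<ominus>\<^bsub>E\<^esub> x)) \<omega> \<le> \<epsilon> \<omega>" using le by auto
        moreover have "\<forall>N\<in>Q'. AE \<omega> in M. L0_rep (N (y \<ominus>\<^bsub>E\<^esub> x)) \<omega> \<le> \<epsilon>' \<omega>" using le by auto
        ultimately show ?thesis using 1 2 y by blast
      qed
      moreover have "?e \<in> borel_measurable M" by measurable
      moreover have "finite (Q \<union> Q')" "Q \<union> Q' \<noteq> {}" "Q \<union> Q' \<subseteq> P" "\<forall>\<omega>. 0 < ?e \<omega>" using 1 2 by auto
      ultimately have "?ball x (S \<inter> T) (Q \<union> Q') ?e" by blast
      then show "\<exists>Q \<epsilon>. ?ball x (S \<inter> T) Q \<epsilon>" by blast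
    qed
  next
    fix \<K> assume K: "\<forall>S\<in>\<K>. ?open S"
    then show "\<Union>\<K> \<subseteq> carrier E" by blast
    show "\<forall>x\<in>\<Union>\<K>. \<exists>Q \<epsilon>. ?ball x (\<Union>\<K>) Q \<epsilon>"
    proof
      fix x assume "x \<in> \<Union>\<K>"
      then obtain S where S: "S \<in> \<K>" "x \<in> S" by auto
      from bspec[OF conjunct2[OF bspec[OF K S(1)]] S(2)] obtain Q \<epsilon> where "?ball x S Q \<epsilon>" by (elim exE)
      with S have "?ball x (\<Union>\<K>) Q \<epsilon>" by blast
      then show "\<exists>Q \<epsilon>. ?ball x (\<Union>\<K>) Q \<epsilon>" by blast
    qed
  qed
  then show ?thesis unfolding Tc_def open_eq by (simp only: topology_inverse')
qed

text \<open>\<open>Tc\<close> measures distances with the subtraction of the record, which is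
  defined through additive inverses; the group axioms are what identifies it with
  \<open>L0_diff\<close>.\<close>

lemma abelian_group_L0_module: "abelian_group (L0_module M)"
proof (rule abelian_groupI)
  fix X Y Z assume X: "X \<in> carrier (L0_module M)" and Y: "Y \<in> carrier (L0_module M)" and Z: "Z \<in> carrier (L0_module M)"
  then have L: "X \<in> L0 M" "Y \<in> L0 M" "Z \<in> L0 M" by (auto simp: L0_module_def)
  note [simp] = L0_add_in_L0 L0_const_in_L0
  show "X \<oplus>\<^bsub>L0_module M\<^esub> Y \<in> carrier (L0_module M)" using L by (simp add: L0_module_def)
  have "L0_add M (L0_add M X Y) Z = L0_add M X (L0_add M Y Z)"
  proof (subst L0_eq_iff)
    show "AE \<omega> in M. L0_rep (L0_add M (L0_add M X Y) Z) \<omega> = L0_rep (L0_add M X (L0_add M Y Z)) \<omega>"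
      using L0_rep_add[OF L(1,2)] L0_rep_add[OF L(2,3)] L0_rep_add[OF L0_add_in_L0[OF L(1,2)] L(3)]
        L0_rep_add[OF L(1) L0_add_in_L0[OF L(2,3)]] by eventually_elim simp
  qed (use L in simp_all)
  then show "X \<oplus>\<^bsub>L0_module M\<^esub> Y \<oplus>\<^bsub>L0_module M\<^esub> Z = X \<oplus>\<^bsub>L0_module M\<^esub> (Y \<oplus>\<^bsub>L0_module M\<^esub> Z)"
    by (simp add: L0_module_def)
  show "X \<oplus>\<^bsub>L0_module M\<^esub> Y = Y \<oplus>\<^bsub>L0_module M\<^esub> X" by (simp add: L0_module_def L0_add_def add.commute)
next
  show "\<zero>\<^bsub>L0_module M\<^esub> \<in> carrier (L0_module M)" by (simp add: L0_module_def L0_const_in_L0)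
next
  fix X assume "X \<in> carrier (L0_module M)"
  then have L: "X \<in> L0 M" by (simp add: L0_module_def)
  have "L0_add M (L0_const M 0) X = X"
  proof (subst L0_eq_iff)
    show "AE \<omega> in M. L0_rep (L0_add M (L0_const M 0) X) \<omega> = L0_rep X \<omega>"
      using L0_rep_add[OF L0_const_in_L0[of M 0] L] L0_rep_const[where c = "0::real"] by eventually_elim simp
  qed (use L in \<open>simp_all add: L0_add_in_L0 L0_const_in_L0\<close>)
  then show "\<zero>\<^bsub>L0_module M\<^esub> \<oplus>\<^bsub>L0_module M\<^esub> X = X" by (simp add: L0_module_def)
  have m: "L0_diff M (L0_const M 0) X \<in> L0 M" by (intro L0_diff_in_L0 L0_const_in_L0 L)
  have "L0_add M (L0_diff M (L0_const M 0) X) X = L0_const M 0"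
  proof (subst L0_eq_iff)
    show "AE \<omega> in M. L0_rep (L0_add M (L0_diff M (L0_const M 0) X) X) \<omega> = L0_rep (L0_const M (0::real)) \<omega>"
      using L0_rep_add[OF m L] L0_rep_diff[OF L0_const_in_L0[of M 0] L] L0_rep_const[where c = "0::real"]
      by eventually_elim simp
  qed (use L m in \<open>simp_all add: L0_add_in_L0 L0_const_in_L0\<close>)
  with m show "\<exists>Y\<in>carrier (L0_module M). Y \<oplus>\<^bsub>L0_module M\<^esub> X = \<zero>\<^bsub>L0_module M\<^esub>"
    by (auto simp: L0_module_def)
qed

lemma L0_module_minus:
  assumes "X \<in> L0 M" "Y \<in> L0 M"
  shows "Y \<ominus>\<^bsub>L0_module M\<^esub> X = L0_diff M Y X"
proof -
  interpret abelian_group "L0_module M" by (rule abelian_group_L0_module)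
  have c: "carrier (L0_module M) = L0 M" "add (L0_module M) = L0_add M" by (simp_all add: L0_module_def)
  have d: "L0_diff M Y X \<in> L0 M" by (intro L0_diff_in_L0 assms)
  have "L0_add M (L0_diff M Y X) X = Y"
  proof (subst L0_eq_iff)
    show "AE \<omega> in M. L0_rep (L0_add M (L0_diff M Y X) X) \<omega> = L0_rep Y \<omega>"
      using L0_rep_add[OF d assms(1)] L0_rep_diff[OF assms(2,1)] by eventually_elim simp
  qed (use assms d in \<open>simp_all add: L0_add_in_L0\<close>)
  then have "Y \<ominus>\<^bsub>L0_module M\<^esub> X = (L0_diff M Y X \<oplus>\<^bsub>L0_module M\<^esub> X) \<oplus>\<^bsub>L0_module M\<^esub> (\<ominus>\<^bsub>L0_module M\<^esub> X)"
    by (simp add: a_minus_def c)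
  also have "\<dots> = L0_diff M Y X"
    using assms d unfolding c(1)[symmetric] by (simp add: a_assoc r_neg)
  finally show ?thesis .
qed

lemma openin_Tc_L0:
  "openin (Tc_L0 M) V \<longleftrightarrow> V \<subseteq> L0 M \<and>
    (\<forall>X\<in>V. \<exists>\<epsilon>. \<epsilon> \<in> borel_measurable M \<and> (\<forall>\<omega>. 0 < \<epsilon> \<omega>) \<and>
      (\<forall>Y\<in>L0 M. (AE \<omega> in M. \<bar>L0_rep Y \<omega> - L0_rep X \<omega>\<bar> \<le> \<epsilon> \<omega>) \<longrightarrow> Y \<in> V))"
proof -
  have c: "carrier (L0_module M) = L0 M" by (simp add: L0_module_def)
  have 0: "openin (Tc_L0 M) V \<longleftrightarrow> V \<subseteq> L0 M \<and>
    (\<forall>x\<in>V. \<exists>Q \<epsilon>. finite Q \<and> Q \<noteq> {} \<and> Q \<subseteq> {L0_abs M} \<and> \<epsilon> \<in> borel_measurable M \<and> (\<forall>\<omega>. 0 < \<epsilon> \<omega>) \<and>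
      (\<forall>y\<in>L0 M. (\<forall>N\<in>Q. AE \<omega> in M. L0_rep (N (y \<ominus>\<^bsub>L0_module M\<^esub> x)) \<omega> \<le> \<epsilon> \<omega>) \<longrightarrow> y \<in> V))"
    unfolding Tc_L0_def by (subst openin_Tc) (auto simp: c L0_module_minus intro!: L0_abs_in_L0 L0_diff_in_L0)
  have Q: "finite Q \<and> Q \<noteq> {} \<and> Q \<subseteq> {L0_abs M} \<longleftrightarrow> Q = {L0_abs M}" for Q by auto
  have r: "(AE \<omega> in M. L0_rep (L0_abs M (y \<ominus>\<^bsub>L0_module M\<^esub> x)) \<omega> \<le> \<epsilon> \<omega>) \<longleftrightarrow>
      (AE \<omega> in M. \<bar>L0_rep y \<omega> - L0_rep x \<omega>\<bar> \<le> \<epsilon> \<omega>)" if "x \<in> L0 M" "y \<in> L0 M" for x y \<epsilon>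
  proof -
    have e: "AE \<omega> in M. L0_rep (L0_abs M (y \<ominus>\<^bsub>L0_module M\<^esub> x)) \<omega> = \<bar>L0_rep y \<omega> - L0_rep x \<omega>\<bar>"
      using L0_rep_abs[OF L0_diff_in_L0[OF that(2,1)]] L0_rep_diff[OF that(2,1)]
      unfolding L0_module_minus[OF that] by eventually_elim simp
    show ?thesis
    proof
      assume "AE \<omega> in M. L0_rep (L0_abs M (y \<ominus>\<^bsub>L0_module M\<^esub> x)) \<omega> \<le> \<epsilon> \<omega>"
      with e show "AE \<omega> in M. \<bar>L0_rep y \<omega> - L0_rep x \<omega>\<bar> \<le> \<epsilon> \<omega>" by eventually_elim simp
    next
      assume "AE \<omega> in M. \<bar>L0_rep y \<omega> - L0_rep x \<omega>\<bar> \<le> \<epsilon> \<omega>"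
      with e show "AE \<omega> in M. L0_rep (L0_abs M (y \<ominus>\<^bsub>L0_module M\<^esub> x)) \<omega> \<le> \<epsilon> \<omega>" by eventually_elim simp
    qed
  qed
  show ?thesis unfolding 0
  proof (intro conj_cong refl ball_cong)
    fix x assume "V \<subseteq> L0 M" "x \<in> V"
    then have x: "x \<in> L0 M" by auto
    show "(\<exists>Q \<epsilon>. finite Q \<and> Q \<noteq> {} \<and> Q \<subseteq> {L0_abs M} \<and> \<epsilon> \<in> borel_measurable M \<and> (\<forall>\<omega>. 0 < \<epsilon> \<omega>) \<and>
      (\<forall>y\<in>L0 M. (\<forall>N\<in>Q. AE \<omega> in M. L0_rep (N (y \<ominus>\<^bsub>L0_module M\<^esub> x)) \<omega> \<le> \<epsilon> \<omega>) \<longrightarrow> y \<in> V)) \<longleftrightarrow>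
      (\<exists>\<epsilon>. \<epsilon> \<in> borel_measurable M \<and> (\<forall>\<omega>. 0 < \<epsilon> \<omega>) \<and>
        (\<forall>Y\<in>L0 M. (AE \<omega> in M. \<bar>L0_rep Y \<omega> - L0_rep x \<omega>\<bar> \<le> \<epsilon> \<omega>) \<longrightarrow> Y \<in> V))" (is "?L \<longleftrightarrow> ?R")
    proof
      assume ?L
      then obtain Q \<epsilon> where Q': "finite Q \<and> Q \<noteq> {} \<and> Q \<subseteq> {L0_abs M}" and e: "\<epsilon> \<in> borel_measurable M \<and> (\<forall>\<omega>. 0 < \<epsilon> \<omega>)"
        and "\<forall>y\<in>L0 M. (\<forall>N\<in>Q. AE \<omega> in M. L0_rep (N (y \<ominus>\<^bsub>L0_module M\<^esub> x)) \<omega> \<le> \<epsilon> \<omega>) \<longrightarrow> y \<in> V"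
        by (elim exE conjE) simp
      then show ?R using r[OF x] unfolding Q by (intro exI[of _ \<epsilon>]) simp
    next
      assume ?R
      then obtain \<epsilon> where "\<epsilon> \<in> borel_measurable M \<and> (\<forall>\<omega>. 0 < \<epsilon> \<omega>) \<and>
        (\<forall>Y\<in>L0 M. (AE \<omega> in M. \<bar>L0_rep Y \<omega> - L0_rep x \<omega>\<bar> \<le> \<epsilon> \<omega>) \<longrightarrow> Y \<in> V)" by blast
      then show ?L using r[OF x] by (intro exI[of _ "{L0_abs M}"] exI[of _ \<epsilon>]) simp
    qed
  qed
qed

section \<open>Random locally convex modules\<close>

lemma topspace_Tc_L0: "topspace (Tc_L0 M) = L0 M"
proof (rule antisym)
  show "topspace (Tc_L0 M) \<subseteq> L0 M"
    using openin_topspace[of "Tc_L0 M"] unfolding openin_Tc_L0 by blast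
  have "openin (Tc_L0 M) (L0 M)" unfolding openin_Tc_L0 by (auto intro!: exI[of _ "\<lambda>_. 1"])
  then show "L0 M \<subseteq> topspace (Tc_L0 M)" by (rule openin_subset)
qed

sublocale rlc_module \<subseteq> L0_mod M E ..

context rlc_module
begin

lemma
  assumes "N \<in> P" "x \<in> carrier E"
  shows seminorm_in_L0: "N x \<in> L0 M"
    and seminorm_nonneg: "AE \<omega> in M. 0 \<le> L0_rep (N x) \<omega>"
proof -
  have "N x \<in> L0_nonneg M" using seminorm[OF assms(1)] assms(2) by (auto simp: L0_seminorm_def)
  then show "N x \<in> L0 M" by (simp add: L0_nonneg_def)
  have "AE \<omega> in M. L0_rep (L0_const M (0::real)) \<omega> \<le> L0_rep (N x) \<omega>"
    using \<open>N x \<in> L0_nonneg M\<close> by (simp add: L0_nonneg_def L0_le_iff)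
  with L0_rep_const[where c = "0::real"] show "AE \<omega> in M. 0 \<le> L0_rep (N x) \<omega>"
    by eventually_elim simp
qed

lemma seminorm_sc:
  assumes N: "N \<in> P" and x: "x \<in> carrier E" and u: "u \<in> borel_measurable M"
  shows "AE \<omega> in M. L0_rep (N (sc u x)) \<omega> = \<bar>u \<omega>\<bar> * L0_rep (N x) \<omega>"
proof -
  have c: "L0_class M u \<in> L0 M" by (rule L0_class_in_L0[OF u])
  have "N (sc u x) = L0_mult M (L0_abs M (L0_class M u)) (N x)"
    using seminorm[OF N] x c unfolding sc_def by (auto simp: L0_seminorm_def)
  with L0_rep_mult[OF L0_abs_in_L0[OF c] seminorm_in_L0[OF N x]] L0_rep_abs[OF c] L0_rep_class(2)[OF u]
  show ?thesis by (auto elim!: eventually_elim2)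
qed

lemma seminorm_add:
  assumes N: "N \<in> P" and x: "x \<in> carrier E" and y: "y \<in> carrier E"
  shows "AE \<omega> in M. L0_rep (N (x \<oplus>\<^bsub>E\<^esub> y)) \<omega> \<le> L0_rep (N x) \<omega> + L0_rep (N y) \<omega>"
proof -
  have "AE \<omega> in M. L0_rep (N (x \<oplus>\<^bsub>E\<^esub> y)) \<omega> \<le> L0_rep (L0_add M (N x) (N y)) \<omega>"
    using seminorm[OF N] x y by (auto simp: L0_seminorm_def L0_le_iff)
  with L0_rep_add[OF seminorm_in_L0[OF N x] seminorm_in_L0[OF N y]] show ?thesis
    by eventually_elim simp
qed

text \<open>The empty supremum is the class of \<open>-\<infinity>\<close> and not of 0, which
  contradicts the separation axiom at the null vector.\<close>

lemma P_nonempty: "P \<noteq> {}"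
proof
  assume "P = {}"
  then have s: "\<Squnion>\<^bsub>L0_order M\<^esub> {} = L0_const M (0 :: ereal)"
    using separating[of "\<zero>\<^bsub>E\<^esub>"] by simp
  have "AE \<omega> in M. L0_rep (\<Squnion>\<^bsub>L0_order M\<^esub> {}) \<omega> \<le> (-\<infinity> :: ereal)"
    by (rule L0_sup_least) auto
  with L0_rep_const[where c = "0::ereal"] have "AE \<omega> in M. False"
    unfolding s by eventually_elim simp
  then show False by simp
qed

text \<open>The sum of the nonnegative seminorms in \<open>Q\<close> dominates each of them and is
  at most \<open>card Q\<close> times their supremum, so it describes the same neighbourhoods;
  homogeneity and the triangle inequality pass through it term by term.\<close>

definition sn :: "('e \<Rightarrow> ('a \<Rightarrow> real) set) set \<Rightarrow> 'e \<Rightarrow> 'a \<Rightarrow> real" where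
  "sn Q x \<omega> = (\<Sum>N\<in>Q. L0_rep (N x) \<omega>)"

lemma sn_all:
  assumes "finite Q" "\<And>N. N \<in> Q \<Longrightarrow> AE \<omega> in M. R N \<omega>"
  shows "AE \<omega> in M. \<forall>N\<in>Q. R N \<omega>"
  using assms by (subst AE_ball_countable) (auto intro: countable_finite)

section \<open>Calculus of finite sums of seminorms\<close>

context
  fixes Q assumes Q: "finite Q" "Q \<subseteq> P"
begin

lemma sn_measurable: "x \<in> carrier E \<Longrightarrow> sn Q x \<in> borel_measurable M"
  unfolding sn_def[abs_def] using Q by (intro borel_measurable_sum L0_rep_measurable seminorm_in_L0) auto

lemma sn_nonneg:
  assumes "x \<in> carrier E"
  shows "AE \<omega> in M. 0 \<le> sn Q x \<omega>"
proof -
  have "AE \<omega> in M. \<forall>N\<in>Q. 0 \<le> L0_rep (N x) \<omega>"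
    by (rule sn_all[OF Q(1)]) (use Q(2) assms in \<open>auto intro!: seminorm_nonneg\<close>)
  then show ?thesis by eventually_elim (auto simp: sn_def intro!: sum_nonneg)
qed

lemma seminorm_le_sn:
  assumes "x \<in> carrier E" "N \<in> Q"
  shows "AE \<omega> in M. L0_rep (N x) \<omega> \<le> sn Q x \<omega>"
proof -
  have "AE \<omega> in M. \<forall>N\<in>Q. 0 \<le> L0_rep (N x) \<omega>"
    by (rule sn_all[OF Q(1)]) (use Q(2) assms in \<open>auto intro!: seminorm_nonneg\<close>)
  then show ?thesis unfolding sn_def
  proof eventually_elim
    case (elim \<omega>)
    then show ?case using Q(1) assms(2) by (intro member_le_sum[of N Q "\<lambda>N. L0_rep (N x) \<omega>"]) auto
  qed
qed

lemma sn_sc: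
  assumes "x \<in> carrier E" "u \<in> borel_measurable M"
  shows "AE \<omega> in M. sn Q (sc u x) \<omega> = \<bar>u \<omega>\<bar> * sn Q x \<omega>"
proof -
  have "AE \<omega> in M. \<forall>N\<in>Q. L0_rep (N (sc u x)) \<omega> = \<bar>u \<omega>\<bar> * L0_rep (N x) \<omega>"
    by (rule sn_all[OF Q(1)]) (use Q(2) assms in \<open>auto intro!: seminorm_sc\<close>)
  then show ?thesis by eventually_elim (simp add: sn_def sum_distrib_left)
qed

lemma sn_add:
  assumes "x \<in> carrier E" "y \<in> carrier E"
  shows "AE \<omega> in M. sn Q (x \<oplus>\<^bsub>E\<^esub> y) \<omega> \<le> sn Q x \<omega> + sn Q y \<omega>"
proof -
  have "AE \<omega> in M. \<forall>N\<in>Q. L0_rep (N (x \<oplus>\<^bsub>E\<^esub> y)) \<omega> \<le> L0_rep (N x) \<omega> + L0_rep (N y) \<omega>"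
    by (rule sn_all[OF Q(1)]) (use Q(2) assms in \<open>auto intro!: seminorm_add\<close>)
  then show ?thesis by eventually_elim (auto simp: sn_def sum.distrib[symmetric] intro!: sum_mono)
qed

lemma sn_a_inv:
  assumes "x \<in> carrier E"
  shows "AE \<omega> in M. sn Q (\<ominus>\<^bsub>E\<^esub> x) \<omega> = sn Q x \<omega>"
proof -
  have "\<ominus>\<^bsub>E\<^esub> x = sc (\<lambda>_. - 1) x" using sc_uminus[of "\<lambda>_. 1" x] assms by (simp add: sc_one)
  with sn_sc[OF assms, of "\<lambda>_. - 1"] show ?thesis by simp
qed

end

lemma sn_minus_triangle:
  assumes Q: "finite Q" "Q \<subseteq> P" and "x \<in> carrier E" "y \<in> carrier E" "z \<in> carrier E"
  shows "AE \<omega> in M. sn Q (x \<ominus>\<^bsub>E\<^esub> z) \<omega> \<le> sn Q (x \<ominus>\<^bsub>E\<^esub> y) \<omega> + sn Q (y \<ominus>\<^bsub>E\<^esub> z) \<omega>"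
proof -
  have "x \<ominus>\<^bsub>E\<^esub> z = (x \<ominus>\<^bsub>E\<^esub> y) \<oplus>\<^bsub>E\<^esub> (y \<ominus>\<^bsub>E\<^esub> z)"
    using assms by (simp add: a_minus_def M.a_assoc M.r_neg1)
  with sn_add[OF Q, of "x \<ominus>\<^bsub>E\<^esub> y" "y \<ominus>\<^bsub>E\<^esub> z"] assms show ?thesis by simp
qed

lemma openin_Tc_E:
  "openin (Tc M E P) U \<longleftrightarrow> U \<subseteq> carrier E \<and>
    (\<forall>x\<in>U. \<exists>Q \<epsilon>. finite Q \<and> Q \<noteq> {} \<and> Q \<subseteq> P \<and> \<epsilon> \<in> borel_measurable M \<and> (\<forall>\<omega>. 0 < \<epsilon> \<omega>) \<and>
      (\<forall>y\<in>carrier E. (\<forall>N\<in>Q. AE \<omega> in M. L0_rep (N (y \<ominus>\<^bsub>E\<^esub> x)) \<omega> \<le> \<epsilon> \<omega>) \<longrightarrow> y \<in> U))"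
  by (rule openin_Tc) (auto intro!: seminorm_in_L0)

lemma topspace_Tc_E: "topspace (Tc M E P) = carrier E"
proof (rule antisym)
  show "topspace (Tc M E P) \<subseteq> carrier E"
    using openin_topspace[of "Tc M E P"] unfolding openin_Tc_E by blast
  have "openin (Tc M E P) (carrier E)" unfolding openin_Tc_E
  proof (intro conjI ballI)
    obtain N where "N \<in> P" using P_nonempty by auto
    then show "\<exists>Q \<epsilon>. finite Q \<and> Q \<noteq> {} \<and> Q \<subseteq> P \<and> \<epsilon> \<in> borel_measurable M \<and> (\<forall>\<omega>. 0 < \<epsilon> \<omega>) \<and>
      (\<forall>y\<in>carrier E. (\<forall>N\<in>Q. AE \<omega> in M. L0_rep (N (y \<ominus>\<^bsub>E\<^esub> x)) \<omega> \<le> \<epsilon> \<omega>) \<longrightarrow> y \<in> carrier E)" for x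
      by (intro exI[of _ "{N}"] exI[of _ "\<lambda>_. 1"]) auto
  qed simp
  then show "carrier E \<subseteq> topspace (Tc M E P)" by (rule openin_subset)
qed

subsection \<open>The dual\<close>

lemma
  assumes "g \<in> Tc_dual M E P"
  shows dual_in_L0: "x \<in> carrier E \<Longrightarrow> g x \<in> L0 M"
    and dual_add: "x \<in> carrier E \<Longrightarrow> y \<in> carrier E \<Longrightarrow>
      AE \<omega> in M. L0_rep (g (x \<oplus>\<^bsub>E\<^esub> y)) \<omega> = L0_rep (g x) \<omega> + L0_rep (g y) \<omega>"
    and dual_sc: "x \<in> carrier E \<Longrightarrow> u \<in> borel_measurable M \<Longrightarrow>
      AE \<omega> in M. L0_rep (g (sc u x)) \<omega> = u \<omega> * L0_rep (g x) \<omega>"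
proof -
  show L: "g x \<in> L0 M" if "x \<in> carrier E" for x using assms that by (auto simp: Tc_dual_def)
  show "AE \<omega> in M. L0_rep (g (x \<oplus>\<^bsub>E\<^esub> y)) \<omega> = L0_rep (g x) \<omega> + L0_rep (g y) \<omega>"
    if "x \<in> carrier E" "y \<in> carrier E"
    using assms that L0_rep_add[OF L L, of x y] by (auto simp: Tc_dual_def)
  show "AE \<omega> in M. L0_rep (g (sc u x)) \<omega> = u \<omega> * L0_rep (g x) \<omega>"
    if x: "x \<in> carrier E" and u: "u \<in> borel_measurable M"
  proof -
    have c: "L0_class M u \<in> L0 M" by (rule L0_class_in_L0[OF u])
    have "g (sc u x) = L0_mult M (L0_class M u) (g x)"
      using assms x c unfolding sc_def by (auto simp: Tc_dual_def)
    with L0_rep_mult[OF c L[OF x]] L0_rep_class(2)[OF u] show ?thesis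
      by (auto elim!: eventually_elim2)
  qed
qed

text \<open>The set of classes strictly within \<open>e\<close> of \<open>g x\<close> is open, since
  half of the remaining gap is an admissible radius around each of its members. Its preimage under
  \<open>g\<close> contains a ball around \<open>x\<close>.\<close>

lemma dual_continuous:
  assumes g: "g \<in> Tc_dual M E P" and x: "x \<in> carrier E" and e: "e \<in> borel_measurable M" "\<And>\<omega>. 0 < e \<omega>"
  shows "\<exists>Q \<epsilon>. finite Q \<and> Q \<noteq> {} \<and> Q \<subseteq> P \<and> \<epsilon> \<in> borel_measurable M \<and> (\<forall>\<omega>. 0 < \<epsilon> \<omega>) \<and>
    (\<forall>y\<in>carrier E. (\<forall>N\<in>Q. AE \<omega> in M. L0_rep (N (y \<ominus>\<^bsub>E\<^esub> x)) \<omega> \<le> \<epsilon> \<omega>) \<longrightarrow>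
      (AE \<omega> in M. \<bar>L0_rep (g y) \<omega> - L0_rep (g x) \<omega>\<bar> < e \<omega>))"
proof -
  note [measurable] = e(1)
  define V where "V = {Y \<in> L0 M. AE \<omega> in M. \<bar>L0_rep Y \<omega> - L0_rep (g x) \<omega>\<bar> < e \<omega>}"
  have gx: "g x \<in> L0 M" by (rule dual_in_L0[OF g x])
  have [measurable]: "L0_rep (g x) \<in> borel_measurable M" by (rule L0_rep_measurable[OF gx])
  have V: "openin (Tc_L0 M) V" unfolding openin_Tc_L0
  proof (intro conjI ballI)
    show "V \<subseteq> L0 M" by (auto simp: V_def)
    fix X assume "X \<in> V"
    then have X: "X \<in> L0 M" and lt: "AE \<omega> in M. \<bar>L0_rep X \<omega> - L0_rep (g x) \<omega>\<bar> < e \<omega>" by (auto simp: V_def)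
    have [measurable]: "L0_rep X \<in> borel_measurable M" by (rule L0_rep_measurable[OF X])
    let ?d = "\<lambda>\<omega>. e \<omega> - \<bar>L0_rep X \<omega> - L0_rep (g x) \<omega>\<bar>"
    \<comment> \<open>The gap \<open>?d\<close> is positive only a.s.; the default 1 concerns a null
      set.\<close>
    let ?e = "\<lambda>\<omega>. if 0 < ?d \<omega> then ?d \<omega> / 2 else 1"
    show "\<exists>\<epsilon>. \<epsilon> \<in> borel_measurable M \<and> (\<forall>\<omega>. 0 < \<epsilon> \<omega>) \<and>
      (\<forall>Y\<in>L0 M. (AE \<omega> in M. \<bar>L0_rep Y \<omega> - L0_rep X \<omega>\<bar> \<le> \<epsilon> \<omega>) \<longrightarrow> Y \<in> V)"
    proof (intro exI[of _ ?e] conjI ballI impI)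
      show "?e \<in> borel_measurable M" by measurable
      fix Y assume Y: "Y \<in> L0 M" and le: "AE \<omega> in M. \<bar>L0_rep Y \<omega> - L0_rep X \<omega>\<bar> \<le> ?e \<omega>"
      from le lt have "AE \<omega> in M. \<bar>L0_rep Y \<omega> - L0_rep (g x) \<omega>\<bar> < e \<omega>"
        by eventually_elim (auto split: if_splits simp: abs_if)
      with Y show "Y \<in> V" by (simp add: V_def)
    qed auto
  qed
  have cont: "continuous_map (Tc M E P) (Tc_L0 M) g" using g by (simp add: Tc_dual_def)
  have op: "openin (Tc M E P) {y \<in> carrier E. g y \<in> V}"
    using openin_continuous_map_preimage[OF cont V] by (simp add: topspace_Tc_E)
  have "x \<in> {y \<in> carrier E. g y \<in> V}" using x gx e(2) by (simp add: V_def)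
  from bspec[OF conjunct2[OF op[unfolded openin_Tc_E]] this] obtain Q \<epsilon> where "finite Q \<and> Q \<noteq> {} \<and> Q \<subseteq> P \<and> \<epsilon> \<in> borel_measurable M \<and> (\<forall>\<omega>. 0 < \<epsilon> \<omega>) \<and>
      (\<forall>y\<in>carrier E. (\<forall>N\<in>Q. AE \<omega> in M. L0_rep (N (y \<ominus>\<^bsub>E\<^esub> x)) \<omega> \<le> \<epsilon> \<omega>) \<longrightarrow> y \<in> {y \<in> carrier E. g y \<in> V})"
    by (elim exE)
  then show ?thesis by (intro exI[of _ Q] exI[of _ \<epsilon>]) (auto simp: V_def)
qed

text \<open>Domination by a multiple of \<open>sn Q\<close> is Lipschitz continuity. The map is
  given on representatives, as the Hahn-Banach theorem delivers it.\<close>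

lemma dualI:
  fixes g :: "'e \<Rightarrow> 'a \<Rightarrow> real"
  assumes m: "\<And>x. x \<in> carrier E \<Longrightarrow> g x \<in> borel_measurable M"
    and add: "\<And>x y. x \<in> carrier E \<Longrightarrow> y \<in> carrier E \<Longrightarrow> AE \<omega> in M. g (x \<oplus>\<^bsub>E\<^esub> y) \<omega> = g x \<omega> + g y \<omega>"
    and sc: "\<And>x u. x \<in> carrier E \<Longrightarrow> u \<in> borel_measurable M \<Longrightarrow> AE \<omega> in M. g (sc u x) \<omega> = u \<omega> * g x \<omega>"
    and Q: "finite Q" "Q \<noteq> {}" "Q \<subseteq> P"
    and dom: "\<And>x. x \<in> carrier E \<Longrightarrow> AE \<omega> in M. \<bar>g x \<omega>\<bar> \<le> C * sn Q x \<omega>" and C: "0 < C"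
  shows "(\<lambda>x\<in>carrier E. L0_class M (g x)) \<in> Tc_dual M E P"
proof -
  let ?G = "\<lambda>x\<in>carrier E. L0_class M (g x)"
  have L: "L0_class M (g x) \<in> L0 M" if "x \<in> carrier E" for x by (rule L0_class_in_L0[OF m[OF that]])
  have rep: "AE \<omega> in M. L0_rep (L0_class M (g x)) \<omega> = g x \<omega>" if "x \<in> carrier E" for x
    by (rule L0_rep_class(2)[OF m[OF that]])
  have "openin (Tc M E P) {x \<in> topspace (Tc M E P). ?G x \<in> V}" if V: "openin (Tc_L0 M) V" for V
  proof -
    have "openin (Tc M E P) {x \<in> carrier E. ?G x \<in> V}" unfolding openin_Tc_E
    proof (intro conjI ballI)
      fix x assume "x \<in> {x \<in> carrier E. ?G x \<in> V}"
      then have x: "x \<in> carrier E" and xV: "L0_class M (g x) \<in> V" by auto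
      from bspec[OF conjunct2[OF V[unfolded openin_Tc_L0]] xV] obtain \<epsilon> where e: "\<epsilon> \<in> borel_measurable M" "\<And>\<omega>. 0 < \<epsilon> \<omega>" and
        ball: "\<And>Y. Y \<in> L0 M \<Longrightarrow> AE \<omega> in M. \<bar>L0_rep Y \<omega> - L0_rep (L0_class M (g x)) \<omega>\<bar> \<le> \<epsilon> \<omega> \<Longrightarrow> Y \<in> V"
        by (elim exE conjE) simp
      \<comment> \<open>With \<open>card Q\<close> seminorms each at most \<open>?e\<close>, the sum
        is at most \<open>\<epsilon> / C\<close>, and \<open>g\<close> moves by at most
        \<open>\<epsilon>\<close>.\<close>
      let ?e = "\<lambda>\<omega>. \<epsilon> \<omega> / (C * real (card Q))"
      have cQ: "0 < C * real (card Q)" using Q C by (simp add: card_gt_0_iff)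
      show "\<exists>Q \<epsilon>. finite Q \<and> Q \<noteq> {} \<and> Q \<subseteq> P \<and> \<epsilon> \<in> borel_measurable M \<and> (\<forall>\<omega>. 0 < \<epsilon> \<omega>) \<and>
        (\<forall>y\<in>carrier E. (\<forall>N\<in>Q. AE \<omega> in M. L0_rep (N (y \<ominus>\<^bsub>E\<^esub> x)) \<omega> \<le> \<epsilon> \<omega>) \<longrightarrow> y \<in> {x \<in> carrier E. ?G x \<in> V})"
      proof (intro exI[of _ Q] exI[of _ ?e] conjI ballI impI Q allI)
        show "?e \<in> borel_measurable M" using e(1) by measurable
        show "0 < ?e \<omega>" for \<omega> using e(2) cQ by simp
        fix y assume y: "y \<in> carrier E" and le: "\<forall>N\<in>Q. AE \<omega> in M. L0_rep (N (y \<ominus>\<^bsub>E\<^esub> x)) \<omega> \<le> ?e \<omega>"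
        have yx: "y \<ominus>\<^bsub>E\<^esub> x \<in> carrier E" using x y by simp
        have "(y \<ominus>\<^bsub>E\<^esub> x) \<oplus>\<^bsub>E\<^esub> x = y" using x y by (simp add: a_minus_def M.a_assoc M.l_neg)
        then have 1: "AE \<omega> in M. g y \<omega> = g (y \<ominus>\<^bsub>E\<^esub> x) \<omega> + g x \<omega>" using add[OF yx x] by simp
        have "AE \<omega> in M. \<forall>N\<in>Q. L0_rep (N (y \<ominus>\<^bsub>E\<^esub> x)) \<omega> \<le> ?e \<omega>"
          by (rule sn_all[OF Q(1)]) (use le in blast)
        with 1 dom[OF yx] rep[OF x] rep[OF y]
        have "AE \<omega> in M. \<bar>L0_rep (L0_class M (g y)) \<omega> - L0_rep (L0_class M (g x)) \<omega>\<bar> \<le> \<epsilon> \<omega>"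
        proof eventually_elim
          case (elim \<omega>)
          have "sn Q (y \<ominus>\<^bsub>E\<^esub> x) \<omega> \<le> real (card Q) * ?e \<omega>"
            unfolding sn_def using elim by (intro sum_bounded_above) auto
          then have "C * sn Q (y \<ominus>\<^bsub>E\<^esub> x) \<omega> \<le> C * (real (card Q) * ?e \<omega>)" using C by simp
          also have "\<dots> = \<epsilon> \<omega>" using cQ by (auto simp: field_simps)
          finally show ?case using elim by simp
        qed
        from ball[OF L[OF y] this] y show "y \<in> {x \<in> carrier E. ?G x \<in> V}" by simp
      qed
    qed auto
    then show ?thesis by (simp add: topspace_Tc_E)
  qed
  then have cont: "continuous_map (Tc M E P) (Tc_L0 M) ?G"
    using L by (auto simp: continuous_map Pi_iff topspace_Tc_E topspace_Tc_L0)
  show ?thesis unfolding Tc_dual_def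
  proof (intro CollectI conjI ballI cont)
    show "?G \<in> carrier E \<rightarrow>\<^sub>E L0 M" using L by auto
  next
    fix x y assume x: "x \<in> carrier E" and y: "y \<in> carrier E"
    have xy: "x \<oplus>\<^bsub>E\<^esub> y \<in> carrier E" using x y by simp
    have "L0_class M (g (x \<oplus>\<^bsub>E\<^esub> y)) = L0_add M (L0_class M (g x)) (L0_class M (g y))"
      unfolding L0_class_add[OF m[OF x] m[OF y]]
      by (rule L0_class_eqI) (use m[OF xy] m[OF x] m[OF y] add[OF x y] in auto)
    with x y xy show "?G (x \<oplus>\<^bsub>E\<^esub> y) = L0_add M (?G x) (?G y)" by simp
  next
    fix \<xi> :: "('a \<Rightarrow> real) set" and x assume xi: "\<xi> \<in> L0 M" and x: "x \<in> carrier E"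
    note u = L0_rep_measurable[OF xi]
    have ux: "\<xi> \<odot>\<^bsub>E\<^esub> x \<in> carrier E" "\<xi> \<odot>\<^bsub>E\<^esub> x = sc (L0_rep \<xi>) x"
      unfolding smult_eq_sc[OF xi] using u x by simp_all
    have "L0_class M (g (\<xi> \<odot>\<^bsub>E\<^esub> x)) = L0_mult M (L0_class M (L0_rep \<xi>)) (L0_class M (g x))"
      unfolding L0_class_mult[OF u m[OF x]]
      by (rule L0_class_eqI) (use m[OF ux(1)] m[OF x] u sc[OF x u] ux(2) in auto)
    with x ux(1) L0_class_rep(2)[OF xi] show "?G (\<xi> \<odot>\<^bsub>E\<^esub> x) = L0_mult M \<xi> (?G x)" by simp
  qed
qed

end

lemma AE_imp_le_cong:
  fixes a b a' b' :: "'a \<Rightarrow> 'b::ord"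
  assumes "AE \<omega>\<in>D in M. a \<omega> = a' \<omega>" "AE \<omega>\<in>D in M. b \<omega> = b' \<omega>"
  shows "(AE \<omega>\<in>D in M. a \<omega> \<le> b \<omega>) \<longleftrightarrow> (AE \<omega>\<in>D in M. a' \<omega> \<le> b' \<omega>)"
proof
  assume "AE \<omega>\<in>D in M. a \<omega> \<le> b \<omega>"
  with assms show "AE \<omega>\<in>D in M. a' \<omega> \<le> b' \<omega>" by eventually_elim auto
next
  assume "AE \<omega>\<in>D in M. a' \<omega> \<le> b' \<omega>"
  with assms show "AE \<omega>\<in>D in M. a \<omega> \<le> b \<omega>" by eventually_elim auto
qed

subsection \<open>Restriction to an event\<close>

context rlc_module
begin

lemma local_AE:
  assumes f: "f \<in> carrier E \<rightarrow> L0 M" "L0_local M E f" and x: "x \<in> carrier E" and A: "A \<in> sets M"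
  shows "AE \<omega>\<in>A in M. L0_rep (f (sc (indicator A) x)) \<omega> = L0_rep (f x) \<omega>"
proof -
  have x': "sc (indicator A) x \<in> carrier E" using x A by simp
  have "L0_mult M (L0_ind M A) (f x) = L0_mult M (L0_ind M A) (f (sc (indicator A) x))"
    using f(2) x A unfolding L0_local_def ind_smult_eq_sc by blast
  then show ?thesis
    using L0_ind_mult_eq_iff[OF funcset_mem[OF f(1) x] funcset_mem[OF f(1) x'] A]
    by (simp add: eq_commute)
qed

text \<open>A local function depends on \<open>A\<close> only through the part of the argument on
  \<open>A\<close>; this is how values at concatenated points are computed.\<close>

lemma local_cong:
  assumes f: "f \<in> carrier E \<rightarrow> L0 M" "L0_local M E f" and x: "x \<in> carrier E" "y \<in> carrier E" and A: "A \<in> sets M"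
    and eq: "sc (indicator A) x = sc (indicator A) y"
  shows "AE \<omega>\<in>A in M. L0_rep (f x) \<omega> = L0_rep (f y) \<omega>"
  using local_AE[OF f x(1) A] local_AE[OF f x(2) A] unfolding eq by eventually_elim auto

context
  fixes D :: "'a set"
  assumes D [measurable]: "D \<in> sets M" and pos: "measure M D > 0"
begin

text \<open>Multiplication by the indicator is idempotent, so its range is its set of fixed points.
  Closure of the restricted carrier under the operations is then a computation.\<close>

lemma restr_carrier_iff: "x \<in> carrier (restr_module M D E) \<longleftrightarrow> x \<in> carrier E \<and> sc (indicator D) x = x"
proof
  assume "x \<in> carrier (restr_module M D E)"
  then obtain y where y: "y \<in> carrier E" "x = sc (indicator D) y"
    by (auto simp: restr_module_def ind_smult_eq_sc)
  have "sc (indicator D) x = sc (indicator D) y"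
    unfolding y(2) using y(1) by (subst sc_sc) (auto intro!: sc_cong simp: indicator_def)
  with y show "x \<in> carrier E \<and> sc (indicator D) x = x" by simp
next
  assume *: "x \<in> carrier E \<and> sc (indicator D) x = x"
  then have "x = L0_ind M D \<odot>\<^bsub>E\<^esub> x" by (simp add: ind_smult_eq_sc)
  with * show "x \<in> carrier (restr_module M D E)" by (auto simp: restr_module_def)
qed

lemma restr_carrier_subset: "x \<in> carrier (restr_module M D E) \<Longrightarrow> x \<in> carrier E"
  by (simp add: restr_carrier_iff)

lemma sc_indicator_in_restr: "x \<in> carrier E \<Longrightarrow> sc (indicator D) x \<in> carrier (restr_module M D E)"
  by (auto simp: restr_module_def ind_smult_eq_sc)

lemma restr_add_closed:
  "x \<in> carrier (restr_module M D E) \<Longrightarrow> y \<in> carrier (restr_module M D E) \<Longrightarrow>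
    x \<oplus>\<^bsub>E\<^esub> y \<in> carrier (restr_module M D E)"
  by (simp add: restr_carrier_iff sc_add_right)

lemma restr_minus_closed:
  "x \<in> carrier (restr_module M D E) \<Longrightarrow> y \<in> carrier (restr_module M D E) \<Longrightarrow>
    x \<ominus>\<^bsub>E\<^esub> y \<in> carrier (restr_module M D E)"
  by (simp add: restr_carrier_iff sc_minus_right)

lemma restr_sc_closed:
  assumes "x \<in> carrier (restr_module M D E)" and [measurable]: "u \<in> borel_measurable M"
  shows "sc u x \<in> carrier (restr_module M D E)"
proof -
  have "sc (indicator D) (sc u x) = sc u (sc (indicator D) x)"
    using restr_carrier_subset[OF assms(1)] by (simp add: sc_sc mult.commute)
  then show ?thesis using assms by (simp add: restr_carrier_iff)
qed

text \<open>The inverse is a definite description over the smaller carrier. It picks the same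
  element as in \<open>E\<close>, because inverses in \<open>E\<close> are unique and those of
  restricted vectors are restricted again.\<close>

lemma restr_minus:
  assumes x: "x \<in> carrier (restr_module M D E)" and y: "y \<in> carrier (restr_module M D E)"
  shows "y \<ominus>\<^bsub>restr_module M D E\<^esub> x = y \<ominus>\<^bsub>E\<^esub> x"
proof -
  have [simp]: "x \<in> carrier E" "\<ominus>\<^bsub>E\<^esub> x \<in> carrier (restr_module M D E)"
    using x by (simp_all add: restr_carrier_iff sc_a_inv)
  have ops: "add (restr_module M D E) = add E" "zero (restr_module M D E) = zero E"
    by (simp_all add: restr_module_def)
  have "\<ominus>\<^bsub>restr_module M D E\<^esub> x = \<ominus>\<^bsub>E\<^esub> x"
    unfolding a_inv_def[of "restr_module M D E"] m_inv_def
  proof (rule the_equality)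
    fix z assume z: "z \<in> carrier (add_monoid (restr_module M D E)) \<and>
      x \<otimes>\<^bsub>add_monoid (restr_module M D E)\<^esub> z = \<one>\<^bsub>add_monoid (restr_module M D E)\<^esub> \<and>
      z \<otimes>\<^bsub>add_monoid (restr_module M D E)\<^esub> x = \<one>\<^bsub>add_monoid (restr_module M D E)\<^esub>"
    then have "z \<in> carrier E" "z \<oplus>\<^bsub>E\<^esub> x = \<zero>\<^bsub>E\<^esub>" by (simp_all add: ops restr_carrier_subset)
    then show "z = \<ominus>\<^bsub>E\<^esub> x" by (simp add: M.minus_equality)
  qed (simp add: ops M.l_neg M.r_neg)
  then show ?thesis by (simp add: a_minus_def ops)
qed

text \<open>A finite family of restricted seminorms is the image of a finite subfamily of
  \<open>P\<close>, and a radius over the conditional base extends to one over \<open>M\<close>.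
  Hence balls of the restricted module are balls for the original seminorms with the inequalities
  demanded on \<open>D\<close> only.\<close>

lemma openin_Tc_restr:
  "openin (Tc (cond_base M D) (restr_module M D E) (restr_seminorms M D E P)) U \<longleftrightarrow>
    U \<subseteq> carrier (restr_module M D E) \<and>
    (\<forall>x\<in>U. \<exists>Q \<epsilon>. finite Q \<and> Q \<noteq> {} \<and> Q \<subseteq> P \<and> \<epsilon> \<in> borel_measurable M \<and> (\<forall>\<omega>. 0 < \<epsilon> \<omega>) \<and>
      (\<forall>y\<in>carrier (restr_module M D E).
        (\<forall>N\<in>Q. AE \<omega>\<in>D in M. L0_rep (N (y \<ominus>\<^bsub>E\<^esub> x)) \<omega> \<le> \<epsilon> \<omega>) \<longrightarrow> y \<in> U))"
proof -
  let ?C = "carrier (restr_module M D E)"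
  let ?r = "\<lambda>N. \<lambda>x\<in>?C. L0_restrict M D (N x)"
  have in_L0: "?r N (y \<ominus>\<^bsub>restr_module M D E\<^esub> x) \<in> L0 (cond_base M D)"
    if "N \<in> P" "x \<in> ?C" "y \<in> ?C" for N x y
    using that restr_minus_closed[of y x]
    by (simp add: restr_minus L0_restrict_in_L0[OF D pos] seminorm_in_L0 restr_carrier_subset)
  have rep: "(AE \<omega> in cond_base M D. L0_rep (?r N (y \<ominus>\<^bsub>restr_module M D E\<^esub> x)) \<omega> \<le> \<epsilon> \<omega>) \<longleftrightarrow>
      (AE \<omega>\<in>D in M. L0_rep (N (y \<ominus>\<^bsub>E\<^esub> x)) \<omega> \<le> \<epsilon> \<omega>)"
    if "N \<in> P" "x \<in> ?C" "y \<in> ?C" for N x y \<epsilon>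
  proof -
    have m: "y \<ominus>\<^bsub>E\<^esub> x \<in> ?C" using that restr_minus_closed by blast
    have e: "?r N (y \<ominus>\<^bsub>restr_module M D E\<^esub> x) = L0_restrict M D (N (y \<ominus>\<^bsub>E\<^esub> x))"
      using that m by (simp add: restr_minus)
    have r: "AE \<omega>\<in>D in M. L0_rep (L0_restrict M D (N (y \<ominus>\<^bsub>E\<^esub> x))) \<omega> = L0_rep (N (y \<ominus>\<^bsub>E\<^esub> x)) \<omega>"
      by (intro L0_rep_restrict[OF D pos] seminorm_in_L0 that restr_carrier_subset m)
    show ?thesis unfolding e AE_cond_base[OF D pos]
    proof
      assume "AE \<omega>\<in>D in M. L0_rep (L0_restrict M D (N (y \<ominus>\<^bsub>E\<^esub> x))) \<omega> \<le> \<epsilon> \<omega>"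
      with r show "AE \<omega>\<in>D in M. L0_rep (N (y \<ominus>\<^bsub>E\<^esub> x)) \<omega> \<le> \<epsilon> \<omega>" by eventually_elim auto
    next
      assume "AE \<omega>\<in>D in M. L0_rep (N (y \<ominus>\<^bsub>E\<^esub> x)) \<omega> \<le> \<epsilon> \<omega>"
      with r show "AE \<omega>\<in>D in M. L0_rep (L0_restrict M D (N (y \<ominus>\<^bsub>E\<^esub> x))) \<omega> \<le> \<epsilon> \<omega>"
        by eventually_elim auto
    qed
  qed
  have S: "restr_seminorms M D E P = ?r ` P" by (simp add: restr_seminorms_def)
  have "openin (Tc (cond_base M D) (restr_module M D E) (restr_seminorms M D E P)) U \<longleftrightarrow> U \<subseteq> ?C \<and>
    (\<forall>x\<in>U. \<exists>Q \<epsilon>. finite Q \<and> Q \<noteq> {} \<and> Q \<subseteq> ?r ` P \<and> \<epsilon> \<in> borel_measurable (cond_base M D) \<and> (\<forall>\<omega>. 0 < \<epsilon> \<omega>) \<and>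
      (\<forall>y\<in>?C. (\<forall>N\<in>Q. AE \<omega> in cond_base M D. L0_rep (N (y \<ominus>\<^bsub>restr_module M D E\<^esub> x)) \<omega> \<le> \<epsilon> \<omega>) \<longrightarrow> y \<in> U))"
    unfolding S by (rule openin_Tc) (use in_L0 in blast)
  also have "\<dots> \<longleftrightarrow> U \<subseteq> ?C \<and>
    (\<forall>x\<in>U. \<exists>Q \<epsilon>. finite Q \<and> Q \<noteq> {} \<and> Q \<subseteq> P \<and> \<epsilon> \<in> borel_measurable M \<and> (\<forall>\<omega>. 0 < \<epsilon> \<omega>) \<and>
      (\<forall>y\<in>?C. (\<forall>N\<in>Q. AE \<omega>\<in>D in M. L0_rep (N (y \<ominus>\<^bsub>E\<^esub> x)) \<omega> \<le> \<epsilon> \<omega>) \<longrightarrow> y \<in> U))"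
  proof (intro conj_cong refl ball_cong)
    fix x assume "U \<subseteq> ?C" "x \<in> U"
    then have x: "x \<in> ?C" by auto
    show "(\<exists>Q \<epsilon>. finite Q \<and> Q \<noteq> {} \<and> Q \<subseteq> ?r ` P \<and> \<epsilon> \<in> borel_measurable (cond_base M D) \<and> (\<forall>\<omega>. 0 < \<epsilon> \<omega>) \<and>
      (\<forall>y\<in>?C. (\<forall>N\<in>Q. AE \<omega> in cond_base M D. L0_rep (N (y \<ominus>\<^bsub>restr_module M D E\<^esub> x)) \<omega> \<le> \<epsilon> \<omega>) \<longrightarrow> y \<in> U)) \<longleftrightarrow>
     (\<exists>Q \<epsilon>. finite Q \<and> Q \<noteq> {} \<and> Q \<subseteq> P \<and> \<epsilon> \<in> borel_measurable M \<and> (\<forall>\<omega>. 0 < \<epsilon> \<omega>) \<and>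
      (\<forall>y\<in>?C. (\<forall>N\<in>Q. AE \<omega>\<in>D in M. L0_rep (N (y \<ominus>\<^bsub>E\<^esub> x)) \<omega> \<le> \<epsilon> \<omega>) \<longrightarrow> y \<in> U))" (is "?L \<longleftrightarrow> ?R")
    proof
      assume ?L
      then obtain Q' \<epsilon> where Q': "finite Q'" "Q' \<noteq> {}" "Q' \<subseteq> ?r ` P" and e: "\<epsilon> \<in> borel_measurable (cond_base M D)" "\<And>\<omega>. 0 < \<epsilon> \<omega>"
        and ball: "\<forall>y\<in>?C. (\<forall>N\<in>Q'. AE \<omega> in cond_base M D. L0_rep (N (y \<ominus>\<^bsub>restr_module M D E\<^esub> x)) \<omega> \<le> \<epsilon> \<omega>) \<longrightarrow> y \<in> U"
        by (elim exE conjE) simp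
      from finite_subset_image[OF Q'(1,3)] obtain Q where Q: "Q \<subseteq> P" "finite Q" "Q' = ?r ` Q" by auto
      \<comment> \<open>Off \<open>D\<close> any positive value will do, since the inequalities are
        tested on \<open>D\<close> alone.\<close>
      let ?e = "\<lambda>\<omega>. if \<omega> \<in> D then \<epsilon> \<omega> else 1"
      show ?R
      proof (intro exI[of _ Q] exI[of _ ?e] conjI ballI impI allI)
        show "?e \<in> borel_measurable M" by (rule measurable_extend[OF D pos e(1)])
        fix y assume y: "y \<in> ?C" and le: "\<forall>N\<in>Q. AE \<omega>\<in>D in M. L0_rep (N (y \<ominus>\<^bsub>E\<^esub> x)) \<omega> \<le> ?e \<omega>"
        have "AE \<omega> in cond_base M D. L0_rep (?r N (y \<ominus>\<^bsub>restr_module M D E\<^esub> x)) \<omega> \<le> \<epsilon> \<omega>" if N: "N \<in> Q" for N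
        proof (subst rep)
          show "AE \<omega>\<in>D in M. L0_rep (N (y \<ominus>\<^bsub>E\<^esub> x)) \<omega> \<le> \<epsilon> \<omega>"
            using le[rule_format, OF N] by eventually_elim simp
        qed (use N Q x y in auto)
        with ball y show "y \<in> U" unfolding Q(3) by blast
      qed (use Q Q' e in auto)
    next
      assume ?R
      then obtain Q \<epsilon> where Q: "finite Q" "Q \<noteq> {}" "Q \<subseteq> P" and e: "\<epsilon> \<in> borel_measurable M" "\<And>\<omega>. 0 < \<epsilon> \<omega>"
        and ball: "\<forall>y\<in>?C. (\<forall>N\<in>Q. AE \<omega>\<in>D in M. L0_rep (N (y \<ominus>\<^bsub>E\<^esub> x)) \<omega> \<le> \<epsilon> \<omega>) \<longrightarrow> y \<in> U"
        by (elim exE conjE) simp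
      show ?L
      proof (intro exI[of _ "?r ` Q"] exI[of _ \<epsilon>] conjI ballI impI allI)
        show "\<epsilon> \<in> borel_measurable (cond_base M D)" by (rule measurable_cond_base[OF D pos e(1)])
        fix y assume y: "y \<in> ?C"
          and le: "\<forall>N\<in>?r ` Q. AE \<omega> in cond_base M D. L0_rep (N (y \<ominus>\<^bsub>restr_module M D E\<^esub> x)) \<omega> \<le> \<epsilon> \<omega>"
        have "AE \<omega>\<in>D in M. L0_rep (N (y \<ominus>\<^bsub>E\<^esub> x)) \<omega> \<le> \<epsilon> \<omega>" if N: "N \<in> Q" for N
        proof (subst rep[symmetric])
          show "AE \<omega> in cond_base M D. L0_rep (?r N (y \<ominus>\<^bsub>restr_module M D E\<^esub> x)) \<omega> \<le> \<epsilon> \<omega>"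
            using le N by blast
        qed (use N Q x y in auto)
        with ball y show "y \<in> U" by blast
      qed (use Q e in auto)
    qed
  qed
  finally show ?thesis .
qed

lemma topspace_Tc_restr:
  "topspace (Tc (cond_base M D) (restr_module M D E) (restr_seminorms M D E P)) = carrier (restr_module M D E)"
  (is "topspace ?T = ?C")
proof (rule antisym)
  show "topspace ?T \<subseteq> ?C"
    using openin_topspace[of ?T] unfolding openin_Tc_restr by blast
  have "openin ?T ?C" unfolding openin_Tc_restr
  proof (intro conjI ballI)
    obtain N where "N \<in> P" using P_nonempty by auto
    then show "\<exists>Q \<epsilon>. finite Q \<and> Q \<noteq> {} \<and> Q \<subseteq> P \<and> \<epsilon> \<in> borel_measurable M \<and> (\<forall>\<omega>. 0 < \<epsilon> \<omega>) \<and>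
      (\<forall>y\<in>?C. (\<forall>N\<in>Q. AE \<omega>\<in>D in M. L0_rep (N (y \<ominus>\<^bsub>E\<^esub> x)) \<omega> \<le> \<epsilon> \<omega>) \<longrightarrow> y \<in> ?C)" for x
      by (intro exI[of _ "{N}"] exI[of _ "\<lambda>_. 1"]) auto
  qed simp
  then show "?C \<subseteq> topspace ?T" by (rule openin_subset)
qed

section \<open>Properness, convexity and epigraph of a restricted function\<close>

context
  fixes f :: "'e \<Rightarrow> ('a \<Rightarrow> ereal) set"
  assumes f: "f \<in> carrier E \<rightarrow> L0 M"
begin

lemma
  assumes x: "x \<in> carrier (restr_module M D E)"
  shows restr_fun_in_L0: "restr_fun M D E f x \<in> L0 (cond_base M D)"
    and L0_rep_restr_fun: "AE \<omega>\<in>D in M. L0_rep (restr_fun M D E f x) \<omega> = L0_rep (f x) \<omega>"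
proof -
  have fx: "f x \<in> L0 M" by (rule funcset_mem[OF f restr_carrier_subset[OF x]])
  have m: "L0_mult M (L0_ind M D) (f x) \<in> L0 M"
    by (intro L0_mult_ereal_in_L0 L0_ind_in_L0 D fx)
  have e: "restr_fun M D E f x = L0_restrict M D (L0_mult M (L0_ind M D) (f x))"
    using x by (simp add: restr_fun_def)
  show "restr_fun M D E f x \<in> L0 (cond_base M D)" unfolding e by (rule L0_restrict_in_L0[OF D pos m])
  show "AE \<omega>\<in>D in M. L0_rep (restr_fun M D E f x) \<omega> = L0_rep (f x) \<omega>"
    using L0_rep_restrict[OF D pos m] L0_rep_mult_ereal[OF L0_ind_in_L0[OF D] fx] L0_rep_ind[OF D, where ?'b = ereal]
    unfolding e by eventually_elim simp
qed

lemma L0_proper_restr_iff: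
  "L0_proper (cond_base M D) (restr_module M D E) (restr_fun M D E f) \<longleftrightarrow>
    (\<forall>x\<in>carrier (restr_module M D E). AE \<omega>\<in>D in M. L0_rep (f x) \<omega> > -\<infinity>) \<and>
    (\<exists>x\<in>carrier (restr_module M D E). AE \<omega>\<in>D in M. L0_rep (f x) \<omega> < \<infinity>)"
proof -
  have eq: "(AE \<omega>\<in>D in M. R (L0_rep (restr_fun M D E f x) \<omega>)) \<longleftrightarrow>
      (AE \<omega>\<in>D in M. R (L0_rep (f x) \<omega>))" if x: "x \<in> carrier (restr_module M D E)" for x R
  proof
    assume "AE \<omega>\<in>D in M. R (L0_rep (restr_fun M D E f x) \<omega>)"
    with L0_rep_restr_fun[OF x] show "AE \<omega>\<in>D in M. R (L0_rep (f x) \<omega>)"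
      by eventually_elim auto
  next
    assume "AE \<omega>\<in>D in M. R (L0_rep (f x) \<omega>)"
    with L0_rep_restr_fun[OF x] show "AE \<omega>\<in>D in M. R (L0_rep (restr_fun M D E f x) \<omega>)"
      by eventually_elim auto
  qed
  show ?thesis unfolding L0_proper_def AE_cond_base[OF D pos]
    using eq[of _ "\<lambda>t. t > -\<infinity>"] eq[of _ "\<lambda>t. t < \<infinity>"] by (intro arg_cong2[of _ _ _ _ "(\<and>)"] ball_cong bex_cong refl)
qed

text \<open>A multiplier over the conditional base acts after extension by zero. On vectors
  supported in \<open>D\<close> this agrees with the action of any \<open>u\<close> that equals it
  a.s. on \<open>D\<close>.\<close>

lemma restr_convex_ineq_iff:
  assumes x: "x \<in> carrier (restr_module M D E)" and y: "y \<in> carrier (restr_module M D E)"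
    and xi: "\<xi> \<in> L0 (cond_base M D)" and u: "u \<in> borel_measurable M"
    and eq: "AE \<omega>\<in>D in M. L0_rep \<xi> \<omega> = u \<omega>"
  shows "restr_fun M D E f (\<xi> \<odot>\<^bsub>restr_module M D E\<^esub> x \<oplus>\<^bsub>restr_module M D E\<^esub>
        L0_diff (cond_base M D) (L0_const (cond_base M D) 1) \<xi> \<odot>\<^bsub>restr_module M D E\<^esub> y)
      \<sqsubseteq>\<^bsub>L0_order (cond_base M D)\<^esub>
      L0_add (cond_base M D)
        (L0_mult (cond_base M D) (L0_ereal (cond_base M D) \<xi>) (restr_fun M D E f x))
        (L0_mult (cond_base M D)
          (L0_ereal (cond_base M D) (L0_diff (cond_base M D) (L0_const (cond_base M D) 1) \<xi>))
          (restr_fun M D E f y)) \<longleftrightarrow>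
    (AE \<omega>\<in>D in M. L0_rep (f (sc u x \<oplus>\<^bsub>E\<^esub> sc (\<lambda>\<omega>. 1 - u \<omega>) y)) \<omega> \<le>
      ereal (u \<omega>) * L0_rep (f x) \<omega> + ereal (1 - u \<omega>) * L0_rep (f y) \<omega>)"
proof -
  note [measurable] = u
  let ?M = "cond_base M D"
  let ?\<eta> = "L0_diff ?M (L0_const ?M 1) \<xi>"
  have eta: "?\<eta> \<in> L0 ?M" by (intro L0_diff_in_L0 L0_const_in_L0 xi)
  have eta_eq: "AE \<omega>\<in>D in M. L0_rep ?\<eta> \<omega> = 1 - u \<omega>"
    using L0_rep_diff[OF L0_const_in_L0[of ?M 1] xi] L0_rep_const[of ?M "1::real"] eq
    unfolding AE_cond_base[OF D pos] by eventually_elim auto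
  have smult: "\<zeta> \<odot>\<^bsub>restr_module M D E\<^esub> z = sc v z"
    if z: "z \<in> carrier (restr_module M D E)" and zeta: "\<zeta> \<in> L0 ?M" and v [measurable]: "v \<in> borel_measurable M"
      and eq: "AE \<omega>\<in>D in M. L0_rep \<zeta> \<omega> = v \<omega>" for \<zeta> z v
  proof -
    have L: "L0_extend M D \<zeta> \<in> L0 M" by (rule L0_extend_in_L0[OF D pos zeta])
    have "\<zeta> \<odot>\<^bsub>restr_module M D E\<^esub> z = sc (L0_rep (L0_extend M D \<zeta>)) z"
      by (simp add: restr_module_def smult_eq_sc[OF L])
    also have "\<dots> = sc (\<lambda>\<omega>. v \<omega> * indicator D \<omega>) z"
    proof (rule sc_cong)
      show "AE \<omega> in M. L0_rep (L0_extend M D \<zeta>) \<omega> = v \<omega> * indicator D \<omega>"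
        using L0_rep_extend[OF D pos zeta] eq by eventually_elim auto
    qed (use L0_rep_measurable[OF L] in auto)
    also have "\<dots> = sc v (sc (indicator D) z)"
      using z by (subst sc_sc) (auto simp: restr_carrier_subset)
    finally show ?thesis using z by (simp add: restr_carrier_iff)
  qed
  let ?z = "sc u x \<oplus>\<^bsub>E\<^esub> sc (\<lambda>\<omega>. 1 - u \<omega>) y"
  have z: "?z \<in> carrier (restr_module M D E)"
    by (intro restr_add_closed restr_sc_closed x y) measurable
  have zeq: "\<xi> \<odot>\<^bsub>restr_module M D E\<^esub> x \<oplus>\<^bsub>restr_module M D E\<^esub> ?\<eta> \<odot>\<^bsub>restr_module M D E\<^esub> y = ?z"
    using smult[OF x xi u eq] smult[OF y eta _ eta_eq] by (simp add: restr_module_def)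
  note fx = restr_fun_in_L0[OF x] and fy = restr_fun_in_L0[OF y]
  have m1: "L0_mult ?M (L0_ereal ?M \<xi>) (restr_fun M D E f x) \<in> L0 ?M"
    by (intro L0_mult_ereal_in_L0 L0_ereal_in_L0 xi fx)
  have m2: "L0_mult ?M (L0_ereal ?M ?\<eta>) (restr_fun M D E f y) \<in> L0 ?M"
    by (intro L0_mult_ereal_in_L0 L0_ereal_in_L0 eta fy)
  have rhs: "AE \<omega>\<in>D in M. L0_rep (L0_add ?M (L0_mult ?M (L0_ereal ?M \<xi>) (restr_fun M D E f x))
        (L0_mult ?M (L0_ereal ?M ?\<eta>) (restr_fun M D E f y))) \<omega> =
      ereal (u \<omega>) * L0_rep (f x) \<omega> + ereal (1 - u \<omega>) * L0_rep (f y) \<omega>"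
    using L0_rep_add_ereal[OF m1 m2] L0_rep_mult_ereal[OF L0_ereal_in_L0[OF xi] fx]
      L0_rep_mult_ereal[OF L0_ereal_in_L0[OF eta] fy] L0_rep_ereal[OF xi] L0_rep_ereal[OF eta]
      eq eta_eq L0_rep_restr_fun[OF x] L0_rep_restr_fun[OF y]
    unfolding AE_cond_base[OF D pos] by eventually_elim auto
  show ?thesis unfolding zeq L0_le_iff AE_cond_base[OF D pos]
    by (rule AE_imp_le_cong[OF L0_rep_restr_fun[OF z] rhs])
qed

lemma L0_convex_restr_iff:
  "L0_convex (cond_base M D) (restr_module M D E) (restr_fun M D E f) \<longleftrightarrow>
    (\<forall>x\<in>carrier (restr_module M D E). \<forall>y\<in>carrier (restr_module M D E).
      \<forall>u\<in>borel_measurable M. (\<forall>\<omega>. 0 \<le> u \<omega> \<and> u \<omega> \<le> 1) \<longrightarrow>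
      (AE \<omega>\<in>D in M. L0_rep (f (sc u x \<oplus>\<^bsub>E\<^esub> sc (\<lambda>\<omega>. 1 - u \<omega>) y)) \<omega> \<le>
        ereal (u \<omega>) * L0_rep (f x) \<omega> + ereal (1 - u \<omega>) * L0_rep (f y) \<omega>))"
    (is "?L \<longleftrightarrow> ?R")
proof
  assume L: ?L
  show ?R
  proof (intro ballI impI)
    fix x y and u :: "'a \<Rightarrow> real" assume x: "x \<in> carrier (restr_module M D E)" and y: "y \<in> carrier (restr_module M D E)"
      and u [measurable]: "u \<in> borel_measurable M" and u01: "\<forall>\<omega>. 0 \<le> u \<omega> \<and> u \<omega> \<le> 1"
    let ?\<xi> = "L0_class (cond_base M D) u"
    have um: "u \<in> borel_measurable (cond_base M D)" by (rule measurable_cond_base[OF D pos u])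
    have xi: "?\<xi> \<in> L0 (cond_base M D)" by (rule L0_class_in_L0[OF um])
    have eq: "AE \<omega>\<in>D in M. L0_rep ?\<xi> \<omega> = u \<omega>"
      using L0_rep_class(2)[OF um] unfolding AE_cond_base[OF D pos] .
    have "?\<xi> \<in> L0_nonneg (cond_base M D)" unfolding L0_nonneg_def L0_le_iff
      using L0_rep_const[of "cond_base M D" "0::real"] L0_rep_class(2)[OF um] xi u01
      by (auto elim!: eventually_elim2)
    moreover have "?\<xi> \<sqsubseteq>\<^bsub>L0_order (cond_base M D)\<^esub> L0_const (cond_base M D) 1" unfolding L0_le_iff
      using L0_rep_const[of "cond_base M D" "1::real"] L0_rep_class(2)[OF um] u01
      by (auto elim!: eventually_elim2)
    ultimately show "AE \<omega>\<in>D in M. L0_rep (f (sc u x \<oplus>\<^bsub>E\<^esub> sc (\<lambda>\<omega>. 1 - u \<omega>) y)) \<omega> \<le>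
        ereal (u \<omega>) * L0_rep (f x) \<omega> + ereal (1 - u \<omega>) * L0_rep (f y) \<omega>"
      using L x y restr_convex_ineq_iff[OF x y xi u eq] unfolding L0_convex_def by blast
  qed
next
  assume R: ?R
  show ?L unfolding L0_convex_def
  proof (intro ballI impI)
    fix x y \<xi> assume x: "x \<in> carrier (restr_module M D E)" and y: "y \<in> carrier (restr_module M D E)"
      and xi0: "\<xi> \<in> L0_nonneg (cond_base M D)" and xi1: "\<xi> \<sqsubseteq>\<^bsub>L0_order (cond_base M D)\<^esub> L0_const (cond_base M D) 1"
    have xi: "\<xi> \<in> L0 (cond_base M D)" using xi0 by (simp add: L0_nonneg_def)
    \<comment> \<open>Clipping alters the multiplier at most on a null part of \<open>D\<close> and
      provides the bounds 0 and 1 at every point.\<close>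
    define u where "u = (\<lambda>\<omega>. max 0 (min 1 (if \<omega> \<in> D then L0_rep \<xi> \<omega> else 0)))"
    have u: "u \<in> borel_measurable M" unfolding u_def
      using measurable_extend[OF D pos L0_rep_measurable[OF xi]] by measurable
    have "AE \<omega>\<in>D in M. 0 \<le> L0_rep \<xi> \<omega>"
      using xi0 L0_rep_const[of "cond_base M D" "0::real"]
      unfolding L0_nonneg_def mem_Collect_eq L0_le_iff AE_cond_base[OF D pos]
      by (auto elim!: eventually_elim2)
    moreover have "AE \<omega>\<in>D in M. L0_rep \<xi> \<omega> \<le> 1"
      using xi1 L0_rep_const[of "cond_base M D" "1::real"]
      unfolding L0_le_iff AE_cond_base[OF D pos] by (auto elim!: eventually_elim2)
    ultimately have eq: "AE \<omega>\<in>D in M. L0_rep \<xi> \<omega> = u \<omega>"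
      by eventually_elim (auto simp: u_def)
    have "\<forall>\<omega>. 0 \<le> u \<omega> \<and> u \<omega> \<le> 1" by (simp add: u_def)
    with R x y u have "AE \<omega>\<in>D in M. L0_rep (f (sc u x \<oplus>\<^bsub>E\<^esub> sc (\<lambda>\<omega>. 1 - u \<omega>) y)) \<omega> \<le>
        ereal (u \<omega>) * L0_rep (f x) \<omega> + ereal (1 - u \<omega>) * L0_rep (f y) \<omega>" by blast
    then show "restr_fun M D E f (\<xi> \<odot>\<^bsub>restr_module M D E\<^esub> x \<oplus>\<^bsub>restr_module M D E\<^esub>
        L0_diff (cond_base M D) (L0_const (cond_base M D) 1) \<xi> \<odot>\<^bsub>restr_module M D E\<^esub> y)
      \<sqsubseteq>\<^bsub>L0_order (cond_base M D)\<^esub>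
      L0_add (cond_base M D)
        (L0_mult (cond_base M D) (L0_ereal (cond_base M D) \<xi>) (restr_fun M D E f x))
        (L0_mult (cond_base M D)
          (L0_ereal (cond_base M D) (L0_diff (cond_base M D) (L0_const (cond_base M D) 1) \<xi>))
          (restr_fun M D E f y))"
      unfolding restr_convex_ineq_iff[OF x y xi u eq] .
  qed
qed

lemma epi_restr_iff:
  "(x, r) \<in> epi (cond_base M D) (restr_module M D E) (restr_fun M D E f) \<longleftrightarrow>
    x \<in> carrier (restr_module M D E) \<and> r \<in> L0 (cond_base M D) \<and>
    (AE \<omega>\<in>D in M. L0_rep (f x) \<omega> \<le> ereal (L0_rep r \<omega>))"
proof -
  have "restr_fun M D E f x \<sqsubseteq>\<^bsub>L0_order (cond_base M D)\<^esub> L0_ereal (cond_base M D) r \<longleftrightarrow>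
      (AE \<omega>\<in>D in M. L0_rep (f x) \<omega> \<le> ereal (L0_rep r \<omega>))"
    if x: "x \<in> carrier (restr_module M D E)" and r: "r \<in> L0 (cond_base M D)"
  proof -
    have 2: "AE \<omega>\<in>D in M. L0_rep (L0_ereal (cond_base M D) r) \<omega> = ereal (L0_rep r \<omega>)"
      using L0_rep_ereal[OF r] unfolding AE_cond_base[OF D pos] .
    show ?thesis unfolding L0_le_iff AE_cond_base[OF D pos]
      by (rule AE_imp_le_cong[OF L0_rep_restr_fun[OF x] 2])
  qed
  then show ?thesis by (auto simp: epi_def)
qed

text \<open>A product neighbourhood of \<open>(x, r)\<close> outside the epigraph is cut at the
  level \<open>r\<close>, which leaves a ball around \<open>x\<close>. Its members violate
  \<open>f y \<le> r\<close> only on some part of \<open>D\<close>, and that part may vary with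
  \<open>y\<close>.\<close>

lemma Tc_lsc_restr_ball:
  assumes lsc: "Tc_lsc (cond_base M D) (restr_module M D E) (restr_seminorms M D E P) (restr_fun M D E f)"
    and x: "x \<in> carrier (restr_module M D E)" and r: "r \<in> borel_measurable M"
    and not_le: "\<not> (AE \<omega>\<in>D in M. L0_rep (f x) \<omega> \<le> ereal (r \<omega>))"
  shows "\<exists>Q \<epsilon>. finite Q \<and> Q \<noteq> {} \<and> Q \<subseteq> P \<and> \<epsilon> \<in> borel_measurable M \<and> (\<forall>\<omega>. 0 < \<epsilon> \<omega>) \<and>
    (\<forall>y\<in>carrier (restr_module M D E).
      (\<forall>N\<in>Q. AE \<omega>\<in>D in M. L0_rep (N (y \<ominus>\<^bsub>E\<^esub> x)) \<omega> \<le> \<epsilon> \<omega>) \<longrightarrow>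
      \<not> (AE \<omega>\<in>D in M. L0_rep (f y) \<omega> \<le> ereal (r \<omega>)))"
proof -
  let ?T = "Tc (cond_base M D) (restr_module M D E) (restr_seminorms M D E P)"
  let ?R = "Tc_L0 (cond_base M D)"
  let ?epi = "epi (cond_base M D) (restr_module M D E) (restr_fun M D E f)"
  let ?r = "L0_class (cond_base M D) r"
  have rm: "r \<in> borel_measurable (cond_base M D)" by (rule measurable_cond_base[OF D pos r])
  have rL: "?r \<in> L0 (cond_base M D)" by (rule L0_class_in_L0[OF rm])
  have rr: "AE \<omega>\<in>D in M. L0_rep ?r \<omega> = r \<omega>"
    using L0_rep_class(2)[OF rm] unfolding AE_cond_base[OF D pos] .
  have iff: "(y, ?r) \<in> ?epi \<longleftrightarrow> (AE \<omega>\<in>D in M. L0_rep (f y) \<omega> \<le> ereal (r \<omega>))" (is "_ \<longleftrightarrow> ?B")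
    if "y \<in> carrier (restr_module M D E)" for y
  proof -
    have "(AE \<omega>\<in>D in M. L0_rep (f y) \<omega> \<le> ereal (L0_rep ?r \<omega>)) \<longleftrightarrow> ?B"
      by (rule AE_imp_le_cong) (use rr in auto)
    then show ?thesis using that rL by (simp add: epi_restr_iff)
  qed
  have op: "openin (prod_topology ?T ?R) (topspace (prod_topology ?T ?R) - ?epi)"
    using lsc unfolding Tc_lsc_def by (rule openin_diff[OF openin_topspace])
  have mem: "(x, ?r) \<in> topspace (prod_topology ?T ?R) - ?epi"
    using x rL not_le iff[OF x] by (simp add: topspace_Tc_restr topspace_Tc_L0)
  from op[unfolded openin_prod_topology_alt, rule_format, OF mem] obtain U V where UV: "openin ?T U" "openin ?R V" "x \<in> U" "?r \<in> V"
    "U \<times> V \<subseteq> topspace (prod_topology ?T ?R) - ?epi"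
    by (elim exE conjE) (rule that)
  from bspec[OF conjunct2[OF UV(1)[unfolded openin_Tc_restr]] UV(3)] obtain Q \<epsilon> where
    Q: "finite Q \<and> Q \<noteq> {} \<and> Q \<subseteq> P \<and> \<epsilon> \<in> borel_measurable M \<and> (\<forall>\<omega>. 0 < \<epsilon> \<omega>) \<and>
      (\<forall>y\<in>carrier (restr_module M D E).
        (\<forall>N\<in>Q. AE \<omega>\<in>D in M. L0_rep (N (y \<ominus>\<^bsub>E\<^esub> x)) \<omega> \<le> \<epsilon> \<omega>) \<longrightarrow> y \<in> U)"
    by (elim exE)
  have "\<not> (AE \<omega>\<in>D in M. L0_rep (f y) \<omega> \<le> ereal (r \<omega>))"
    if y: "y \<in> carrier (restr_module M D E)" "\<forall>N\<in>Q. AE \<omega>\<in>D in M. L0_rep (N (y \<ominus>\<^bsub>E\<^esub> x)) \<omega> \<le> \<epsilon> \<omega>" for y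
    using Q y UV(4,5) iff[OF y(1)] by blast
  with Q show ?thesis by (intro exI[of _ Q] exI[of _ \<epsilon>]) blast
qed

end

end

end

section \<open>The biconjugate\<close>

context rlc_module
begin

lemma MI_in_sets: "MI M E f \<in> sets M"
  using is_ess_Sup_ess_Sup_sets[of "{A \<in> sets M. \<exists>x\<in>carrier E.
     L0_mult M (L0_ind M A) (f x) = L0_mult M (L0_ind M A) (L0_const M (-\<infinity>))}"]
  by (auto simp: MI_def is_ess_Sup_def)

lemma PI_in_sets: "PI M E f \<in> sets M"
  using is_ess_Sup_ess_Sup_sets[of "{A \<in> sets M. \<forall>x\<in>carrier E.
     L0_mult M (L0_ind M A) (f x) = L0_mult M (L0_ind M A) (L0_const M \<infinity>)}"]
  by (auto simp: PI_def is_ess_Sup_def)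

lemma ind_const_iff:
  fixes c :: ereal
  assumes f: "f \<in> carrier E \<rightarrow> L0 M" and x: "x \<in> carrier E" and A: "A \<in> sets M"
  shows "L0_mult M (L0_ind M A) (f x) = L0_mult M (L0_ind M A) (L0_const M c) \<longleftrightarrow>
    (AE \<omega>\<in>A in M. L0_rep (f x) \<omega> = c)"
proof -
  have "(AE \<omega>\<in>A in M. L0_rep (f x) \<omega> = L0_rep (L0_const M c) \<omega>) \<longleftrightarrow>
    (AE \<omega>\<in>A in M. L0_rep (f x) \<omega> = c)"
  proof
    assume "AE \<omega>\<in>A in M. L0_rep (f x) \<omega> = L0_rep (L0_const M c) \<omega>"
    with L0_rep_const[where c = c] show "AE \<omega>\<in>A in M. L0_rep (f x) \<omega> = c"
      by eventually_elim auto
  next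
    assume "AE \<omega>\<in>A in M. L0_rep (f x) \<omega> = c"
    with L0_rep_const[where c = c] show "AE \<omega>\<in>A in M. L0_rep (f x) \<omega> = L0_rep (L0_const M c) \<omega>"
      by eventually_elim auto
  qed
  then show ?thesis
    using L0_ind_mult_eq_iff[OF funcset_mem[OF f x] L0_const_in_L0 A, of c] by simp
qed

context
  fixes f :: "'e \<Rightarrow> ('a \<Rightarrow> ereal) set"
  assumes f: "f \<in> carrier E \<rightarrow> L0 M"
begin

lemma diff_in_L0:
  assumes "g \<in> Tc_dual M E P" "x \<in> carrier E" "Y \<in> L0 M"
  shows "L0_diff M (L0_ereal M (g x)) Y \<in> L0 M"
    and "AE \<omega> in M. L0_rep (L0_diff M (L0_ereal M (g x)) Y) \<omega> = ereal (L0_rep (g x) \<omega>) - L0_rep Y \<omega>"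
proof -
  have gx: "g x \<in> L0 M" by (rule dual_in_L0[OF assms(1,2)])
  show "L0_diff M (L0_ereal M (g x)) Y \<in> L0 M"
    by (intro L0_diff_ereal_in_L0 L0_ereal_in_L0 gx assms)
  show "AE \<omega> in M. L0_rep (L0_diff M (L0_ereal M (g x)) Y) \<omega> = ereal (L0_rep (g x) \<omega>) - L0_rep Y \<omega>"
    using L0_rep_diff_ereal[OF L0_ereal_in_L0[OF gx] assms(3)] L0_rep_ereal[OF gx]
    by eventually_elim simp
qed

lemma
  assumes g: "g \<in> Tc_dual M E P"
  shows conj_in_L0: "conj_c M E P f g \<in> L0 M"
    and conj_upper: "x \<in> carrier E \<Longrightarrow>
      AE \<omega> in M. ereal (L0_rep (g x) \<omega>) - L0_rep (f x) \<omega> \<le> L0_rep (conj_c M E P f g) \<omega>"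
    and conj_least: "v \<in> borel_measurable M \<Longrightarrow>
      (\<And>x. x \<in> carrier E \<Longrightarrow> AE \<omega> in M. ereal (L0_rep (g x) \<omega>) - L0_rep (f x) \<omega> \<le> v \<omega>) \<Longrightarrow>
      AE \<omega> in M. L0_rep (conj_c M E P f g) \<omega> \<le> v \<omega>"
proof -
  let ?X = "{L0_diff M (L0_ereal M (g x)) (f x) | x. x \<in> carrier E}"
  have X: "?X \<subseteq> L0 M" using diff_in_L0(1)[OF g] f by auto
  have eq: "conj_c M E P f g = \<Squnion>\<^bsub>L0_order M\<^esub> ?X" using g by (simp add: conj_c_def)
  show "conj_c M E P f g \<in> L0 M" unfolding eq by (rule L0_sup_in_L0[OF X])
  show "AE \<omega> in M. ereal (L0_rep (g x) \<omega>) - L0_rep (f x) \<omega> \<le> L0_rep (conj_c M E P f g) \<omega>"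
    if x: "x \<in> carrier E"
  proof -
    have "L0_diff M (L0_ereal M (g x)) (f x) \<in> ?X" using x by blast
    from L0_sup_upper[OF X this] diff_in_L0(2)[OF g x funcset_mem[OF f x]] show ?thesis
      unfolding eq by eventually_elim simp
  qed
  show "AE \<omega> in M. L0_rep (conj_c M E P f g) \<omega> \<le> v \<omega>"
    if v: "v \<in> borel_measurable M" and le: "\<And>x. x \<in> carrier E \<Longrightarrow> AE \<omega> in M. ereal (L0_rep (g x) \<omega>) - L0_rep (f x) \<omega> \<le> v \<omega>"
    unfolding eq
  proof (rule L0_sup_least[OF X v])
    fix Y assume "Y \<in> ?X"
    then obtain x where x: "x \<in> carrier E" and Y: "Y = L0_diff M (L0_ereal M (g x)) (f x)" by auto
    from le[OF x] diff_in_L0(2)[OF g x funcset_mem[OF f x]] show "AE \<omega> in M. L0_rep Y \<omega> \<le> v \<omega>"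
      unfolding Y by eventually_elim simp
  qed
qed

lemma
  assumes x: "x \<in> carrier E"
  shows biconj_in_L0: "biconj_c M E P f x \<in> L0 M"
    and biconj_upper: "g \<in> Tc_dual M E P \<Longrightarrow>
      AE \<omega> in M. ereal (L0_rep (g x) \<omega>) - L0_rep (conj_c M E P f g) \<omega> \<le> L0_rep (biconj_c M E P f x) \<omega>"
    and biconj_least: "v \<in> borel_measurable M \<Longrightarrow>
      (\<And>g. g \<in> Tc_dual M E P \<Longrightarrow> AE \<omega> in M. ereal (L0_rep (g x) \<omega>) - L0_rep (conj_c M E P f g) \<omega> \<le> v \<omega>) \<Longrightarrow>
      AE \<omega> in M. L0_rep (biconj_c M E P f x) \<omega> \<le> v \<omega>"
proof -
  let ?X = "{L0_diff M (L0_ereal M (g x)) (conj_c M E P f g) | g. g \<in> Tc_dual M E P}"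
  have X: "?X \<subseteq> L0 M" using diff_in_L0(1)[OF _ x conj_in_L0] by auto
  have eq: "biconj_c M E P f x = \<Squnion>\<^bsub>L0_order M\<^esub> ?X" using x by (simp add: biconj_c_def)
  show "biconj_c M E P f x \<in> L0 M" unfolding eq by (rule L0_sup_in_L0[OF X])
  show "AE \<omega> in M. ereal (L0_rep (g x) \<omega>) - L0_rep (conj_c M E P f g) \<omega> \<le> L0_rep (biconj_c M E P f x) \<omega>"
    if g: "g \<in> Tc_dual M E P"
  proof -
    have "L0_diff M (L0_ereal M (g x)) (conj_c M E P f g) \<in> ?X" using g by blast
    from L0_sup_upper[OF X this] diff_in_L0(2)[OF g x conj_in_L0[OF g]] show ?thesis
      unfolding eq by eventually_elim simp
  qed
  show "AE \<omega> in M. L0_rep (biconj_c M E P f x) \<omega> \<le> v \<omega>"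
    if v: "v \<in> borel_measurable M" and le: "\<And>g. g \<in> Tc_dual M E P \<Longrightarrow>
      AE \<omega> in M. ereal (L0_rep (g x) \<omega>) - L0_rep (conj_c M E P f g) \<omega> \<le> v \<omega>"
    unfolding eq
  proof (rule L0_sup_least[OF X v])
    fix Y assume "Y \<in> ?X"
    then obtain g where g: "g \<in> Tc_dual M E P" and Y: "Y = L0_diff M (L0_ereal M (g x)) (conj_c M E P f g)" by auto
    from le[OF g] diff_in_L0(2)[OF g x conj_in_L0[OF g]] show "AE \<omega> in M. L0_rep Y \<omega> \<le> v \<omega>"
      unfolding Y by eventually_elim simp
  qed
qed

lemma biconj_funcset: "biconj_c M E P f \<in> carrier E \<rightarrow> L0 M"
  using biconj_in_L0 by auto

lemma biconj_measurable: "x \<in> carrier E \<Longrightarrow> L0_rep (biconj_c M E P f x) \<in> borel_measurable M"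
  by (intro L0_rep_measurable biconj_in_L0)

text \<open>A supremum can be tested on one event: off \<open>A\<close> the bound is raised to
  \<open>\<infinity>\<close>.\<close>

lemma biconj_least_on:
  assumes x: "x \<in> carrier E" and A: "A \<in> sets M" and v: "v \<in> borel_measurable M"
    and le: "\<And>g. g \<in> Tc_dual M E P \<Longrightarrow>
      AE \<omega>\<in>A in M. ereal (L0_rep (g x) \<omega>) - L0_rep (conj_c M E P f g) \<omega> \<le> v \<omega>"
  shows "AE \<omega>\<in>A in M. L0_rep (biconj_c M E P f x) \<omega> \<le> v \<omega>"
proof -
  have "AE \<omega> in M. L0_rep (biconj_c M E P f x) \<omega> \<le> (if \<omega> \<in> A then v \<omega> else \<infinity>)"
  proof (rule biconj_least[OF x])
    show "(\<lambda>\<omega>. if \<omega> \<in> A then v \<omega> else \<infinity>) \<in> borel_measurable M"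
      using A v by (intro measurable_If_set) auto
    show "AE \<omega> in M. ereal (L0_rep (g x) \<omega>) - L0_rep (conj_c M E P f g) \<omega> \<le> (if \<omega> \<in> A then v \<omega> else \<infinity>)"
      if "g \<in> Tc_dual M E P" for g
      using le[OF that] by eventually_elim auto
  qed
  then show ?thesis by eventually_elim auto
qed

text \<open>This is the Fenchel-Young inequality. If \<open>f x\<close> is
  \<open>-\<infinity>\<close> at a point, the conjugate is \<open>\<infinity>\<close> there and the
  affine term drops to \<open>-\<infinity>\<close> as well.\<close>

lemma biconj_le:
  assumes x: "x \<in> carrier E"
  shows "AE \<omega> in M. L0_rep (biconj_c M E P f x) \<omega> \<le> L0_rep (f x) \<omega>"
proof (rule biconj_least[OF x])
  show "L0_rep (f x) \<in> borel_measurable M" by (rule L0_rep_measurable[OF funcset_mem[OF f x]])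
  show "AE \<omega> in M. ereal (L0_rep (g x) \<omega>) - L0_rep (conj_c M E P f g) \<omega> \<le> L0_rep (f x) \<omega>"
    if g: "g \<in> Tc_dual M E P" for g
    using conj_upper[OF g x]
  proof eventually_elim
    case (elim \<omega>)
    then show ?case
      by (cases "L0_rep (f x) \<omega>"; cases "L0_rep (conj_c M E P f g) \<omega>") auto
  qed
qed

section \<open>Closedness of the biconjugate\<close>

lemma biconj_convex:
  assumes x: "x \<in> carrier E" and y: "y \<in> carrier E" and u [measurable]: "u \<in> borel_measurable M"
    and u01: "\<And>\<omega>. 0 \<le> u \<omega>" "\<And>\<omega>. u \<omega> \<le> 1"
  shows "AE \<omega> in M. L0_rep (biconj_c M E P f (sc u x \<oplus>\<^bsub>E\<^esub> sc (\<lambda>\<omega>. 1 - u \<omega>) y)) \<omega> \<le>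
    ereal (u \<omega>) * L0_rep (biconj_c M E P f x) \<omega> + ereal (1 - u \<omega>) * L0_rep (biconj_c M E P f y) \<omega>"
    (is "AE \<omega> in M. _ \<le> ?v \<omega>")
proof (rule biconj_least)
  show "sc u x \<oplus>\<^bsub>E\<^esub> sc (\<lambda>\<omega>. 1 - u \<omega>) y \<in> carrier E" using x y by simp
  note [measurable] = biconj_measurable[OF x] biconj_measurable[OF y]
  show "?v \<in> borel_measurable M" by measurable
  fix g assume g: "g \<in> Tc_dual M E P"
  have "AE \<omega> in M. L0_rep (g (sc (\<lambda>\<omega>. 1 - u \<omega>) y)) \<omega> = (1 - u \<omega>) * L0_rep (g y) \<omega>"
    by (rule dual_sc[OF g y]) measurable
  moreover have "AE \<omega> in M. L0_rep (g (sc u x \<oplus>\<^bsub>E\<^esub> sc (\<lambda>\<omega>. 1 - u \<omega>) y)) \<omega> =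
      L0_rep (g (sc u x)) \<omega> + L0_rep (g (sc (\<lambda>\<omega>. 1 - u \<omega>) y)) \<omega>"
    using x y by (intro dual_add[OF g]) auto
  moreover note dual_sc[OF g x u] biconj_upper[OF x g] biconj_upper[OF y g]
  ultimately show "AE \<omega> in M. ereal (L0_rep (g (sc u x \<oplus>\<^bsub>E\<^esub> sc (\<lambda>\<omega>. 1 - u \<omega>) y)) \<omega>) -
      L0_rep (conj_c M E P f g) \<omega> \<le> ?v \<omega>"
  proof eventually_elim
    case (elim \<omega>)
    let ?X = "L0_rep (biconj_c M E P f x) \<omega>" and ?Y = "L0_rep (biconj_c M E P f y) \<omega>"
    let ?c = "L0_rep (conj_c M E P f g) \<omega>" and ?u = "u \<omega>"
    have eq: "L0_rep (g (sc u x \<oplus>\<^bsub>E\<^esub> sc (\<lambda>\<omega>. 1 - u \<omega>) y)) \<omega> =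
      ?u * L0_rep (g x) \<omega> + (1 - ?u) * L0_rep (g y) \<omega>" using elim by simp
    show ?case
    proof (cases ?c)
      case PInf
      then show ?thesis by simp
    next
      case MInf
      \<comment> \<open>A conjugate value \<open>-\<infinity>\<close> makes the biconjugate infinite
        at both \<open>x\<close> and \<open>y\<close>; one of the two weights is positive, so the
        right-hand side is \<open>\<infinity>\<close>.\<close>
      then have X: "?X = \<infinity>" "?Y = \<infinity>" using elim by auto
      show ?thesis
      proof (cases "?u = 0")
        case True
        then show ?thesis by (simp add: X)
      next
        case False
        then have "0 < ?u" using u01(1)[of \<omega>] by simp
        then show ?thesis by (simp add: X)
      qed
    next
      case (real c)
      have "ereal ?u * ereal (L0_rep (g x) \<omega> - c) \<le> ereal ?u * ?X"
        using elim u01[of \<omega>] real by (intro ereal_mult_left_mono) auto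
      moreover have "ereal (1 - ?u) * ereal (L0_rep (g y) \<omega> - c) \<le> ereal (1 - ?u) * ?Y"
        using elim u01[of \<omega>] real by (intro ereal_mult_left_mono) auto
      ultimately have "ereal ?u * ereal (L0_rep (g x) \<omega> - c) + ereal (1 - ?u) * ereal (L0_rep (g y) \<omega> - c)
          \<le> ereal ?u * ?X + ereal (1 - ?u) * ?Y" by (rule add_mono)
      moreover have "ereal ?u * ereal (L0_rep (g x) \<omega> - c) + ereal (1 - ?u) * ereal (L0_rep (g y) \<omega> - c) =
          ereal (?u * L0_rep (g x) \<omega> + (1 - ?u) * L0_rep (g y) \<omega>) - ereal c"
        by (simp add: algebra_simps)
      ultimately show ?thesis unfolding eq real by simp
    qed
  qed
qed

text \<open>Each \<open>g\<close> is local by homogeneity for indicators, and the supremum can be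
  tested on \<open>A\<close>.\<close>

lemma biconj_local: "L0_local M E (biconj_c M E P f)"
  unfolding L0_local_def
proof (intro ballI)
  fix x A assume x: "x \<in> carrier E" and A [measurable]: "A \<in> sets M"
  let ?F = "biconj_c M E P f" and ?x = "sc (indicator A) x"
  have x': "?x \<in> carrier E" using x by simp
  have g: "AE \<omega>\<in>A in M. L0_rep (g ?x) \<omega> = L0_rep (g x) \<omega>" if "g \<in> Tc_dual M E P" for g
    using dual_sc[OF that x, of "indicator A"] by (auto elim!: eventually_mono)
  have "AE \<omega>\<in>A in M. L0_rep (?F x) \<omega> \<le> L0_rep (?F ?x) \<omega>"
  proof (rule biconj_least_on[OF x A biconj_measurable[OF x']])
    fix h assume h: "h \<in> Tc_dual M E P"
    from g[OF h] biconj_upper[OF x' h]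
    show "AE \<omega>\<in>A in M. ereal (L0_rep (h x) \<omega>) - L0_rep (conj_c M E P f h) \<omega> \<le> L0_rep (?F ?x) \<omega>"
      by eventually_elim auto
  qed
  moreover have "AE \<omega>\<in>A in M. L0_rep (?F ?x) \<omega> \<le> L0_rep (?F x) \<omega>"
  proof (rule biconj_least_on[OF x' A biconj_measurable[OF x]])
    fix h assume h: "h \<in> Tc_dual M E P"
    from g[OF h] biconj_upper[OF x h]
    show "AE \<omega>\<in>A in M. ereal (L0_rep (h ?x) \<omega>) - L0_rep (conj_c M E P f h) \<omega> \<le> L0_rep (?F x) \<omega>"
      by eventually_elim auto
  qed
  ultimately have "AE \<omega>\<in>A in M. L0_rep (?F x) \<omega> = L0_rep (?F ?x) \<omega>"
    by eventually_elim auto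
  then show "L0_mult M (L0_ind M A) (?F x) = L0_mult M (L0_ind M A) (?F (L0_ind M A \<odot>\<^bsub>E\<^esub> x))"
    unfolding ind_smult_eq_sc L0_ind_mult_eq_iff[OF biconj_in_L0[OF x] biconj_in_L0[OF x'] A] .
qed

text \<open>The value \<open>-\<infinity>\<close> at \<open>x\<close> forces the conjugate of every
  \<open>g\<close> to be \<open>\<infinity>\<close> on \<open>A\<close>, a condition in which
  \<open>x\<close> no longer occurs.\<close>

lemma biconj_minus_infinity:
  assumes x: "x \<in> carrier E" and y: "y \<in> carrier E" and A: "A \<in> sets M"
    and eq: "AE \<omega>\<in>A in M. L0_rep (biconj_c M E P f x) \<omega> = -\<infinity>"
  shows "AE \<omega>\<in>A in M. L0_rep (biconj_c M E P f y) \<omega> = -\<infinity>"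
proof -
  have "AE \<omega>\<in>A in M. L0_rep (biconj_c M E P f y) \<omega> \<le> -\<infinity>"
  proof (rule biconj_least_on[OF y A])
    fix g assume g: "g \<in> Tc_dual M E P"
    from eq biconj_upper[OF x g]
    show "AE \<omega>\<in>A in M. ereal (L0_rep (g y) \<omega>) - L0_rep (conj_c M E P f g) \<omega> \<le> -\<infinity>"
    proof eventually_elim
      case (elim \<omega>)
      then show ?case by (cases "L0_rep (conj_c M E P f g) \<omega>") auto
    qed
  qed simp
  then show ?thesis by eventually_elim auto
qed

text \<open>If \<open>(x, r)\<close> lies outside the epigraph, a single \<open>g\<close> already
  violates the inequality, and it does so by a constant margin \<open>2 * d\<close> on an event of
  positive probability. Half of the margin pays for moving \<open>x\<close>, half for moving
  \<open>r\<close>.\<close>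

lemma biconj_lsc:
  assumes D [measurable]: "D \<in> sets M" and pos: "measure M D > 0"
  shows "Tc_lsc (cond_base M D) (restr_module M D E) (restr_seminorms M D E P) (restr_fun M D E (biconj_c M E P f))"
proof -
  let ?F = "biconj_c M E P f"
  let ?C = "carrier (restr_module M D E)"
  let ?T = "Tc (cond_base M D) (restr_module M D E) (restr_seminorms M D E P)"
  let ?R = "Tc_L0 (cond_base M D)"
  let ?epi = "epi (cond_base M D) (restr_module M D E) (restr_fun M D E ?F)"
  note top = topspace_Tc_restr[OF D pos] topspace_Tc_L0
  note epi_iff = epi_restr_iff[OF D pos biconj_funcset]
  note AE_D = AE_cond_base[OF D pos]
  note sub = restr_carrier_subset[OF D pos]
  have "openin (prod_topology ?T ?R) (topspace (prod_topology ?T ?R) - ?epi)"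
    unfolding openin_prod_topology_alt
  proof (intro allI impI)
    fix x r assume "(x, r) \<in> topspace (prod_topology ?T ?R) - ?epi"
    then have x: "x \<in> ?C" and r: "r \<in> L0 (cond_base M D)"
      and nle: "\<not> (AE \<omega>\<in>D in M. L0_rep (?F x) \<omega> \<le> ereal (L0_rep r \<omega>))"
      by (auto simp: top epi_iff)
    define r' where "r' = (\<lambda>\<omega>. if \<omega> \<in> D then L0_rep r \<omega> else 0)"
    have r' [measurable]: "r' \<in> borel_measurable M"
      unfolding r'_def by (rule measurable_extend[OF D pos L0_rep_measurable[OF r]])
    have "\<exists>g\<in>Tc_dual M E P. \<not> (AE \<omega>\<in>D in M.
        ereal (L0_rep (g x) \<omega>) - L0_rep (conj_c M E P f g) \<omega> \<le> ereal (r' \<omega>))"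
    proof (rule ccontr)
      assume "\<not> ?thesis"
      then have "AE \<omega>\<in>D in M. L0_rep (?F x) \<omega> \<le> ereal (r' \<omega>)"
        by (intro biconj_least_on[OF sub[OF x] D]) auto
      then have "AE \<omega>\<in>D in M. L0_rep (?F x) \<omega> \<le> ereal (L0_rep r \<omega>)"
        by eventually_elim (auto simp: r'_def)
      with nle show False ..
    qed
    then obtain g where g: "g \<in> Tc_dual M E P" and g_nle: "\<not> (AE \<omega>\<in>D in M.
        ereal (L0_rep (g x) \<omega>) - L0_rep (conj_c M E P f g) \<omega> \<le> ereal (r' \<omega>))" by blast
    let ?c = "L0_rep (conj_c M E P f g)"
    \<comment> \<open>If no margin \<open>2 / Suc n\<close> worked, all these inequalities would
      hold off one null set, and letting \<open>n\<close> grow would give the inequality without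
      margin.\<close>
    have "\<exists>n::nat. \<not> (AE \<omega>\<in>D in M.
        ereal (L0_rep (g x) \<omega>) - ?c \<omega> \<le> ereal (r' \<omega> + 2 / real (Suc n)))"
    proof (rule ccontr)
      assume "\<not> ?thesis"
      then have "AE \<omega> in M. \<forall>n::nat. \<omega> \<in> D \<longrightarrow> ereal (L0_rep (g x) \<omega>) - ?c \<omega> \<le> ereal (r' \<omega> + 2 / real (Suc n))"
        by (subst AE_all_countable) auto
      then have "AE \<omega>\<in>D in M. ereal (L0_rep (g x) \<omega>) - ?c \<omega> \<le> ereal (r' \<omega>)"
      proof eventually_elim
        case (elim \<omega>)
        show ?case
        proof
          assume "\<omega> \<in> D"
          with elim have le: "ereal (L0_rep (g x) \<omega>) - ?c \<omega> \<le> ereal (r' \<omega> + 2 / real (Suc n))" for n by blast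
          have "(\<lambda>n. ereal (r' \<omega> + 2 / real (Suc n))) \<longlonglongrightarrow> ereal (r' \<omega> + 0)"
            by (intro tendsto_intros LIMSEQ_Suc[OF lim_const_over_n])
          then show "ereal (L0_rep (g x) \<omega>) - ?c \<omega> \<le> ereal (r' \<omega>)"
            using le by (intro LIMSEQ_le_const[where X = "\<lambda>n. ereal (r' \<omega> + 2 / real (Suc n))"]) auto
        qed
      qed
      with g_nle show False ..
    qed
    then obtain n :: nat where n: "\<not> (AE \<omega>\<in>D in M.
        ereal (L0_rep (g x) \<omega>) - ?c \<omega> \<le> ereal (r' \<omega> + 2 / real (Suc n)))" ..
    define d where "d = 1 / real (Suc n)"
    have d: "0 < d" and d2: "2 * d = 2 / real (Suc n)" by (simp_all add: d_def)
    have d_nle: "\<not> (AE \<omega>\<in>D in M. ereal (L0_rep (g x) \<omega>) - ?c \<omega> \<le> ereal (r' \<omega> + 2 * d))"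
      using n unfolding d2 .
    define U where "U = {y \<in> ?C. AE \<omega>\<in>D in M. \<bar>L0_rep (g y) \<omega> - L0_rep (g x) \<omega>\<bar> < d}"
    define V where "V = {s \<in> L0 (cond_base M D). AE \<omega>\<in>D in M. \<bar>L0_rep s \<omega> - L0_rep r \<omega>\<bar> < d}"
    have g_meas: "L0_rep (g y) \<in> borel_measurable M" if "y \<in> carrier E" for y
      by (intro L0_rep_measurable dual_in_L0[OF g] that)
    have "openin ?T U" unfolding openin_Tc_restr[OF D pos]
    proof (intro conjI ballI)
      show "U \<subseteq> ?C" by (auto simp: U_def)
      fix y assume "y \<in> U"
      then have y: "y \<in> ?C" and lt: "AE \<omega>\<in>D in M. \<bar>L0_rep (g y) \<omega> - L0_rep (g x) \<omega>\<bar> < d"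
        by (auto simp: U_def)
      \<comment> \<open>The room left before the margin \<open>d\<close> is used up. The default 1
        keeps the radius positive where the bound, known only a.s. on \<open>D\<close>, may
        fail.\<close>
      define e where "e = (\<lambda>\<omega>. if \<bar>L0_rep (g y) \<omega> - L0_rep (g x) \<omega>\<bar> < d
          then d - \<bar>L0_rep (g y) \<omega> - L0_rep (g x) \<omega>\<bar> else 1)"
      note [measurable] = g_meas[OF sub[OF x]] g_meas[OF sub[OF y]]
      have e: "e \<in> borel_measurable M" "\<And>\<omega>. 0 < e \<omega>" unfolding e_def by measurable
      from dual_continuous[OF g sub[OF y] e] obtain Q \<epsilon> where
        Q: "finite Q \<and> Q \<noteq> {} \<and> Q \<subseteq> P \<and> \<epsilon> \<in> borel_measurable M \<and> (\<forall>\<omega>. 0 < \<epsilon> \<omega>)"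
        and ball: "\<forall>z\<in>carrier E. (\<forall>N\<in>Q. AE \<omega> in M. L0_rep (N (z \<ominus>\<^bsub>E\<^esub> y)) \<omega> \<le> \<epsilon> \<omega>) \<longrightarrow>
          (AE \<omega> in M. \<bar>L0_rep (g z) \<omega> - L0_rep (g y) \<omega>\<bar> < e \<omega>)" by (elim exE conjE) simp
      have "z \<in> U" if z: "z \<in> ?C" and le: "\<forall>N\<in>Q. AE \<omega>\<in>D in M. L0_rep (N (z \<ominus>\<^bsub>E\<^esub> y)) \<omega> \<le> \<epsilon> \<omega>" for z
      proof -
        have zy: "z \<ominus>\<^bsub>E\<^esub> y \<in> ?C" by (rule restr_minus_closed[OF D pos z y])
        \<comment> \<open>The difference of \<open>z\<close> and \<open>y\<close> is supported in
          \<open>D\<close>, so its seminorms vanish a.s. elsewhere and an inequality on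
          \<open>D\<close> extends to the whole space. This lets the continuity of \<open>g\<close>
          on \<open>E\<close> act on the restricted module.\<close>
        have "AE \<omega> in M. L0_rep (N (z \<ominus>\<^bsub>E\<^esub> y)) \<omega> \<le> \<epsilon> \<omega>" if N: "N \<in> Q" for N
        proof -
          have "sc (indicator D) (z \<ominus>\<^bsub>E\<^esub> y) = z \<ominus>\<^bsub>E\<^esub> y" using zy by (simp add: restr_carrier_iff[OF D pos])
          with seminorm_sc[of N "z \<ominus>\<^bsub>E\<^esub> y" "indicator D"] Q N sub[OF zy]
          have "AE \<omega> in M. L0_rep (N (z \<ominus>\<^bsub>E\<^esub> y)) \<omega> = \<bar>indicator D \<omega>\<bar> * L0_rep (N (z \<ominus>\<^bsub>E\<^esub> y)) \<omega>" by auto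
          with le[rule_format, OF N] show ?thesis
          proof eventually_elim
            case (elim \<omega>)
            have "0 < \<epsilon> \<omega>" using Q by blast
            with elim show ?case by (cases "\<omega> \<in> D") auto
          qed
        qed
        with ball sub[OF z] have "AE \<omega> in M. \<bar>L0_rep (g z) \<omega> - L0_rep (g y) \<omega>\<bar> < e \<omega>" by blast
        with lt have "AE \<omega>\<in>D in M. \<bar>L0_rep (g z) \<omega> - L0_rep (g x) \<omega>\<bar> < d"
          by eventually_elim (auto simp: e_def)
        with z show ?thesis by (simp add: U_def)
      qed
      with Q show "\<exists>Q \<epsilon>. finite Q \<and> Q \<noteq> {} \<and> Q \<subseteq> P \<and> \<epsilon> \<in> borel_measurable M \<and> (\<forall>\<omega>. 0 < \<epsilon> \<omega>) \<and>
        (\<forall>z\<in>?C. (\<forall>N\<in>Q. AE \<omega>\<in>D in M. L0_rep (N (z \<ominus>\<^bsub>E\<^esub> y)) \<omega> \<le> \<epsilon> \<omega>) \<longrightarrow> z \<in> U)" by blast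
    qed
    moreover have "openin ?R V" unfolding openin_Tc_L0
    proof (intro conjI ballI)
      show "V \<subseteq> L0 (cond_base M D)" by (auto simp: V_def)
      fix s assume "s \<in> V"
      then have s: "s \<in> L0 (cond_base M D)" and lt: "AE \<omega>\<in>D in M. \<bar>L0_rep s \<omega> - L0_rep r \<omega>\<bar> < d"
        by (auto simp: V_def)
      note [measurable] = L0_rep_measurable[OF s] L0_rep_measurable[OF r]
      let ?e = "\<lambda>\<omega>. if \<bar>L0_rep s \<omega> - L0_rep r \<omega>\<bar> < d then (d - \<bar>L0_rep s \<omega> - L0_rep r \<omega>\<bar>) / 2 else 1"
      show "\<exists>\<epsilon>. \<epsilon> \<in> borel_measurable (cond_base M D) \<and> (\<forall>\<omega>. 0 < \<epsilon> \<omega>) \<and>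
        (\<forall>Y\<in>L0 (cond_base M D). (AE \<omega> in cond_base M D. \<bar>L0_rep Y \<omega> - L0_rep s \<omega>\<bar> \<le> \<epsilon> \<omega>) \<longrightarrow> Y \<in> V)"
      proof (intro exI[of _ ?e] conjI ballI impI)
        show "?e \<in> borel_measurable (cond_base M D)" by measurable
        fix Y assume Y: "Y \<in> L0 (cond_base M D)" and "AE \<omega> in cond_base M D. \<bar>L0_rep Y \<omega> - L0_rep s \<omega>\<bar> \<le> ?e \<omega>"
        then have "AE \<omega>\<in>D in M. \<bar>L0_rep Y \<omega> - L0_rep s \<omega>\<bar> \<le> ?e \<omega>" unfolding AE_D by simp
        with lt have "AE \<omega>\<in>D in M. \<bar>L0_rep Y \<omega> - L0_rep r \<omega>\<bar> < d"
          by eventually_elim (auto simp: abs_if split: if_splits)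
        with Y show "Y \<in> V" by (simp add: V_def)
      qed auto
    qed
    moreover have "x \<in> U" "r \<in> V" using x r d by (simp_all add: U_def V_def)
    moreover have "U \<times> V \<subseteq> topspace (prod_topology ?T ?R) - ?epi"
    proof safe
      fix y s assume y: "y \<in> U" and s: "s \<in> V"
      then show "(y, s) \<in> topspace (prod_topology ?T ?R)" by (simp add: top U_def V_def)
      assume "(y, s) \<in> ?epi"
      then have yC: "y \<in> ?C" and le: "AE \<omega>\<in>D in M. L0_rep (?F y) \<omega> \<le> ereal (L0_rep s \<omega>)"
        by (simp_all add: epi_iff)
      have "AE \<omega>\<in>D in M. \<bar>L0_rep (g y) \<omega> - L0_rep (g x) \<omega>\<bar> < d" using y by (simp add: U_def)
      moreover have "AE \<omega>\<in>D in M. \<bar>L0_rep s \<omega> - L0_rep r \<omega>\<bar> < d" using s by (simp add: V_def)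
      moreover note le biconj_upper[OF sub[OF yC] g]
      ultimately have "AE \<omega>\<in>D in M. ereal (L0_rep (g x) \<omega>) - ?c \<omega> \<le> ereal (r' \<omega> + 2 * d)"
      proof eventually_elim
        case (elim \<omega>)
        show ?case
        proof
          assume D: "\<omega> \<in> D"
          then have "ereal (L0_rep (g y) \<omega>) - ?c \<omega> \<le> ereal (L0_rep s \<omega>)" using elim by (meson order_trans)
          then show "ereal (L0_rep (g x) \<omega>) - ?c \<omega> \<le> ereal (r' \<omega> + 2 * d)"
            using D elim by (cases "?c \<omega>") (auto simp: r'_def)
        qed
      qed
      with d_nle show False ..
    qed
    ultimately show "\<exists>U V. openin ?T U \<and> openin ?R V \<and> x \<in> U \<and> r \<in> V \<and>
        U \<times> V \<subseteq> topspace (prod_topology ?T ?R) - ?epi" by blast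
  qed
  moreover have "?epi \<subseteq> topspace (prod_topology ?T ?R)"
    by (auto simp: top epi_iff)
  ultimately show ?thesis unfolding Tc_lsc_def closedin_def by simp
qed

lemma biconj_closed: "Tc_closed M E P (biconj_c M E P f)"
  unfolding Tc_closed_def
proof (intro conjI ballI impI)
  let ?F = "biconj_c M E P f"
  show "L0_local M E ?F" by (rule biconj_local)
  show "L0_mult M (L0_ind M (MI M E ?F)) (?F x) = L0_mult M (L0_ind M (MI M E ?F)) (L0_const M (-\<infinity>))"
    if x: "x \<in> carrier E" for x
  proof -
    let ?A = "{A \<in> sets M. \<exists>x\<in>carrier E. L0_mult M (L0_ind M A) (?F x) = L0_mult M (L0_ind M A) (L0_const M (-\<infinity>))}"
    let ?S = "{\<omega> \<in> space M. L0_rep (?F x) \<omega> = -\<infinity>}"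
    have ess: "is_ess_Sup M ?A (MI M E ?F)" unfolding MI_def by (rule is_ess_Sup_ess_Sup_sets) auto
    note [measurable] = biconj_measurable[OF x]
    have S: "?S \<in> sets M" by measurable
    \<comment> \<open>The event \<open>?S\<close>, formed with one fixed \<open>x\<close>, absorbs
      every member of the family defining \<open>MI\<close>, hence also its essential
      supremum.\<close>
    have "AE \<omega>\<in>A in M. \<omega> \<in> ?S" if mem: "A \<in> ?A" for A
    proof -
      obtain y where y: "y \<in> carrier E" and A: "A \<in> sets M" and "L0_mult M (L0_ind M A) (?F y) = L0_mult M (L0_ind M A) (L0_const M (-\<infinity>))"
        using mem by auto
      then have "AE \<omega>\<in>A in M. L0_rep (?F y) \<omega> = -\<infinity>"
        unfolding ind_const_iff[OF biconj_funcset y A] by simp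
      from biconj_minus_infinity[OF y x A this] AE_space show ?thesis by eventually_elim auto
    qed
    with ess S have "AE \<omega>\<in>MI M E ?F in M. \<omega> \<in> ?S" unfolding is_ess_Sup_def by blast
    then show ?thesis unfolding ind_const_iff[OF biconj_funcset x MI_in_sets]
      by eventually_elim auto
  qed
  fix A assume A: "A \<in> sets M" and pos: "0 < measure M A"
  show "L0_convex (cond_base M A) (restr_module M A E) (restr_fun M A E ?F)"
    unfolding L0_convex_restr_iff[OF A pos biconj_funcset]
  proof (intro ballI impI)
    fix x y and u :: "'a \<Rightarrow> real" assume "x \<in> carrier (restr_module M A E)" "y \<in> carrier (restr_module M A E)"
      "u \<in> borel_measurable M" "\<forall>\<omega>. 0 \<le> u \<omega> \<and> u \<omega> \<le> 1"
    from biconj_convex[of x y u] this restr_carrier_subset[OF A pos]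
    show "AE \<omega>\<in>A in M. L0_rep (?F (sc u x \<oplus>\<^bsub>E\<^esub> sc (\<lambda>\<omega>. 1 - u \<omega>) y)) \<omega> \<le>
        ereal (u \<omega>) * L0_rep (?F x) \<omega> + ereal (1 - u \<omega>) * L0_rep (?F y) \<omega>"
      by (auto elim!: eventually_mono)
  qed
  show "Tc_lsc (cond_base M A) (restr_module M A E) (restr_seminorms M A E P) (restr_fun M A E ?F)"
    by (rule biconj_lsc[OF A pos])
qed

end

end

section \<open>Closed functions have Lipschitz minorants\<close>

context prob_space
begin

lemma measure_pos_iff: "A \<in> sets M \<Longrightarrow> 0 < measure M A \<longleftrightarrow> \<not> (AE \<omega> in M. \<omega> \<notin> A)"
  using prob_eq_0[of A] by (simp add: zero_less_measure_iff measure_nonneg less_le)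

text \<open>Countably many null parts cannot cover \<open>C\<close>. This replaces a random index
  \<open>n\<close> by a constant one on a smaller event.\<close>

lemma ex_pos_subset:
  fixes R :: "nat \<Rightarrow> 'a \<Rightarrow> bool"
  assumes C: "C \<in> sets M" "0 < measure M C" and R: "\<And>n. {\<omega> \<in> space M. R n \<omega>} \<in> sets M"
    and ex: "AE \<omega>\<in>C in M. (\<exists>n. R n \<omega>)"
  shows "\<exists>n. 0 < measure M (C \<inter> {\<omega> \<in> space M. R n \<omega>})"
proof (rule ccontr)
  assume "\<not> ?thesis"
  then have "AE \<omega> in M. \<omega> \<notin> C \<inter> {\<omega> \<in> space M. R n \<omega>}" for n
    using measure_pos_iff[OF sets.Int[OF C(1) R[of n]]] by blast
  then have "AE \<omega> in M. \<forall>n. \<omega> \<notin> C \<inter> {\<omega> \<in> space M. R n \<omega>}" by (subst AE_all_countable) blast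
  with ex AE_space have "AE \<omega> in M. \<omega> \<notin> C" by eventually_elim auto
  with measure_pos_iff[OF C(1)] C(2) show False by simp
qed

end

context rlc_module
begin

lemma seminorm_cong:
  assumes N: "N \<in> P" and x: "x \<in> carrier E" "y \<in> carrier E" and A: "A \<in> sets M"
    and eq: "sc (indicator A) x = sc (indicator A) y"
  shows "AE \<omega>\<in>A in M. L0_rep (N x) \<omega> = L0_rep (N y) \<omega>"
  using seminorm_sc[OF N x(1) indicator_borel_measurable[OF A]]
    seminorm_sc[OF N x(2) indicator_borel_measurable[OF A]]
  unfolding eq by eventually_elim auto

text \<open>The events may overlap and need not cover the space. They are made disjoint, and the
  uncovered rest is prepended as piece 0 with \<open>x\<close> as filler, so the \<open>n\<close>-th
  event sits at index \<open>Suc n\<close>.\<close>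

lemma concatenate:
  assumes cc: "countable_concatenation M E" and y: "\<And>n. y n \<in> carrier E" and x: "x \<in> carrier E"
    and A: "\<And>n. A n \<in> sets M"
  shows "\<exists>z\<in>carrier E. \<forall>n. sc (indicator (disjointed A n)) z = sc (indicator (disjointed A n)) (y n)"
proof -
  define B where "B = case_nat (space M - (\<Union>n. A n)) (disjointed A)"
  have dA: "disjointed A n \<in> sets M" for n using sets.range_disjointed_sets[of A M] A by blast
  have dsub: "disjointed A n \<subseteq> (\<Union>n. A n)" for n using disjointed_subset[of A n] by auto
  have "range (case_nat x y) \<subseteq> carrier E" using x y by (auto split: nat.splits)
  moreover have "range B \<subseteq> sets M" using dA A unfolding B_def by (auto split: nat.splits)
  moreover have "disjoint_family B" unfolding disjoint_family_on_def
  proof (intro ballI impI)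
    fix m n :: nat assume "m \<noteq> n"
    then show "B m \<inter> B n = {}"
      using dsub[of "m - 1"] dsub[of "n - 1"] disjoint_family_disjointed[of A]
      by (cases m; cases n) (auto simp: B_def disjoint_family_on_def)
  qed
  moreover have "(\<Union>n. B n) = space M"
  proof -
    have "(\<Union>n. B n) = B 0 \<union> (\<Union>n. B (Suc n))" by (metis UNIV_nat_eq UN_insert image_image)
    also have "\<dots> = space M" using sets.sets_into_space[OF A] by (auto simp: B_def UN_disjointed_eq)
    finally show ?thesis .
  qed
  ultimately have "\<exists>z\<in>carrier E. \<forall>n. L0_ind M (B n) \<odot>\<^bsub>E\<^esub> z = L0_ind M (B n) \<odot>\<^bsub>E\<^esub> case_nat x y n"
    by (rule cc[unfolded countable_concatenation_def, rule_format])
  then obtain z where z: "z \<in> carrier E"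
    "\<And>n. L0_ind M (B n) \<odot>\<^bsub>E\<^esub> z = L0_ind M (B n) \<odot>\<^bsub>E\<^esub> case_nat x y n"
    by blast
  have "sc (indicator (disjointed A n)) z = sc (indicator (disjointed A n)) (y n)" for n
    using z(2)[of "Suc n"] by (simp add: ind_smult_eq_sc B_def)
  with z(1) show ?thesis by blast
qed

section \<open>Closed functions on an event where they are proper\<close>

context
  fixes h :: "'e \<Rightarrow> ('a \<Rightarrow> ereal) set"
  assumes h: "h \<in> carrier E \<rightarrow> L0 M" and closed: "Tc_closed M E P h"
begin

lemma closed_local: "L0_local M E h"
  using closed by (simp add: Tc_closed_def)

lemma closed_measurable: "x \<in> carrier E \<Longrightarrow> L0_rep (h x) \<in> borel_measurable M"
  by (rule L0_rep_measurable[OF funcset_mem[OF h]])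

text \<open>The event where \<open>h x\<close> is \<open>-\<infinity>\<close> belongs to the family
  whose essential supremum is \<open>MI\<close>, and \<open>BP\<close> excludes
  \<open>MI\<close>.\<close>

lemma closed_not_MInf:
  assumes x: "x \<in> carrier E"
  shows "AE \<omega>\<in>BP M E h in M. L0_rep (h x) \<omega> \<noteq> -\<infinity>"
proof -
  let ?A = "{A \<in> sets M. \<exists>x\<in>carrier E. L0_mult M (L0_ind M A) (h x) = L0_mult M (L0_ind M A) (L0_const M (-\<infinity>))}"
  let ?S = "{\<omega> \<in> space M. L0_rep (h x) \<omega> = -\<infinity>}"
  note [measurable] = closed_measurable[OF x]
  have S: "?S \<in> sets M" by measurable
  have "?S \<in> ?A" using S ind_const_iff[OF h x S, of "-\<infinity>"] x by auto
  moreover have "is_ess_Sup M ?A (MI M E h)" unfolding MI_def by (rule is_ess_Sup_ess_Sup_sets) auto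
  ultimately have "AE \<omega>\<in>?S in M. \<omega> \<in> MI M E h" unfolding is_ess_Sup_def by blast
  with AE_space show ?thesis by eventually_elim (auto simp: BP_def)
qed

context
  fixes C :: "'a set" and y0 :: 'e
  assumes C [measurable]: "C \<in> sets M" and pos: "0 < measure M C" and C_BP: "C \<subseteq> BP M E h"
    and y0: "y0 \<in> carrier E" and fin: "AE \<omega>\<in>C in M. L0_rep (h y0) \<omega> < \<infinity>"
begin

text \<open>Within \<open>BP\<close>, closedness yields convexity and lower semicontinuity only on
  events where the restriction is proper. \<open>C \<subseteq> BP\<close> excludes the value
  \<open>-\<infinity>\<close>, and \<open>y0\<close> provides the point of finiteness.\<close>

lemma closed_restr:
  shows "L0_convex (cond_base M C) (restr_module M C E) (restr_fun M C E h)"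
    and "Tc_lsc (cond_base M C) (restr_module M C E) (restr_seminorms M C E P) (restr_fun M C E h)"
proof -
  have "L0_proper (cond_base M C) (restr_module M C E) (restr_fun M C E h)"
    unfolding L0_proper_restr_iff[OF C pos h]
  proof (intro conjI ballI bexI)
    fix x assume "x \<in> carrier (restr_module M C E)"
    then have "x \<in> carrier E" by (rule restr_carrier_subset[OF C pos])
    from closed_not_MInf[OF this] show "AE \<omega>\<in>C in M. -\<infinity> < L0_rep (h x) \<omega>"
      by eventually_elim (use C_BP in auto)
  next
    show "sc (indicator C) y0 \<in> carrier (restr_module M C E)" by (rule sc_indicator_in_restr[OF C pos y0])
    show "AE \<omega>\<in>C in M. L0_rep (h (sc (indicator C) y0)) \<omega> < \<infinity>"
      using fin local_AE[OF h closed_local y0 C] by eventually_elim auto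
  qed
  with closed C pos C_BP show "L0_convex (cond_base M C) (restr_module M C E) (restr_fun M C E h)"
    and "Tc_lsc (cond_base M C) (restr_module M C E) (restr_seminorms M C E P) (restr_fun M C E h)"
    unfolding Tc_closed_def by blast+
qed

text \<open>Locality strips the indicators, so convexity on restricted vectors becomes convexity on
  \<open>C\<close> for all vectors of \<open>E\<close>.\<close>

lemma closed_convex:
  assumes x: "x \<in> carrier E" and y: "y \<in> carrier E" and u [measurable]: "u \<in> borel_measurable M"
    and u01: "\<And>\<omega>. 0 \<le> u \<omega>" "\<And>\<omega>. u \<omega> \<le> 1"
  shows "AE \<omega>\<in>C in M. L0_rep (h (sc u x \<oplus>\<^bsub>E\<^esub> sc (\<lambda>\<omega>. 1 - u \<omega>) y)) \<omega> \<le>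
    ereal (u \<omega>) * L0_rep (h x) \<omega> + ereal (1 - u \<omega>) * L0_rep (h y) \<omega>"
proof -
  let ?x = "sc (indicator C) x" and ?y = "sc (indicator C) y"
  have in_r: "?x \<in> carrier (restr_module M C E)" "?y \<in> carrier (restr_module M C E)"
    using x y by (simp_all add: sc_indicator_in_restr[OF C pos])
  have 1: "AE \<omega>\<in>C in M. L0_rep (h (sc u ?x \<oplus>\<^bsub>E\<^esub> sc (\<lambda>\<omega>. 1 - u \<omega>) ?y)) \<omega> \<le>
    ereal (u \<omega>) * L0_rep (h ?x) \<omega> + ereal (1 - u \<omega>) * L0_rep (h ?y) \<omega>"
    using closed_restr(1)[unfolded L0_convex_restr_iff[OF C pos h]] in_r u u01 by blast
  have "sc u ?x \<oplus>\<^bsub>E\<^esub> sc (\<lambda>\<omega>. 1 - u \<omega>) ?y = sc (indicator C) (sc u x \<oplus>\<^bsub>E\<^esub> sc (\<lambda>\<omega>. 1 - u \<omega>) y)"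
    using x y by (simp add: sc_add_right sc_sc mult.commute)
  with local_AE[OF h closed_local _ C, of "sc u x \<oplus>\<^bsub>E\<^esub> sc (\<lambda>\<omega>. 1 - u \<omega>) y"] x y
  have "AE \<omega>\<in>C in M. L0_rep (h (sc u ?x \<oplus>\<^bsub>E\<^esub> sc (\<lambda>\<omega>. 1 - u \<omega>) ?y)) \<omega> =
      L0_rep (h (sc u x \<oplus>\<^bsub>E\<^esub> sc (\<lambda>\<omega>. 1 - u \<omega>) y)) \<omega>" by simp
  with 1 local_AE[OF h closed_local x C] local_AE[OF h closed_local y C] show ?thesis
    by eventually_elim auto
qed

text \<open>
  Lower semicontinuity only excludes that \<open>h y \<le> r\<close> holds on all of \<open>C\<close> for some \<open>y\<close> near \<open>x\<close>. If
  the events where single points \<open>y\<close> near \<open>x\<close> satisfy \<open>h y \<le> r\<close> exhausted \<open>C\<close>, concatenating countably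
  many such points would produce an excluded one; \<open>C'\<close> is what these events leave of \<open>C\<close>.
\<close>

lemma closed_ball:
  fixes r :: real
  assumes cc: "countable_concatenation M E" and x: "x \<in> carrier E"
    and lt: "AE \<omega>\<in>C in M. ereal r < L0_rep (h x) \<omega>"
  shows "\<exists>Q \<epsilon> C'. finite Q \<and> Q \<noteq> {} \<and> Q \<subseteq> P \<and> \<epsilon> \<in> borel_measurable M \<and> (\<forall>\<omega>. 0 < \<epsilon> \<omega>) \<and>
    C' \<in> sets M \<and> C' \<subseteq> C \<and> 0 < measure M C' \<and>
    (\<forall>y\<in>carrier E. AE \<omega>\<in>C' in M. sn Q (y \<ominus>\<^bsub>E\<^esub> x) \<omega> \<le> \<epsilon> \<omega> \<longrightarrow> ereal r < L0_rep (h y) \<omega>)"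
proof -
  let ?x = "sc (indicator C) x"
  have x': "?x \<in> carrier (restr_module M C E)" by (rule sc_indicator_in_restr[OF C pos x])
  have "\<not> (AE \<omega>\<in>C in M. L0_rep (h ?x) \<omega> \<le> ereal r)"
  proof
    assume "AE \<omega>\<in>C in M. L0_rep (h ?x) \<omega> \<le> ereal r"
    with lt local_AE[OF h closed_local x C] have "AE \<omega> in M. \<omega> \<notin> C" by eventually_elim auto
    with measure_pos_iff[OF C] pos show False by simp
  qed
  from Tc_lsc_restr_ball[OF C pos h closed_restr(2) x' borel_measurable_const this] obtain Q \<epsilon> where
    Q: "finite Q" "Q \<noteq> {}" "Q \<subseteq> P" and e [measurable]: "\<epsilon> \<in> borel_measurable M" and e0: "\<And>\<omega>. 0 < \<epsilon> \<omega>"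
    and ball: "\<And>y. y \<in> carrier (restr_module M C E) \<Longrightarrow>
      \<forall>N\<in>Q. AE \<omega>\<in>C in M. L0_rep (N (y \<ominus>\<^bsub>E\<^esub> ?x)) \<omega> \<le> \<epsilon> \<omega> \<Longrightarrow>
      \<not> (AE \<omega>\<in>C in M. L0_rep (h y) \<omega> \<le> ereal r)"
    by (elim exE conjE) simp
  \<comment> \<open>Nearness is tested with the sum \<open>sn Q\<close>, which bounds each seminorm
    of \<open>Q\<close>; a point glued together on these events will therefore lie in the ball given
    by lower semicontinuity.\<close>
  define A where "A = (\<lambda>y. {\<omega> \<in> space M. \<omega> \<in> C \<and> sn Q (y \<ominus>\<^bsub>E\<^esub> x) \<omega> \<le> \<epsilon> \<omega> \<and> L0_rep (h y) \<omega> \<le> ereal r})"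
  have A: "A y \<in> sets M" if y: "y \<in> carrier E" for y
  proof -
    have yx: "y \<ominus>\<^bsub>E\<^esub> x \<in> carrier E" using x y by simp
    note [measurable] = closed_measurable[OF y] sn_measurable[OF Q(1,3) yx]
    show ?thesis unfolding A_def by measurable
  qed
  have "A ` carrier E \<subseteq> sets M" using A by auto
  from ex_countable_ess_Union[OF this] obtain \<D> where
    D: "countable \<D>" "\<D> \<subseteq> A ` carrier E" "\<forall>B\<in>A ` carrier E. AE \<omega>\<in>B in M. \<omega> \<in> \<Union>\<D>" by auto
  from countable_subset_image[of \<D> A "carrier E"] D(1,2) obtain Y where
    Y: "countable Y" "Y \<subseteq> carrier E" "\<D> = A ` Y" by auto
  have S: "\<Union>\<D> \<in> sets M" using D(1,2) A by (intro sets.countable_Union) auto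
  have pos': "0 < measure M (C - \<Union>\<D>)"
  proof (rule ccontr)
    assume "\<not> ?thesis"
    then have cover: "AE \<omega> in M. \<omega> \<notin> C - \<Union>\<D>" using measure_pos_iff[of "C - \<Union>\<D>"] S C by blast
    have "Y \<noteq> {}"
    proof
      assume "Y = {}"
      then have "AE \<omega> in M. \<omega> \<notin> C" using cover Y(3) by simp
      with measure_pos_iff[OF C] pos show False by simp
    qed
    define y where "y = from_nat_into Y"
    have y: "y n \<in> carrier E" for n using from_nat_into[OF \<open>Y \<noteq> {}\<close>, of n] Y(2) by (auto simp: y_def)
    have rY: "range y = Y" unfolding y_def using range_from_nat_into[OF \<open>Y \<noteq> {}\<close> Y(1)] .
    have "\<exists>z\<in>carrier E. \<forall>n. sc (indicator (disjointed (\<lambda>n. A (y n)) n)) z =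
        sc (indicator (disjointed (\<lambda>n. A (y n)) n)) (y n)"
      by (rule concatenate[OF cc y x]) (rule A[OF y])
    then obtain z where z: "z \<in> carrier E"
      "\<And>n. sc (indicator (disjointed (\<lambda>n. A (y n)) n)) z = sc (indicator (disjointed (\<lambda>n. A (y n)) n)) (y n)"
      by blast
    let ?d = "disjointed (\<lambda>n. A (y n))"
    have d: "?d n \<in> sets M" for n using sets.range_disjointed_sets[of "\<lambda>n. A (y n)" M] A y by blast
    have zx: "z \<ominus>\<^bsub>E\<^esub> x \<in> carrier E" using z x by simp
    have eq_n: "AE \<omega> in M. \<forall>N\<in>Q. \<omega> \<in> ?d n \<longrightarrow> L0_rep (N (z \<ominus>\<^bsub>E\<^esub> x)) \<omega> = L0_rep (N (y n \<ominus>\<^bsub>E\<^esub> x)) \<omega>" for n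
    proof (rule sn_all[OF Q(1)])
      fix N assume N: "N \<in> Q"
      have "sc (indicator (?d n)) (z \<ominus>\<^bsub>E\<^esub> x) = sc (indicator (?d n)) (y n \<ominus>\<^bsub>E\<^esub> x)"
        using z x y[of n] d[of n] by (simp add: sc_minus_right indicator_borel_measurable)
      then show "AE \<omega>\<in>?d n in M. L0_rep (N (z \<ominus>\<^bsub>E\<^esub> x)) \<omega> = L0_rep (N (y n \<ominus>\<^bsub>E\<^esub> x)) \<omega>"
        using N Q(3) x y z d by (intro seminorm_cong) auto
    qed
    \<comment> \<open>On its piece \<open>z\<close> agrees with \<open>y n\<close>, and both the
      seminorms and \<open>h\<close> see nothing but that piece: the seminorms by homogeneity,
      \<open>h\<close> by locality.\<close>
    have on_n: "AE \<omega>\<in>?d n in M. sn Q (z \<ominus>\<^bsub>E\<^esub> x) \<omega> \<le> \<epsilon> \<omega> \<and> L0_rep (h z) \<omega> \<le> ereal r" for n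
      using eq_n[of n] local_cong[OF h closed_local z(1) y d z(2), of n]
    proof eventually_elim
      case (elim \<omega>)
      show ?case
      proof
        assume w: "\<omega> \<in> ?d n"
        then have "\<omega> \<in> A (y n)" using disjointed_subset[of "\<lambda>n. A (y n)" n] by auto
        moreover have "sn Q (z \<ominus>\<^bsub>E\<^esub> x) \<omega> = sn Q (y n \<ominus>\<^bsub>E\<^esub> x) \<omega>"
          unfolding sn_def using elim w by (intro sum.cong) auto
        ultimately show "sn Q (z \<ominus>\<^bsub>E\<^esub> x) \<omega> \<le> \<epsilon> \<omega> \<and> L0_rep (h z) \<omega> \<le> ereal r"
          using elim w by (simp add: A_def)
      qed
    qed
    have "AE \<omega> in M. \<forall>n. \<omega> \<in> ?d n \<longrightarrow> sn Q (z \<ominus>\<^bsub>E\<^esub> x) \<omega> \<le> \<epsilon> \<omega> \<and> L0_rep (h z) \<omega> \<le> ereal r"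
      by (subst AE_all_countable) (rule allI, rule on_n)
    with cover have on_C: "AE \<omega>\<in>C in M. sn Q (z \<ominus>\<^bsub>E\<^esub> x) \<omega> \<le> \<epsilon> \<omega> \<and> L0_rep (h z) \<omega> \<le> ereal r"
    proof eventually_elim
      case (elim \<omega>)
      have "\<Union>\<D> = (\<Union>n. ?d n)" unfolding UN_disjointed_eq Y(3) rY[symmetric] by simp
      with elim show ?case by blast
    qed
    \<comment> \<open>Cutting to \<open>C\<close> moves the glued point into the restricted module,
      where \<open>ball\<close> applies, and leaves \<open>h\<close> unchanged on
      \<open>C\<close>.\<close>
    let ?z = "sc (indicator C) z"
    have z': "?z \<in> carrier (restr_module M C E)" by (rule sc_indicator_in_restr[OF C pos z(1)])
    have "AE \<omega>\<in>C in M. L0_rep (N (?z \<ominus>\<^bsub>E\<^esub> ?x)) \<omega> \<le> \<epsilon> \<omega>" if N: "N \<in> Q" for N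
    proof -
      have "?z \<ominus>\<^bsub>E\<^esub> ?x = sc (indicator C) (z \<ominus>\<^bsub>E\<^esub> x)" using z(1) x by (simp add: sc_minus_right)
      then have "AE \<omega> in M. L0_rep (N (?z \<ominus>\<^bsub>E\<^esub> ?x)) \<omega> = \<bar>indicator C \<omega>\<bar> * L0_rep (N (z \<ominus>\<^bsub>E\<^esub> x)) \<omega>"
        using seminorm_sc[of N "z \<ominus>\<^bsub>E\<^esub> x" "indicator C"] zx N Q(3) by auto
      with seminorm_le_sn[OF Q(1,3) zx N] on_C show ?thesis by eventually_elim auto
    qed
    with ball[OF z'] have "\<not> (AE \<omega>\<in>C in M. L0_rep (h ?z) \<omega> \<le> ereal r)" by blast
    moreover have "AE \<omega>\<in>C in M. L0_rep (h ?z) \<omega> \<le> ereal r"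
      using on_C local_AE[OF h closed_local z(1) C] by eventually_elim auto
    ultimately show False ..
  qed
  show ?thesis
  proof (intro exI[of _ Q] exI[of _ \<epsilon>] exI[of _ "C - \<Union>\<D>"] conjI ballI)
    fix y assume y: "y \<in> carrier E"
    then have "AE \<omega> in M. \<omega> \<in> A y \<longrightarrow> \<omega> \<in> \<Union>\<D>" using D(3) by blast
    with AE_space show "AE \<omega> in M. \<omega> \<in> C - \<Union>\<D> \<longrightarrow> sn Q (y \<ominus>\<^bsub>E\<^esub> x) \<omega> \<le> \<epsilon> \<omega> \<longrightarrow> ereal r < L0_rep (h y) \<omega>"
      by eventually_elim (auto simp: A_def not_le)
  qed (use Q e e0 S C pos' in auto)
qed

end

end

end

text \<open>
  Here \<open>v = h y\<close>, \<open>p\<close> and \<open>p0\<close> are the distances from \<open>y\<close> to \<open>x\<close> and to \<open>y0\<close>, and \<open>h y0 \<le> n\<close>. The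
  weight \<open>d / (d + p0)\<close> moves \<open>y\<close> towards \<open>y0\<close> into the ball of radius \<open>d\<close>, where \<open>h > - n\<close>.
\<close>

lemma lipschitz_arith:
  fixes v p p0 d n m r :: real
  assumes d: "0 < d" and p: "0 \<le> p" and p0: "0 \<le> p0" and n: "0 \<le> n" and m: "0 \<le> m" and tri: "p0 \<le> p + m"
    and near: "p \<le> d \<Longrightarrow> r < v"
    and conv: "- n < d / (d + p0) * v + (1 - d / (d + p0)) * n"
  shows "r - (2 * n / d + (\<bar>r\<bar> + n + 2 * n / d * m) / d) * p \<le> v"
proof -
  let ?k = "2 * n / d" and ?c = "\<bar>r\<bar> + n + 2 * n / d * m"
  have k: "0 \<le> ?k" and c: "0 \<le> ?c" using d n m by simp_all
  \<comment> \<open>Clearing the denominator gives \<open>d * v > - n * d - 2 * n * p0\<close>; this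
    is where the slope \<open>2 * n / d\<close> comes from.\<close>
  have "- n * (d + p0) < (d / (d + p0) * v + (1 - d / (d + p0)) * n) * (d + p0)"
    using conv d p0 by (intro mult_strict_right_mono) auto
  also have "\<dots> = (d / (d + p0) * (d + p0)) * v + ((d + p0) - d / (d + p0) * (d + p0)) * n"
    by (simp only: algebra_simps)
  also have "\<dots> = d * v + p0 * n" using d p0 by simp
  finally have "- n - ?k * p0 < v" using d by (simp add: field_simps)
  moreover have "?k * p0 \<le> ?k * (p + m)" using tri k by (rule mult_left_mono)
  ultimately have v: "- n - ?k * p - ?k * m < v" by (simp add: distrib_left)
  show ?thesis
  proof (cases "p \<le> d")
    case True
    have "0 \<le> (?k + ?c / d) * p" using k c d p by (intro mult_nonneg_nonneg add_nonneg_nonneg) auto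
    with near[OF True] show ?thesis by linarith
  next
    case False
    \<comment> \<open>Beyond distance \<open>d\<close> a constant is at most \<open>p / d\<close>
      times itself. The constant \<open>?c\<close> collects \<open>\<bar>r\<bar>\<close>,
      \<open>n\<close> and the cost \<open>?k * m\<close> of changing the centre from
      \<open>y0\<close> to \<open>x\<close>, and is absorbed into the slope.\<close>
    have "?c / d * d \<le> ?c / d * p" using False c d by (intro mult_left_mono) auto
    moreover have "?c / d * d = ?c" using d by simp
    ultimately have "?c \<le> ?c / d * p" by linarith
    then show ?thesis using v by (simp add: distrib_right)
  qed
qed

section \<open>From two balls to a global Lipschitz bound\<close>

context rlc_module
begin

text \<open>Convexity forbids a steep descent away from \<open>y0\<close>: if \<open>h\<close> were
  too small at a distant \<open>y\<close>, then at a point of the segment close to \<open>y0\<close>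
  it would be at most \<open>- n\<close>, against the bound on the ball there. The ball around
  \<open>x\<close> handles the nearby \<open>y\<close>, so that the cone can have its apex at height
  \<open>r\<close>.\<close>

lemma closed_lipschitz_minorant:
  fixes r :: real
  assumes h: "h \<in> carrier E \<rightarrow> L0 M" and closed: "Tc_closed M E P h"
    and cc: "countable_concatenation M E"
    and C: "C \<in> sets M" "0 < measure M C" "C \<subseteq> BP M E h"
    and y0: "y0 \<in> carrier E" "AE \<omega>\<in>C in M. L0_rep (h y0) \<omega> < \<infinity>"
    and x: "x \<in> carrier E" and lt: "AE \<omega>\<in>C in M. ereal r < L0_rep (h x) \<omega>"
  shows "\<exists>Q K C'. finite Q \<and> Q \<noteq> {} \<and> Q \<subseteq> P \<and> 0 < K \<and> C' \<in> sets M \<and> C' \<subseteq> C \<and> 0 < measure M C' \<and>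
    (\<forall>y\<in>carrier E. AE \<omega>\<in>C' in M. ereal (r - K * sn Q (y \<ominus>\<^bsub>E\<^esub> x) \<omega>) \<le> L0_rep (h y) \<omega>)"
proof -
  note [measurable] = closed_measurable[OF h closed y0(1)]
  \<comment> \<open>A two-sided bound, so that one \<open>n\<close> serves both as upper bound for
    \<open>h\<close> at \<open>y0\<close> and, negated, as the level of the ball around
    \<open>y0\<close>.\<close>
  have "\<exists>n::nat. 0 < measure M (C \<inter> {\<omega> \<in> space M. - ereal n < L0_rep (h y0) \<omega> \<and> L0_rep (h y0) \<omega> \<le> ereal n})"
  proof (rule ex_pos_subset[OF C(1,2)])
    show "{\<omega> \<in> space M. - ereal (real n) < L0_rep (h y0) \<omega> \<and> L0_rep (h y0) \<omega> \<le> ereal (real n)} \<in> sets M" for n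
      by measurable
    from closed_not_MInf[OF h closed y0(1)] y0(2)
    show "AE \<omega>\<in>C in M. (\<exists>n. - ereal (real n) < L0_rep (h y0) \<omega> \<and> L0_rep (h y0) \<omega> \<le> ereal (real n))"
    proof eventually_elim
      case (elim \<omega>)
      show ?case
      proof
        assume w: "\<omega> \<in> C"
        with elim C(3) obtain v where v: "L0_rep (h y0) \<omega> = ereal v" by (cases "L0_rep (h y0) \<omega>") auto
        obtain n where "\<bar>v\<bar> < real n" using reals_Archimedean2 by blast
        then show "\<exists>n. - ereal (real n) < L0_rep (h y0) \<omega> \<and> L0_rep (h y0) \<omega> \<le> ereal (real n)"
          unfolding v by (intro exI[of _ n]) auto
      qed
    qed
  qed
  then obtain n where n: "0 < measure M (C \<inter> {\<omega> \<in> space M. - ereal (real n) < L0_rep (h y0) \<omega> \<and> L0_rep (h y0) \<omega> \<le> ereal (real n)})" ..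
  define C1 where "C1 = C \<inter> {\<omega> \<in> space M. - ereal (real n) < L0_rep (h y0) \<omega> \<and> L0_rep (h y0) \<omega> \<le> ereal (real n)}"
  have C1: "C1 \<in> sets M" "0 < measure M C1" "C1 \<subseteq> BP M E h" "C1 \<subseteq> C"
    using C n unfolding C1_def by auto
  have fin1: "AE \<omega>\<in>C1 in M. L0_rep (h y0) \<omega> < \<infinity>"
    and low1: "AE \<omega>\<in>C1 in M. ereal (- real n) < L0_rep (h y0) \<omega>"
    by (auto simp: C1_def intro!: AE_I2)
  from closed_ball[OF h closed C1(1-3) y0(1) fin1 cc y0(1) low1] obtain Q1 e1 C2 where
    Q1: "finite Q1" "Q1 \<subseteq> P" and e1: "e1 \<in> borel_measurable M" "\<And>\<omega>. 0 < e1 \<omega>"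
    and C2: "C2 \<in> sets M" "C2 \<subseteq> C1" "0 < measure M C2"
    and ball1: "\<And>y. y \<in> carrier E \<Longrightarrow> AE \<omega>\<in>C2 in M. sn Q1 (y \<ominus>\<^bsub>E\<^esub> y0) \<omega> \<le> e1 \<omega> \<longrightarrow>
      ereal (- real n) < L0_rep (h y) \<omega>"
    by (elim exE conjE) simp
  have C2': "C2 \<subseteq> BP M E h" using C2 C1 by auto
  have fin2: "AE \<omega>\<in>C2 in M. L0_rep (h y0) \<omega> < \<infinity>"
    using fin1 by eventually_elim (use C2(2) in auto)
  have lt2: "AE \<omega>\<in>C2 in M. ereal r < L0_rep (h x) \<omega>"
    using lt by eventually_elim (use C2(2) C1(4) in auto)
  from closed_ball[OF h closed C2(1,3) C2' y0(1) fin2 cc x lt2] obtain Q2 e2 C3 where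
    Q2: "finite Q2" "Q2 \<noteq> {}" "Q2 \<subseteq> P" and e2: "e2 \<in> borel_measurable M" "\<And>\<omega>. 0 < e2 \<omega>"
    and C3: "C3 \<in> sets M" "C3 \<subseteq> C2" "0 < measure M C3"
    and ball2: "\<And>y. y \<in> carrier E \<Longrightarrow> AE \<omega>\<in>C3 in M. sn Q2 (y \<ominus>\<^bsub>E\<^esub> x) \<omega> \<le> e2 \<omega> \<longrightarrow>
      ereal r < L0_rep (h y) \<omega>"
    by (elim exE conjE) simp
  define Q where "Q = Q1 \<union> Q2"
  have Q: "finite Q" "Q \<noteq> {}" "Q \<subseteq> P" using Q1 Q2 by (auto simp: Q_def)
  have Q12: "Q1 \<subseteq> Q" "Q2 \<subseteq> Q" by (auto simp: Q_def)
  \<comment> \<open>Enlarging the family enlarges the sum, so a ball for \<open>Q\<close> lies in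
    the balls for \<open>Q1\<close> and \<open>Q2\<close>.\<close>
  have sn_sub: "AE \<omega> in M. sn Q' z \<omega> \<le> sn Q z \<omega>" if "Q' \<subseteq> Q" "z \<in> carrier E" for Q' z
  proof -
    have "AE \<omega> in M. \<forall>N\<in>Q. 0 \<le> L0_rep (N z) \<omega>"
      by (rule sn_all[OF Q(1)]) (use Q(3) that in \<open>auto intro!: seminorm_nonneg\<close>)
    then show ?thesis
      by eventually_elim (use Q(1) that in \<open>auto simp: sn_def intro!: sum_mono2\<close>)
  qed
  \<comment> \<open>One index \<open>m\<close> bounds both random radii from below by the constant
    \<open>d\<close> and the distance from \<open>x\<close> to \<open>y0\<close> from above.\<close>
  let ?R = "\<lambda>m \<omega>. 1 / real (Suc m) \<le> e1 \<omega> \<and> 1 / real (Suc m) \<le> e2 \<omega> \<and> sn Q (x \<ominus>\<^bsub>E\<^esub> y0) \<omega> \<le> real m"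
  have xy0: "x \<ominus>\<^bsub>E\<^esub> y0 \<in> carrier E" using x y0 by simp
  note [measurable] = e1(1) e2(1) sn_measurable[OF Q(1,3) xy0]
  have "\<exists>m. 0 < measure M (C3 \<inter> {\<omega> \<in> space M. ?R m \<omega>})"
  proof (rule ex_pos_subset[OF C3(1,3)])
    show "{\<omega> \<in> space M. ?R m \<omega>} \<in> sets M" for m by measurable
    have "\<exists>m. ?R m \<omega>" for \<omega>
    proof -
      obtain k :: nat where "max (max (1 / e1 \<omega>) (1 / e2 \<omega>)) (sn Q (x \<ominus>\<^bsub>E\<^esub> y0) \<omega>) < real k"
        using reals_Archimedean2 by blast
      then have "1 / e1 \<omega> < real (Suc k)" "1 / e2 \<omega> < real (Suc k)" "sn Q (x \<ominus>\<^bsub>E\<^esub> y0) \<omega> \<le> real k" by auto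
      then show ?thesis using e1(2)[of \<omega>] e2(2)[of \<omega>] by (intro exI[of _ k]) (auto simp: field_simps)
    qed
    then show "AE \<omega>\<in>C3 in M. (\<exists>m. ?R m \<omega>)" by auto
  qed
  then obtain m where m: "0 < measure M (C3 \<inter> {\<omega> \<in> space M. ?R m \<omega>})" ..
  define d where "d = 1 / real (Suc m)"
  have d: "0 < d" by (simp add: d_def)
  define C4 where "C4 = C3 \<inter> {\<omega> \<in> space M. ?R m \<omega>}"
  have C4: "C4 \<in> sets M" "0 < measure M C4" "C4 \<subseteq> C3" using C3 m unfolding C4_def by auto
  have C4_BP: "C4 \<subseteq> BP M E h" using C4 C3 C2' by auto
  have fin4: "AE \<omega>\<in>C4 in M. L0_rep (h y0) \<omega> < \<infinity>"
    using fin2 by eventually_elim (use C4 C3 in auto)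
  let ?K = "2 * real n / d + (\<bar>r\<bar> + real n + 2 * real n / d * real m) / d"
  have K0: "0 \<le> ?K" using d by simp
  \<comment> \<open>The added 1 makes the slope strictly positive, as \<open>?K\<close> is zero when
    \<open>n\<close> and \<open>r\<close> vanish.\<close>
  have "AE \<omega>\<in>C4 in M. ereal (r - (?K + 1) * sn Q (y \<ominus>\<^bsub>E\<^esub> x) \<omega>) \<le> L0_rep (h y) \<omega>"
    if y: "y \<in> carrier E" for y
  proof -
    have yy0: "y \<ominus>\<^bsub>E\<^esub> y0 \<in> carrier E" and yx: "y \<ominus>\<^bsub>E\<^esub> x \<in> carrier E" using x y y0 by simp_all
    \<comment> \<open>This weight brings the point \<open>z\<close> within distance \<open>d\<close>
      of \<open>y0\<close>. The absolute value keeps \<open>l\<close> between 0 and 1 at every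
      point, because \<open>sn\<close> is known to be nonnegative only a.s.\<close>
    define l where "l = (\<lambda>\<omega>. d / (d + \<bar>sn Q (y \<ominus>\<^bsub>E\<^esub> y0) \<omega>\<bar>))"
    note [measurable] = sn_measurable[OF Q(1,3) yy0]
    have l [measurable]: "l \<in> borel_measurable M" unfolding l_def by measurable
    have l01: "0 \<le> l \<omega>" "l \<omega> \<le> 1" for \<omega> using d by (auto simp: l_def)
    define z where "z = sc l y \<oplus>\<^bsub>E\<^esub> sc (\<lambda>\<omega>. 1 - l \<omega>) y0"
    have z: "z \<in> carrier E" using y y0 by (simp add: z_def)
    have "z \<ominus>\<^bsub>E\<^esub> y0 = sc l (y \<ominus>\<^bsub>E\<^esub> y0)"
      using y y0 sc_minus_left[of "\<lambda>_. 1" l y0]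
      by (simp add: z_def sc_one sc_add_right sc_a_inv a_minus_def M.a_ac M.r_neg1 M.r_neg2)
    with sn_sc[OF Q(1,3) yy0 l]
    have zy0: "AE \<omega> in M. sn Q (z \<ominus>\<^bsub>E\<^esub> y0) \<omega> = \<bar>l \<omega>\<bar> * sn Q (y \<ominus>\<^bsub>E\<^esub> y0) \<omega>" by simp
    have zy0c: "z \<ominus>\<^bsub>E\<^esub> y0 \<in> carrier E" using z y0 by simp
    have "AE \<omega>\<in>C4 in M. L0_rep (h z) \<omega> \<le>
        ereal (l \<omega>) * L0_rep (h y) \<omega> + ereal (1 - l \<omega>) * L0_rep (h y0) \<omega>"
      unfolding z_def by (rule closed_convex[OF h closed C4(1,2) C4_BP y0(1) fin4 y y0(1) l l01])
    moreover note ball1[OF z] ball2[OF y] zy0 sn_nonneg[OF Q(1,3) yy0] sn_nonneg[OF Q(1,3) yx]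
      sn_minus_triangle[OF Q(1,3) y x y0(1)] closed_not_MInf[OF h closed y]
      sn_sub[OF Q12(1) zy0c] sn_sub[OF Q12(2) yx]
    ultimately show ?thesis
    proof eventually_elim
      case (elim \<omega>)
      show ?case
      proof
        assume w: "\<omega> \<in> C4"
        let ?p = "sn Q (y \<ominus>\<^bsub>E\<^esub> x) \<omega>" and ?q = "sn Q (y \<ominus>\<^bsub>E\<^esub> y0) \<omega>"
        have wm: "\<omega> \<in> C3" "\<omega> \<in> C2" "\<omega> \<in> C1" "\<omega> \<in> BP M E h" "d \<le> e1 \<omega>" "d \<le> e2 \<omega>" "sn Q (x \<ominus>\<^bsub>E\<^esub> y0) \<omega> \<le> real m"
          using w C4 C3 C2 C1 by (auto simp: C4_def d_def)
        have le: "L0_rep (h z) \<omega> \<le> ereal (l \<omega>) * L0_rep (h y) \<omega> + ereal (1 - l \<omega>) * L0_rep (h y0) \<omega>"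
          using elim w by blast
        have lw: "l \<omega> = d / (d + ?q)" using elim by (simp add: l_def)
        \<comment> \<open>Hence \<open>z\<close> is in the ball around \<open>y0\<close>, as
          \<open>d\<close> is at most \<open>e1\<close> on \<open>C4\<close>.\<close>
        have "\<bar>l \<omega>\<bar> * ?q \<le> d" unfolding lw using elim d by (simp add: field_simps)
        then have hz: "ereal (- real n) < L0_rep (h z) \<omega>" using elim wm by auto
        obtain w0 where w0: "L0_rep (h y0) \<omega> = ereal w0" "w0 \<le> real n"
          using wm(3) by (cases "L0_rep (h y0) \<omega>") (auto simp: C1_def)
        show "ereal (r - (?K + 1) * ?p) \<le> L0_rep (h y) \<omega>"
        proof (cases "L0_rep (h y) \<omega>")
          case (real v)
          have "ereal (- real n) < ereal (l \<omega> * v + (1 - l \<omega>) * w0)"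
            using less_le_trans[OF hz le] by (simp add: real w0)
          moreover have "(1 - l \<omega>) * w0 \<le> (1 - l \<omega>) * real n" using w0 l01[of \<omega>] by (intro mult_left_mono) auto
          ultimately have conv: "- real n < d / (d + ?q) * v + (1 - d / (d + ?q)) * real n"
            unfolding lw by simp
          have "r - ?K * ?p \<le> v"
          proof (rule lipschitz_arith[where p = ?p and p0 = ?q and m = "real m", OF d _ _ _ _ _ _ conv])
            show "r < v" if "?p \<le> d"
            proof -
              have "sn Q2 (y \<ominus>\<^bsub>E\<^esub> x) \<omega> \<le> e2 \<omega>" using elim wm(6) that by linarith
              then show ?thesis using elim wm(1) real by simp
            qed
            show "?q \<le> ?p + real m" using elim wm by linarith
          qed (use elim in auto)
          moreover have "r - (?K + 1) * ?p = r - ?K * ?p - ?p" by (simp add: algebra_simps)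
          moreover have "0 \<le> ?p" using elim by simp
          ultimately have "r - (?K + 1) * ?p \<le> v" by linarith
          then show ?thesis by (simp only: real ereal_less_eq)
        next
          case MInf
          then show ?thesis using elim wm by simp
        qed simp
      qed
    qed
  qed
  moreover have "C4 \<subseteq> C" "0 < ?K + 1" using C4 C3 C2 C1 K0 by auto
  ultimately show ?thesis using Q C4 by (intro exI[of _ Q] exI[of _ "?K + 1"] exI[of _ C4]) blast
qed

end

section \<open>Separation\<close>

context rlc_module
begin

lemma minus_add_add:
  assumes "a \<in> carrier E" "b \<in> carrier E" "c \<in> carrier E" "d \<in> carrier E"
  shows "(a \<oplus>\<^bsub>E\<^esub> b) \<ominus>\<^bsub>E\<^esub> (c \<oplus>\<^bsub>E\<^esub> d) = (a \<ominus>\<^bsub>E\<^esub> c) \<oplus>\<^bsub>E\<^esub> (b \<ominus>\<^bsub>E\<^esub> d)"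
  using assms by (simp add: a_minus_def M.minus_add M.a_ac)

lemma minus_self: "a \<in> carrier E \<Longrightarrow> a \<ominus>\<^bsub>E\<^esub> a = \<zero>\<^bsub>E\<^esub>"
  by (simp add: a_minus_def M.r_neg)

lemma minus_zero: "a \<in> carrier E \<Longrightarrow> a \<ominus>\<^bsub>E\<^esub> \<zero>\<^bsub>E\<^esub> = a"
  by (simp add: a_minus_def)

lemma sn_zero:
  assumes "finite Q" "Q \<subseteq> P"
  shows "AE \<omega> in M. sn Q \<zero>\<^bsub>E\<^esub> \<omega> = 0"
  using sn_sc[OF assms, of "\<zero>\<^bsub>E\<^esub>" "\<lambda>_. 0"] by (simp add: sc_null)

section \<open>The supporting functional\<close>

context
  fixes h :: "'e \<Rightarrow> ('a \<Rightarrow> ereal) set" and C Q and K r :: real and x :: 'e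
  assumes h: "h \<in> carrier E \<rightarrow> L0 M" and C [measurable]: "C \<in> sets M"
    and convex: "\<And>y z u. y \<in> carrier E \<Longrightarrow> z \<in> carrier E \<Longrightarrow> u \<in> borel_measurable M \<Longrightarrow>
      (\<And>\<omega>. 0 \<le> u \<omega>) \<Longrightarrow> (\<And>\<omega>. u \<omega> \<le> 1) \<Longrightarrow>
      AE \<omega>\<in>C in M. L0_rep (h (sc u y \<oplus>\<^bsub>E\<^esub> sc (\<lambda>\<omega>. 1 - u \<omega>) z)) \<omega> \<le>
        ereal (u \<omega>) * L0_rep (h y) \<omega> + ereal (1 - u \<omega>) * L0_rep (h z) \<omega>"
    and Q: "finite Q" "Q \<noteq> {}" "Q \<subseteq> P" and K: "0 < K" and x: "x \<in> carrier E"
    and minorant: "\<And>y. y \<in> carrier E \<Longrightarrow>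
      AE \<omega>\<in>C in M. ereal (r - K * sn Q (y \<ominus>\<^bsub>E\<^esub> x) \<omega>) \<le> L0_rep (h y) \<omega>"
begin

text \<open>
  The constraints \<open>g (t (z - x)) \<le> t (s - r)\<close> for \<open>s \<ge> h z\<close>, \<open>t \<ge> 0\<close>, together with
  \<open>g \<le> K \<Sum>N\<in>Q. N\<close>. The multiplier \<open>t\<close> may vanish where \<open>h z = \<infinity>\<close>, so that \<open>s\<close> can be real valued.
\<close>

definition constraints :: "('e \<times> ('a \<Rightarrow> real)) set" where
  "constraints = {(w, b). w \<in> carrier E \<and> b \<in> borel_measurable M \<and>
    (\<exists>t z s. t \<in> borel_measurable M \<and> (\<forall>\<omega>. 0 \<le> t \<omega>) \<and> z \<in> carrier E \<and> s \<in> borel_measurable M \<and>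
      (AE \<omega>\<in>C in M. 0 < t \<omega> \<longrightarrow> L0_rep (h z) \<omega> \<le> ereal (s \<omega>)) \<and>
      (AE \<omega> in M. (\<omega> \<in> C \<longrightarrow> t \<omega> * (s \<omega> - r) + K * sn Q (w \<ominus>\<^bsub>E\<^esub> sc t (z \<ominus>\<^bsub>E\<^esub> x)) \<omega> \<le> b \<omega>) \<and>
        (\<omega> \<notin> C \<longrightarrow> 0 \<le> b \<omega>)))}"

lemma constraintsI:
  assumes "w \<in> carrier E" "b \<in> borel_measurable M" "t \<in> borel_measurable M" "\<And>\<omega>. 0 \<le> t \<omega>" "z \<in> carrier E"
    "s \<in> borel_measurable M" "AE \<omega>\<in>C in M. 0 < t \<omega> \<longrightarrow> L0_rep (h z) \<omega> \<le> ereal (s \<omega>)"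
    "AE \<omega> in M. (\<omega> \<in> C \<longrightarrow> t \<omega> * (s \<omega> - r) + K * sn Q (w \<ominus>\<^bsub>E\<^esub> sc t (z \<ominus>\<^bsub>E\<^esub> x)) \<omega> \<le> b \<omega>) \<and>
        (\<omega> \<notin> C \<longrightarrow> 0 \<le> b \<omega>)"
  shows "(w, b) \<in> constraints"
  unfolding constraints_def using assms by blast

text \<open>The multiplier \<open>t = 0\<close> leaves only the seminorm. These constraints supply a
  bound at every vector, as the Hahn-Banach theorem requires, and force \<open>g\<close> to vanish
  a.s. off \<open>C\<close>.\<close>

lemma sn_constraint:
  assumes v: "v \<in> carrier E"
  shows "(v, \<lambda>\<omega>. indicator C \<omega> * (K * sn Q v \<omega>)) \<in> constraints"
proof (rule constraintsI[where t = "\<lambda>_. 0" and s = "\<lambda>_. 0" and z = x])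
  note [measurable] = sn_measurable[OF Q(1,3) v]
  show "(\<lambda>\<omega>. indicator C \<omega> * (K * sn Q v \<omega>)) \<in> borel_measurable M" by measurable
  have "v \<ominus>\<^bsub>E\<^esub> sc (\<lambda>_. 0) (x \<ominus>\<^bsub>E\<^esub> x) = v" using v x by (simp add: sc_zero minus_zero)
  then show "AE \<omega> in M. (\<omega> \<in> C \<longrightarrow> 0 * (0 - r) + K * sn Q (v \<ominus>\<^bsub>E\<^esub> sc (\<lambda>_. 0) (x \<ominus>\<^bsub>E\<^esub> x)) \<omega> \<le>
      indicator C \<omega> * (K * sn Q v \<omega>)) \<and> (\<omega> \<notin> C \<longrightarrow> 0 \<le> indicator C \<omega> * (K * sn Q v \<omega>))" by simp
qed (use v x in auto)

text \<open>The pairs \<open>(t (z - x), t (s - r))\<close> form a convex cone: two of them add up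
  to the one with multiplier \<open>t1 + t2\<close> at the convex combination of \<open>z1\<close>
  and \<open>z2\<close> with weights proportional to \<open>t1\<close> and \<open>t2\<close>.
  Convexity of \<open>h\<close> keeps \<open>s\<close> above \<open>h z\<close>.\<close>

lemma constraints_add:
  assumes "(w1, b1) \<in> constraints" "(w2, b2) \<in> constraints"
  shows "(w1 \<oplus>\<^bsub>E\<^esub> w2, \<lambda>\<omega>. b1 \<omega> + b2 \<omega>) \<in> constraints"
proof -
  from assms obtain t1 z1 s1 t2 z2 s2 where
    w: "w1 \<in> carrier E" "w2 \<in> carrier E" and b: "b1 \<in> borel_measurable M" "b2 \<in> borel_measurable M"
    and t: "t1 \<in> borel_measurable M" "t2 \<in> borel_measurable M" and t0: "\<And>\<omega>. 0 \<le> t1 \<omega>" "\<And>\<omega>. 0 \<le> t2 \<omega>"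
    and z: "z1 \<in> carrier E" "z2 \<in> carrier E" and s: "s1 \<in> borel_measurable M" "s2 \<in> borel_measurable M"
    and le1: "AE \<omega>\<in>C in M. 0 < t1 \<omega> \<longrightarrow> L0_rep (h z1) \<omega> \<le> ereal (s1 \<omega>)"
    and le2: "AE \<omega>\<in>C in M. 0 < t2 \<omega> \<longrightarrow> L0_rep (h z2) \<omega> \<le> ereal (s2 \<omega>)"
    and b1: "AE \<omega> in M. (\<omega> \<in> C \<longrightarrow> t1 \<omega> * (s1 \<omega> - r) + K * sn Q (w1 \<ominus>\<^bsub>E\<^esub> sc t1 (z1 \<ominus>\<^bsub>E\<^esub> x)) \<omega> \<le> b1 \<omega>) \<and>
        (\<omega> \<notin> C \<longrightarrow> 0 \<le> b1 \<omega>)"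
    and b2: "AE \<omega> in M. (\<omega> \<in> C \<longrightarrow> t2 \<omega> * (s2 \<omega> - r) + K * sn Q (w2 \<ominus>\<^bsub>E\<^esub> sc t2 (z2 \<ominus>\<^bsub>E\<^esub> x)) \<omega> \<le> b2 \<omega>) \<and>
        (\<omega> \<notin> C \<longrightarrow> 0 \<le> b2 \<omega>)"
    unfolding constraints_def by (elim CollectE case_prodE conjE exE Pair_inject) simp
  note [measurable] = b t s
  define t where "t = (\<lambda>\<omega>. t1 \<omega> + t2 \<omega>)"
  \<comment> \<open>Where both multipliers vanish, division by zero gives \<open>l = 0\<close>, and
    the products of \<open>t\<close> with \<open>l\<close> and \<open>1 - l\<close> are still
    \<open>t1\<close> and \<open>t2\<close>.\<close>
  define l where "l = (\<lambda>\<omega>. t1 \<omega> / t \<omega>)"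
  have tm [measurable]: "t \<in> borel_measurable M" unfolding t_def by measurable
  have lm [measurable]: "l \<in> borel_measurable M" unfolding l_def by measurable
  have l01: "0 \<le> l \<omega>" "l \<omega> \<le> 1" for \<omega>
    using t0[of \<omega>] by (auto simp: l_def t_def divide_le_eq_1)
  have tl: "t \<omega> * l \<omega> = t1 \<omega>" for \<omega> using t0[of \<omega>] by (auto simp: l_def t_def)
  have tl': "t \<omega> * (1 - l \<omega>) = t2 \<omega>" for \<omega> using tl[of \<omega>] by (simp add: right_diff_distrib t_def)
  define z where "z = sc l z1 \<oplus>\<^bsub>E\<^esub> sc (\<lambda>\<omega>. 1 - l \<omega>) z2"
  have zc: "z \<in> carrier E" using z by (simp add: z_def)
  define s where "s = (\<lambda>\<omega>. l \<omega> * s1 \<omega> + (1 - l \<omega>) * s2 \<omega>)"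
  have sm: "s \<in> borel_measurable M" unfolding s_def by measurable
  have "sc t z = sc t1 z1 \<oplus>\<^bsub>E\<^esub> sc t2 z2"
    using z by (simp add: z_def sc_add_right sc_sc tl tl')
  moreover have "sc t x = sc t1 x \<oplus>\<^bsub>E\<^esub> sc t2 x"
    unfolding t_def using x by (intro sc_add_left) auto
  ultimately have tz: "sc t (z \<ominus>\<^bsub>E\<^esub> x) = sc t1 (z1 \<ominus>\<^bsub>E\<^esub> x) \<oplus>\<^bsub>E\<^esub> sc t2 (z2 \<ominus>\<^bsub>E\<^esub> x)"
    using z zc x by (simp add: sc_minus_right minus_add_add)
  let ?v1 = "w1 \<ominus>\<^bsub>E\<^esub> sc t1 (z1 \<ominus>\<^bsub>E\<^esub> x)" and ?v2 = "w2 \<ominus>\<^bsub>E\<^esub> sc t2 (z2 \<ominus>\<^bsub>E\<^esub> x)"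
  have v: "?v1 \<in> carrier E" "?v2 \<in> carrier E" using w z x by simp_all
  have wv: "(w1 \<oplus>\<^bsub>E\<^esub> w2) \<ominus>\<^bsub>E\<^esub> sc t (z \<ominus>\<^bsub>E\<^esub> x) = ?v1 \<oplus>\<^bsub>E\<^esub> ?v2"
    unfolding tz using w z x by (simp add: minus_add_add)
  show ?thesis
  proof (rule constraintsI[OF _ _ tm _ zc sm])
    show "w1 \<oplus>\<^bsub>E\<^esub> w2 \<in> carrier E" "(\<lambda>\<omega>. b1 \<omega> + b2 \<omega>) \<in> borel_measurable M" using w by auto
    show "0 \<le> t \<omega>" for \<omega> using t0 by (simp add: t_def)
    have "AE \<omega>\<in>C in M. L0_rep (h z) \<omega> \<le>
        ereal (l \<omega>) * L0_rep (h z1) \<omega> + ereal (1 - l \<omega>) * L0_rep (h z2) \<omega>"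
      unfolding z_def by (rule convex[OF z lm l01])
    with le1 le2 show "AE \<omega>\<in>C in M. 0 < t \<omega> \<longrightarrow> L0_rep (h z) \<omega> \<le> ereal (s \<omega>)"
    proof eventually_elim
      case (elim \<omega>)
      show ?case
      proof (intro impI)
        assume w: "\<omega> \<in> C" and "0 < t \<omega>"
        have "ereal (l \<omega>) * L0_rep (h z1) \<omega> \<le> ereal (l \<omega>) * ereal (s1 \<omega>)"
        \<comment> \<open>With weight zero nothing is known about \<open>h z1\<close>, which may be
          infinite; the product is 0 all the same.\<close>
        proof (cases "t1 \<omega> = 0")
          case True
          then show ?thesis by (simp add: l_def zero_ereal_def[symmetric])
        next
          case False
          then have "0 < t1 \<omega>" using t0(1)[of \<omega>] by simp
          with elim w l01[of \<omega>] show ?thesis by (intro ereal_mult_left_mono) auto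
        qed
        moreover have "ereal (1 - l \<omega>) * L0_rep (h z2) \<omega> \<le> ereal (1 - l \<omega>) * ereal (s2 \<omega>)"
        proof (cases "t2 \<omega> = 0")
          case True
          then have "1 - l \<omega> = 0" using tl'[of \<omega>] \<open>0 < t \<omega>\<close> by simp
          then show ?thesis by (simp add: zero_ereal_def[symmetric])
        next
          case False
          then have "0 < t2 \<omega>" using t0(2)[of \<omega>] by simp
          with elim w l01[of \<omega>] show ?thesis by (intro ereal_mult_left_mono) auto
        qed
        ultimately have "ereal (l \<omega>) * L0_rep (h z1) \<omega> + ereal (1 - l \<omega>) * L0_rep (h z2) \<omega> \<le>
          ereal (l \<omega>) * ereal (s1 \<omega>) + ereal (1 - l \<omega>) * ereal (s2 \<omega>)" by (rule add_mono)
        also have "\<dots> = ereal (s \<omega>)" by (simp add: s_def)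
        finally show "L0_rep (h z) \<omega> \<le> ereal (s \<omega>)" using elim w order_trans by blast
      qed
    qed
    from b1 b2 sn_add[OF Q(1,3) v]
    show "AE \<omega> in M. (\<omega> \<in> C \<longrightarrow> t \<omega> * (s \<omega> - r) +
        K * sn Q ((w1 \<oplus>\<^bsub>E\<^esub> w2) \<ominus>\<^bsub>E\<^esub> sc t (z \<ominus>\<^bsub>E\<^esub> x)) \<omega> \<le> b1 \<omega> + b2 \<omega>) \<and>
      (\<omega> \<notin> C \<longrightarrow> 0 \<le> b1 \<omega> + b2 \<omega>)"
      unfolding wv
    proof eventually_elim
      case (elim \<omega>)
      have "t \<omega> * (s \<omega> - r) = (t \<omega> * l \<omega>) * s1 \<omega> + (t \<omega> * (1 - l \<omega>)) * s2 \<omega> - t \<omega> * r"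
        by (simp add: s_def algebra_simps)
      also have "\<dots> = t1 \<omega> * (s1 \<omega> - r) + t2 \<omega> * (s2 \<omega> - r)"
        unfolding tl tl' by (simp add: t_def algebra_simps)
      finally have ts: "t \<omega> * (s \<omega> - r) = t1 \<omega> * (s1 \<omega> - r) + t2 \<omega> * (s2 \<omega> - r)" .
      have "K * sn Q (?v1 \<oplus>\<^bsub>E\<^esub> ?v2) \<omega> \<le> K * sn Q ?v1 \<omega> + K * sn Q ?v2 \<omega>"
        using elim K by (simp add: distrib_left[symmetric])
      with elim ts show ?case by auto
    qed
  qed
qed

text \<open>A constraint at zero bounds \<open>b\<close> below by \<open>t (s - r)\<close> plus
  \<open>K t\<close> times the distance from \<open>z\<close> to \<open>x\<close>. The Lipschitz
  minorant at \<open>z\<close> says exactly that this is nonnegative, and here is its only essential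
  use.\<close>

lemma consistent_constraints: "consistent M E constraints"
  unfolding consistent_def
proof (intro conjI allI impI)
  show "constraints \<subseteq> carrier E \<times> borel_measurable M" by (auto simp: constraints_def)
  show "(\<zero>\<^bsub>E\<^esub>, \<lambda>_. 0) \<in> constraints"
  proof (rule constraintsI[where t = "\<lambda>_. 0" and s = "\<lambda>_. 0" and z = x])
    have "\<zero>\<^bsub>E\<^esub> \<ominus>\<^bsub>E\<^esub> sc (\<lambda>_. 0) (x \<ominus>\<^bsub>E\<^esub> x) = \<zero>\<^bsub>E\<^esub>" using x by (simp add: sc_zero minus_zero)
    then show "AE \<omega> in M. (\<omega> \<in> C \<longrightarrow> 0 * (0 - r) + K * sn Q (\<zero>\<^bsub>E\<^esub> \<ominus>\<^bsub>E\<^esub> sc (\<lambda>_. 0) (x \<ominus>\<^bsub>E\<^esub> x)) \<omega> \<le> 0) \<and>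
        (\<omega> \<notin> C \<longrightarrow> (0::real) \<le> 0)"
      using sn_zero[OF Q(1,3)] by (auto elim!: eventually_mono)
  qed (use x in auto)
next
  fix v b w c assume "(v, b) \<in> constraints" "(w, c) \<in> constraints"
  then show "(v \<oplus>\<^bsub>E\<^esub> w, \<lambda>\<omega>. b \<omega> + c \<omega>) \<in> constraints" by (rule constraints_add)
next
  fix b assume "(\<zero>\<^bsub>E\<^esub>, b) \<in> constraints"
  then obtain t z s where t: "t \<in> borel_measurable M" "\<And>\<omega>. 0 \<le> t \<omega>" and z: "z \<in> carrier E"
    and le: "AE \<omega>\<in>C in M. 0 < t \<omega> \<longrightarrow> L0_rep (h z) \<omega> \<le> ereal (s \<omega>)"
    and b: "AE \<omega> in M. (\<omega> \<in> C \<longrightarrow> t \<omega> * (s \<omega> - r) + K * sn Q (\<zero>\<^bsub>E\<^esub> \<ominus>\<^bsub>E\<^esub> sc t (z \<ominus>\<^bsub>E\<^esub> x)) \<omega> \<le> b \<omega>) \<and>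
        (\<omega> \<notin> C \<longrightarrow> 0 \<le> b \<omega>)"
    unfolding constraints_def by (elim CollectE case_prodE conjE exE Pair_inject) simp
  have zx: "z \<ominus>\<^bsub>E\<^esub> x \<in> carrier E" "sc t (z \<ominus>\<^bsub>E\<^esub> x) \<in> carrier E" using z x t by simp_all
  have "AE \<omega> in M. sn Q (\<zero>\<^bsub>E\<^esub> \<ominus>\<^bsub>E\<^esub> sc t (z \<ominus>\<^bsub>E\<^esub> x)) \<omega> = sn Q (sc t (z \<ominus>\<^bsub>E\<^esub> x)) \<omega>"
    using sn_a_inv[OF Q(1,3) zx(2)] zx(2) by (simp add: a_minus_def)
  with sn_sc[OF Q(1,3) zx(1) t(1)] le b minorant[OF z] show "AE \<omega> in M. 0 \<le> b \<omega>"
  proof eventually_elim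
    case (elim \<omega>)
    let ?p = "sn Q (z \<ominus>\<^bsub>E\<^esub> x) \<omega>"
    show ?case
    proof (cases "\<omega> \<in> C")
      case True
      have b: "t \<omega> * (s \<omega> - r) + K * (t \<omega> * ?p) \<le> b \<omega>" using elim True t(2)[of \<omega>] by simp
      have "0 \<le> t \<omega> * (s \<omega> - r + K * ?p)"
      proof (cases "t \<omega> = 0")
        case False
        then have "0 < t \<omega>" using t(2)[of \<omega>] by simp
        with elim True have "ereal (r - K * ?p) \<le> ereal (s \<omega>)" by (meson order_trans)
        then show ?thesis using t(2)[of \<omega>] by (intro mult_nonneg_nonneg) auto
      qed simp
      with b show ?thesis by (simp add: algebra_simps)
    qed (use elim in simp)
  qed
qed

text \<open>The seminorm constraints make \<open>g\<close> homogeneous and continuous; the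
  constraint at the vector \<open>t (y - x)\<close> itself, where the seminorm part is zero, is the
  supporting inequality at \<open>y\<close>.\<close>

lemma ex_supporting_dual:
  "\<exists>g\<in>Tc_dual M E P. \<forall>y\<in>carrier E.
    AE \<omega>\<in>C in M. ereal (r + L0_rep (g y) \<omega> - L0_rep (g x) \<omega>) \<le> L0_rep (h y) \<omega>"
proof -
  have "\<exists>g. (\<forall>v\<in>carrier E. g v \<in> borel_measurable M) \<and>
    (\<forall>v\<in>carrier E. \<forall>w\<in>carrier E. AE \<omega> in M. g (v \<oplus>\<^bsub>E\<^esub> w) \<omega> = g v \<omega> + g w \<omega>) \<and>
    (\<forall>(v, b)\<in>constraints. AE \<omega> in M. g v \<omega> \<le> b \<omega>)"
    using sn_constraint
    by (intro M.ex_additive_below_constraints prob_space_axioms consistent_constraints) blast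
  then obtain g :: "'e \<Rightarrow> 'a \<Rightarrow> real" where gm: "\<And>v. v \<in> carrier E \<Longrightarrow> g v \<in> borel_measurable M"
    and add: "\<And>v w. v \<in> carrier E \<Longrightarrow> w \<in> carrier E \<Longrightarrow> AE \<omega> in M. g (v \<oplus>\<^bsub>E\<^esub> w) \<omega> = g v \<omega> + g w \<omega>"
    and below: "\<And>v b. (v, b) \<in> constraints \<Longrightarrow> AE \<omega> in M. g v \<omega> \<le> b \<omega>" by blast
  define q where "q = (\<lambda>v \<omega>. indicator C \<omega> * (K * sn Q v \<omega>))"
  have g0: "AE \<omega> in M. g \<zero>\<^bsub>E\<^esub> \<omega> = 0" using add[of "\<zero>\<^bsub>E\<^esub>" "\<zero>\<^bsub>E\<^esub>"] by simp
  have ginv: "AE \<omega> in M. g (\<ominus>\<^bsub>E\<^esub> v) \<omega> = - g v \<omega>" if v: "v \<in> carrier E" for v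
    using g0 add[of "\<ominus>\<^bsub>E\<^esub> v" v] v by (auto simp: M.l_neg elim!: eventually_elim2)
  have dom: "AE \<omega> in M. \<bar>g v \<omega>\<bar> \<le> q v \<omega>" if v: "v \<in> carrier E" for v
  proof -
    have "\<ominus>\<^bsub>E\<^esub> v \<in> carrier E" using v by simp
    from below[OF sn_constraint[OF v]] below[OF sn_constraint[OF this]] ginv[OF v] sn_a_inv[OF Q(1,3) v]
    show ?thesis by eventually_elim (auto simp: q_def)
  qed
  have sc: "AE \<omega> in M. g (sc u v) \<omega> = u \<omega> * g v \<omega>" if "v \<in> carrier E" "u \<in> borel_measurable M" for u v
  proof (rule additive_dominated_homogeneous[OF gm add _ dom that(2,1)])
    show "AE \<omega> in M. q (sc u x) \<omega> = \<bar>u \<omega>\<bar> * q x \<omega>" if "u \<in> borel_measurable M" "x \<in> carrier E" for u x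
      using sn_sc[OF Q(1,3) that(2,1)] by eventually_elim (simp add: q_def)
  qed
  let ?G = "\<lambda>x\<in>carrier E. L0_class M (g x)"
  have G: "?G \<in> Tc_dual M E P"
  proof (rule dualI[OF gm add sc Q])
    show "AE \<omega> in M. \<bar>g v \<omega>\<bar> \<le> K * sn Q v \<omega>" if v: "v \<in> carrier E" for v
      using dom[OF v] sn_nonneg[OF Q(1,3) v]
    proof eventually_elim
      case (elim \<omega>)
      then have "q v \<omega> \<le> K * sn Q v \<omega>" using K by (simp add: q_def indicator_def)
      with elim show ?case by simp
    qed
  qed (use K in auto)
  have "AE \<omega>\<in>C in M. ereal (r + L0_rep (?G y) \<omega> - L0_rep (?G x) \<omega>) \<le> L0_rep (h y) \<omega>"
    if y: "y \<in> carrier E" for y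
  proof -
    have yx: "y \<ominus>\<^bsub>E\<^esub> x \<in> carrier E" using x y by simp
    note [measurable] = L0_rep_measurable[OF funcset_mem[OF h y]]
    \<comment> \<open>The multiplier is switched off where \<open>h y\<close> is
      \<open>\<infinity>\<close>, where the claim is trivial. On the rest of \<open>C\<close> the
      minorant excludes \<open>-\<infinity>\<close>, so \<open>s\<close> is the true value of
      \<open>h y\<close>.\<close>
    define t :: "'a \<Rightarrow> real" where "t = (\<lambda>\<omega>. if L0_rep (h y) \<omega> < \<infinity> then 1 else 0)"
    define s where "s = (\<lambda>\<omega>. real_of_ereal (L0_rep (h y) \<omega>))"
    have t [measurable]: "t \<in> borel_measurable M" unfolding t_def by measurable
    have s [measurable]: "s \<in> borel_measurable M" unfolding s_def by measurable
    have w: "sc t (y \<ominus>\<^bsub>E\<^esub> x) \<in> carrier E" using yx by simp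
    have "(sc t (y \<ominus>\<^bsub>E\<^esub> x), \<lambda>\<omega>. indicator C \<omega> * (t \<omega> * (s \<omega> - r))) \<in> constraints"
    proof (rule constraintsI[OF w _ t _ y s])
      show "AE \<omega>\<in>C in M. 0 < t \<omega> \<longrightarrow> L0_rep (h y) \<omega> \<le> ereal (s \<omega>)"
        using minorant[OF y]
      proof eventually_elim
        case (elim \<omega>)
        then show ?case by (cases "L0_rep (h y) \<omega>") (auto simp: t_def s_def)
      qed
      show "AE \<omega> in M. (\<omega> \<in> C \<longrightarrow> t \<omega> * (s \<omega> - r) + K * sn Q (sc t (y \<ominus>\<^bsub>E\<^esub> x) \<ominus>\<^bsub>E\<^esub> sc t (y \<ominus>\<^bsub>E\<^esub> x)) \<omega>
          \<le> indicator C \<omega> * (t \<omega> * (s \<omega> - r))) \<and> (\<omega> \<notin> C \<longrightarrow> 0 \<le> indicator C \<omega> * (t \<omega> * (s \<omega> - r)))"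
        using sn_zero[OF Q(1,3)] unfolding minus_self[OF w] by eventually_elim auto
    qed (auto simp: t_def)
    from below[OF this] have gt: "AE \<omega> in M. g (sc t (y \<ominus>\<^bsub>E\<^esub> x)) \<omega> \<le> indicator C \<omega> * (t \<omega> * (s \<omega> - r))" .
    have "(y \<ominus>\<^bsub>E\<^esub> x) \<oplus>\<^bsub>E\<^esub> x = y" using x y by (simp add: a_minus_def M.a_assoc M.l_neg)
    then have "AE \<omega> in M. g y \<omega> = g (y \<ominus>\<^bsub>E\<^esub> x) \<omega> + g x \<omega>" using add[OF yx x] by simp
    with gt sc[OF yx t] minorant[OF y] L0_rep_class(2)[OF gm[OF y]] L0_rep_class(2)[OF gm[OF x]]
    show ?thesis
    proof eventually_elim
      case (elim \<omega>)
      show ?case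
      proof
        assume "\<omega> \<in> C"
        with elim x y show "ereal (r + L0_rep (?G y) \<omega> - L0_rep (?G x) \<omega>) \<le> L0_rep (h y) \<omega>"
          by (cases "L0_rep (h y) \<omega>") (auto simp: t_def s_def)
      qed
    qed
  qed
  with G show ?thesis by blast
qed

end

section \<open>Comparison of closed minorants with the biconjugate\<close>

lemma zero_in_dual: "(\<lambda>x\<in>carrier E. L0_class M (\<lambda>_. 0)) \<in> Tc_dual M E P"
proof -
  obtain N where N: "N \<in> P" using P_nonempty by auto
  then have Q: "finite {N}" "{N} \<noteq> {}" "{N} \<subseteq> P" by auto
  show ?thesis
    by (rule dualI[of "\<lambda>_ _. 0" "{N}" 1]) (use sn_nonneg[OF Q(1,3)] Q in auto)
qed

text \<open>On \<open>MI\<close> of \<open>h\<close> the left side is \<open>-\<infinity>\<close>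
  and on \<open>PI\<close> the right side is \<open>\<infinity>\<close>, so a violation of positive
  probability must meet \<open>BP\<close>, where convexity and lower semicontinuity are
  available.\<close>

lemma closed_le_biconj:
  assumes cc: "countable_concatenation M E"
    and f: "f \<in> carrier E \<rightarrow> L0 M" and h: "h \<in> carrier E \<rightarrow> L0 M" and closed: "Tc_closed M E P h"
    and le: "\<And>y. y \<in> carrier E \<Longrightarrow> AE \<omega> in M. L0_rep (h y) \<omega> \<le> L0_rep (f y) \<omega>"
    and x: "x \<in> carrier E"
  shows "AE \<omega> in M. L0_rep (h x) \<omega> \<le> L0_rep (biconj_c M E P f x) \<omega>"
proof (rule ccontr)
  let ?F = "L0_rep (biconj_c M E P f x)"
  assume nle: "\<not> ?thesis"
  note hm = closed_measurable[OF h closed]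
  note [measurable] = hm[OF x] biconj_measurable[OF f x] MI_in_sets[of h] PI_in_sets[of h]
  have MI: "AE \<omega>\<in>MI M E h in M. L0_rep (h x) \<omega> = -\<infinity>"
    using closed x unfolding Tc_closed_def ind_const_iff[OF h x MI_in_sets, symmetric] by blast
  \<comment> \<open>Where \<open>h\<close> is \<open>\<infinity>\<close> at all vectors, so is
    \<open>f\<close>; the conjugate at the zero functional is then \<open>-\<infinity>\<close>,
    which lifts the biconjugate to \<open>\<infinity>\<close>.\<close>
  have PI: "AE \<omega>\<in>PI M E h in M. ?F \<omega> = \<infinity>"
  proof -
    let ?A = "{A \<in> sets M. \<forall>x\<in>carrier E. L0_mult M (L0_ind M A) (h x) = L0_mult M (L0_ind M A) (L0_const M \<infinity>)}"
    have ess: "is_ess_Sup M ?A (PI M E h)" unfolding PI_def by (rule is_ess_Sup_ess_Sup_sets) auto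
    have f_inf: "AE \<omega>\<in>PI M E h in M. L0_rep (f y) \<omega> = \<infinity>" if y: "y \<in> carrier E" for y
    proof -
      note [measurable] = hm[OF y]
      let ?S = "{\<omega> \<in> space M. L0_rep (h y) \<omega> = \<infinity>}"
      have S: "?S \<in> sets M" by measurable
      have "AE \<omega>\<in>A in M. \<omega> \<in> ?S" if A: "A \<in> ?A" for A
      proof -
        have "AE \<omega>\<in>A in M. L0_rep (h y) \<omega> = \<infinity>"
          using A y ind_const_iff[OF h y, of A \<infinity>] by blast
        with AE_space show ?thesis by eventually_elim auto
      qed
      with ess S have "AE \<omega>\<in>PI M E h in M. \<omega> \<in> ?S" unfolding is_ess_Sup_def by blast
      with le[OF y] show ?thesis by eventually_elim auto
    qed
    let ?g = "\<lambda>x\<in>carrier E. L0_class M (\<lambda>_. 0 :: real)"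
    have "AE \<omega> in M. L0_rep (conj_c M E P f ?g) \<omega> \<le> (if \<omega> \<in> PI M E h then -\<infinity> else \<infinity>)"
    proof (rule conj_least[OF f zero_in_dual])
      show "(\<lambda>\<omega>. if \<omega> \<in> PI M E h then -\<infinity> else \<infinity> :: ereal) \<in> borel_measurable M" by measurable
      show "AE \<omega> in M. ereal (L0_rep (?g y) \<omega>) - L0_rep (f y) \<omega> \<le> (if \<omega> \<in> PI M E h then -\<infinity> else \<infinity>)"
        if y: "y \<in> carrier E" for y
        using f_inf[OF y] by eventually_elim auto
    qed
    with biconj_upper[OF f x zero_in_dual] show ?thesis
      by eventually_elim auto
  qed
  define C0 where "C0 = {\<omega> \<in> space M. ?F \<omega> < L0_rep (h x) \<omega>} \<inter> BP M E h"
  have BP: "BP M E h \<in> sets M" unfolding BP_def by measurable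
  have C0: "C0 \<in> sets M" unfolding C0_def using BP by measurable
  have pos0: "0 < measure M C0"
  proof (rule ccontr)
    assume "\<not> ?thesis"
    then have "AE \<omega> in M. \<omega> \<notin> C0" using measure_pos_iff[OF C0] by blast
    with MI PI AE_space have "AE \<omega> in M. L0_rep (h x) \<omega> \<le> ?F \<omega>"
      by eventually_elim (auto simp: C0_def BP_def not_less)
    with nle show False ..
  qed
  \<comment> \<open>If \<open>h\<close> were infinite a.s. on \<open>C0\<close> at every vector,
    \<open>C0\<close> would belong to the family defining \<open>PI\<close>, which \<open>BP\<close>
    excludes.\<close>
  have "\<exists>y0\<in>carrier E. \<not> (AE \<omega>\<in>C0 in M. L0_rep (h y0) \<omega> = \<infinity>)"
  proof (rule ccontr)
    assume "\<not> ?thesis"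
    then have "C0 \<in> {A \<in> sets M. \<forall>x\<in>carrier E. L0_mult M (L0_ind M A) (h x) = L0_mult M (L0_ind M A) (L0_const M \<infinity>)}"
      using C0 ind_const_iff[OF h _ C0, of _ \<infinity>] by blast
    moreover have "is_ess_Sup M {A \<in> sets M. \<forall>x\<in>carrier E. L0_mult M (L0_ind M A) (h x) = L0_mult M (L0_ind M A) (L0_const M \<infinity>)} (PI M E h)"
      unfolding PI_def by (rule is_ess_Sup_ess_Sup_sets) auto
    ultimately have "AE \<omega>\<in>C0 in M. \<omega> \<in> PI M E h" unfolding is_ess_Sup_def by blast
    then have "AE \<omega> in M. \<omega> \<notin> C0" by eventually_elim (auto simp: C0_def BP_def)
    with measure_pos_iff[OF C0] pos0 show False by simp
  qed
  then obtain y0 where y0: "y0 \<in> carrier E" and fin: "\<not> (AE \<omega>\<in>C0 in M. L0_rep (h y0) \<omega> = \<infinity>)" ..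
  note [measurable] = hm[OF y0]
  define C1 where "C1 = C0 \<inter> {\<omega> \<in> space M. L0_rep (h y0) \<omega> < \<infinity>}"
  have C1: "C1 \<in> sets M" unfolding C1_def using C0 by measurable
  have pos1: "0 < measure M C1"
  proof (rule ccontr)
    assume "\<not> ?thesis"
    then have "AE \<omega> in M. \<omega> \<notin> C1" using measure_pos_iff[OF C1] by blast
    with AE_space have "AE \<omega>\<in>C0 in M. L0_rep (h y0) \<omega> = \<infinity>"
      by eventually_elim (auto simp: C1_def)
    with fin show False ..
  qed
  \<comment> \<open>Levels are taken from an enumeration of the rationals, since only countably many
    candidates can be sorted out by \<open>ex_pos_subset\<close>.\<close>
  let ?rat = "\<lambda>n. of_rat (from_nat_into UNIV n) :: real"
  have "\<exists>n. 0 < measure M (C1 \<inter> {\<omega> \<in> space M. ?F \<omega> < ereal (?rat n) \<and> ereal (?rat n) < L0_rep (h x) \<omega>})"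
  proof (rule ex_pos_subset[OF C1 pos1])
    show "{\<omega> \<in> space M. ?F \<omega> < ereal (?rat n) \<and> ereal (?rat n) < L0_rep (h x) \<omega>} \<in> sets M" for n by measurable
    show "AE \<omega>\<in>C1 in M. (\<exists>n. ?F \<omega> < ereal (?rat n) \<and> ereal (?rat n) < L0_rep (h x) \<omega>)"
    proof (intro AE_I2 impI)
      fix \<omega> assume "\<omega> \<in> C1"
      then have "?F \<omega> < L0_rep (h x) \<omega>" by (simp add: C1_def C0_def)
      then obtain a where a: "?F \<omega> < ereal a" "ereal a < L0_rep (h x) \<omega>" using ereal_dense2 by blast
      from ereal_dense2[OF a(2)] obtain b where b: "ereal a < ereal b" "ereal b < L0_rep (h x) \<omega>" by blast
      from b(1) obtain c :: rat where c: "a < of_rat c" "of_rat c < b" using of_rat_dense by auto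
      obtain n where n: "from_nat_into UNIV n = c"
        using from_nat_into_surj[of "UNIV :: rat set" c] by auto
      have "?F \<omega> < ereal (of_rat c)" by (rule less_trans[OF a(1)]) (use c in simp)
      moreover have "ereal (of_rat c) < L0_rep (h x) \<omega>" by (rule less_trans[OF _ b(2)]) (use c in simp)
      ultimately show "\<exists>n. ?F \<omega> < ereal (?rat n) \<and> ereal (?rat n) < L0_rep (h x) \<omega>"
        using n by (intro exI[of _ n]) simp
    qed
  qed
  then obtain r :: real where r: "0 < measure M (C1 \<inter> {\<omega> \<in> space M. ?F \<omega> < ereal r \<and> ereal r < L0_rep (h x) \<omega>})" by blast
  define C2 where "C2 = C1 \<inter> {\<omega> \<in> space M. ?F \<omega> < ereal r \<and> ereal r < L0_rep (h x) \<omega>}"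
  have C2: "C2 \<in> sets M" unfolding C2_def using C1 by measurable
  have pos2: "0 < measure M C2" using r by (simp add: C2_def)
  have C2_BP: "C2 \<subseteq> BP M E h" by (auto simp: C2_def C1_def C0_def)
  have fin2: "AE \<omega>\<in>C2 in M. L0_rep (h y0) \<omega> < \<infinity>"
    and lt2: "AE \<omega>\<in>C2 in M. ereal r < L0_rep (h x) \<omega>"
    by (auto simp: C2_def C1_def intro!: AE_I2)
  from closed_lipschitz_minorant[OF h closed cc C2 pos2 C2_BP y0 fin2 x lt2] obtain Q K C where
    Q: "finite Q" "Q \<noteq> {}" "Q \<subseteq> P" and K: "0 < K" and C: "C \<in> sets M" "C \<subseteq> C2" "0 < measure M C"
    and minorant: "\<And>y. y \<in> carrier E \<Longrightarrow>
      AE \<omega>\<in>C in M. ereal (r - K * sn Q (y \<ominus>\<^bsub>E\<^esub> x) \<omega>) \<le> L0_rep (h y) \<omega>"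
    by (elim exE conjE) simp
  have C_BP: "C \<subseteq> BP M E h" using C C2_BP by blast
  have finC: "AE \<omega>\<in>C in M. L0_rep (h y0) \<omega> < \<infinity>"
    using fin2 by eventually_elim (use C(2) in auto)
  have "\<exists>g\<in>Tc_dual M E P. \<forall>y\<in>carrier E.
    AE \<omega>\<in>C in M. ereal (r + L0_rep (g y) \<omega> - L0_rep (g x) \<omega>) \<le> L0_rep (h y) \<omega>"
    by (rule ex_supporting_dual[OF h C(1) _ Q K x minorant])
      (rule closed_convex[OF h closed C(1,3) C_BP y0 finC])
  then obtain g where g: "g \<in> Tc_dual M E P" and supp: "\<And>y. y \<in> carrier E \<Longrightarrow>
    AE \<omega>\<in>C in M. ereal (r + L0_rep (g y) \<omega> - L0_rep (g x) \<omega>) \<le> L0_rep (h y) \<omega>" by blast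
  note [measurable] = L0_rep_measurable[OF dual_in_L0[OF g x]] C(1)
  \<comment> \<open>Off \<open>C\<close> the supporting inequality says nothing, so the bound is
    left at \<open>\<infinity>\<close> there.\<close>
  have "AE \<omega> in M. L0_rep (conj_c M E P f g) \<omega> \<le> (if \<omega> \<in> C then ereal (L0_rep (g x) \<omega> - r) else \<infinity>)"
  proof (rule conj_least[OF f g])
    show "(\<lambda>\<omega>. if \<omega> \<in> C then ereal (L0_rep (g x) \<omega> - r) else \<infinity>) \<in> borel_measurable M" by measurable
    show "AE \<omega> in M. ereal (L0_rep (g y) \<omega>) - L0_rep (f y) \<omega> \<le> (if \<omega> \<in> C then ereal (L0_rep (g x) \<omega> - r) else \<infinity>)"
      if y: "y \<in> carrier E" for y
      using supp[OF y] le[OF y]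
    proof eventually_elim
      case (elim \<omega>)
      show ?case
      proof (cases "\<omega> \<in> C")
        case True
        then have "ereal (r + L0_rep (g y) \<omega> - L0_rep (g x) \<omega>) \<le> L0_rep (f y) \<omega>"
          using elim order_trans by blast
        then show ?thesis using True by (cases "L0_rep (f y) \<omega>") auto
      qed simp
    qed
  qed
  \<comment> \<open>On \<open>C\<close> the biconjugate is at least \<open>g x - (g x - r)\<close>,
    that is \<open>r\<close>, although \<open>C\<close> was chosen where it is below
    \<open>r\<close>.\<close>
  with biconj_upper[OF f x g] have "AE \<omega> in M. \<omega> \<notin> C"
  proof eventually_elim
    case (elim \<omega>)
    show ?case
    proof
      assume w: "\<omega> \<in> C"
      then have "?F \<omega> < ereal r" using C(2) by (auto simp: C2_def)
      with elim w show False
        by (cases "L0_rep (conj_c M E P f g) \<omega>"; cases "?F \<omega>") auto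
    qed
  qed
  with measure_pos_iff[OF C(1)] C(3) show False by simp
qed

end

theorem corollary5p15:
  fixes M :: "'a measure"
    and E :: "(('a \<Rightarrow> real) set, 'e) module"
    and P :: "('e \<Rightarrow> ('a \<Rightarrow> real) set) set"
    and f :: "'e \<Rightarrow> ('a \<Rightarrow> ereal) set"
  assumes "rlc_module M E P"
    and "countable_concatenation M E"
    and "f \<in> carrier E \<rightarrow> L0 M"
    and "L0_local M E f"
  shows "biconj_c M E P f = Cl_c M E P f"
proof -
  interpret rlc_module M E P by (rule assms)
  note f = assms(3)
  let ?S = "{h \<in> carrier E \<rightarrow>\<^sub>E L0 M. Tc_closed M E P h \<and> h \<sqsubseteq>\<^bsub>fun_order M E\<^esub> f}"
  have le_iff: "h \<sqsubseteq>\<^bsub>fun_order M E\<^esub> k \<longleftrightarrow> (\<forall>x\<in>carrier E. AE \<omega> in M. L0_rep (h x) \<omega> \<le> L0_rep (k x) \<omega>)"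
    for h k :: "'e \<Rightarrow> ('a \<Rightarrow> ereal) set" by (simp add: fun_order_def L0_le_iff)
  have ext: "biconj_c M E P f \<in> carrier E \<rightarrow>\<^sub>E L0 M"
    using biconj_in_L0[OF f] by (auto simp: biconj_c_def)
  have greatest: "greatest (fun_order M E) (biconj_c M E P f) ?S"
    unfolding greatest_def
  proof (intro conjI ballI)
    show "?S \<subseteq> carrier (fun_order M E)" by (auto simp: fun_order_def)
    show "biconj_c M E P f \<in> ?S"
      using ext biconj_closed[OF f] biconj_le[OF f] by (simp add: le_iff)
    fix h assume h: "h \<in> ?S"
    then have "h \<in> carrier E \<rightarrow> L0 M" by auto
    with h show "h \<sqsubseteq>\<^bsub>fun_order M E\<^esub> biconj_c M E P f"
      using closed_le_biconj[OF assms(2) f, of h] by (simp add: le_iff)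
  qed
  \<comment> \<open>The description in \<open>Cl_c\<close> requires uniqueness: two greatest
    elements agree a.s. at each vector, hence as classes, and extensionality settles the
    rest.\<close>
  show ?thesis unfolding Cl_c_def
  proof (rule the_equality[symmetric])
    show "greatest (fun_order M E) (biconj_c M E P f) ?S" by (rule greatest)
    fix h assume h: "greatest (fun_order M E) h ?S"
    then have hE: "h \<in> carrier E \<rightarrow>\<^sub>E L0 M" by (simp add: greatest_def)
    have "h \<sqsubseteq>\<^bsub>fun_order M E\<^esub> biconj_c M E P f" "biconj_c M E P f \<sqsubseteq>\<^bsub>fun_order M E\<^esub> h"
      using h greatest unfolding greatest_def by blast+
    then have "AE \<omega> in M. L0_rep (h x) \<omega> = L0_rep (biconj_c M E P f x) \<omega>" if x: "x \<in> carrier E" for x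
      using x unfolding le_iff by (auto elim!: eventually_elim2 ballE[of _ _ x] intro: antisym)
    then have "h x = biconj_c M E P f x" if x: "x \<in> carrier E" for x
      using L0_eq_iff[OF PiE_mem[OF hE x] PiE_mem[OF ext x]] x by blast
    with hE ext show "h = biconj_c M E P f" by (intro PiE_ext)
  qed
qed

end
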